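(* The vector fields $\zeta\mapsto[\zeta,U(\zeta)]$ and $\zeta\mapsto[\zeta,V(\zeta)]$ on $\mathcal{P}_2$ induce an action $\phi$ of $\mathbb{R}^2$ on $\mathcal{P}_2$, i.e. there is a group action $\mathbb{R}^2\ni(x,y)\mapsto\phi(x,y)$, $\phi(x,y):\mathcal{P}_2\to\mathcal{P}_2$, such that for every $\zeta_0\in\mathcal{P}_2$ the map $\zeta(x,y)=\phi(x,y)\zeta_0$ is defined for all $(x,y)\in\mathbb{R}^2$ and satisfies $\zeta(0,0)=\zeta_0$, $\partial_x\zeta=[\zeta,U(\zeta)]$, $\partial_y\zeta=[\zeta,V(\zeta)]$. For every $a\in\mathcal{M}_2$ the isospectral set $I(a)\subset\mathcal{P}_2$ is compact, and the following hold: 1. For $a\in\mathcal{M}_2^1$ the isospectral set $I(a)$ is a two-dimensional compact submanifold of $\mathcal{P}_2$ on which the group action is transitive, i.e. $I(a)=\{\phi(x,y)\zeta\mid(x,y)\in\mathbb{R}^2\}$ for any $\zeta\in I(a)$. 2. For $a\in\mathcal{M}_2^2$ the isospectral set $I(a)$ is a one-dimensional compact subset of $\mathcal{P}_2$ on which the group action is transitive. 3. For $a\in\mathcal{M}_2^3\cup\mathcal{M}_2^4$ the isospectral set $I(a)$ consists of a single fixed point of the group action. 4. For $a\in\mathcal{M}_2^5$ the isospectral set is the union of two disjoint orbits of the group action, $I(a)=K_a\cup L_a$, where, with $\lambda_1$ and $\bar\lambda_1^{-1}$ denoting the double roots of $a$, $$K_a=\{\zeta\in I(a)\mid\zeta|_{\lambda}\neq0\text{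 for }\lambda\in\{\lambda_1,\bar\lambda_1^{-1}\}\},\qquad L_a=\{\zeta\in I(a)\mid\zeta|_{\lambda}=0\text{ for }\lambda\in\{\lambda_1,\bar\lambda_1^{-1}\}\}.$$ Here $K_a$ is a two-dimensional non-compact submanifold of $\mathcal{P}_2$ with closure $\bar K_a=I(a)$, and $L_a$ consists of a single point.
   Context: $\mathbb{C}^d[\lambda]$ denotes the complex polynomials in $\lambda$ of degree at most $d$, $\mathbb{S}^1$ the unit circle in $\mathbb{C}$, and $\mathbb{R}^+$ the positive reals. The space of potentials is $$\mathcal{P}_2=\left\{\zeta=\begin{pmatrix}\alpha\lambda-\bar\alpha\lambda^2&-\gamma^{-1}+\beta\lambda-\gamma\lambda^2\\ \gamma\lambda-\bar\beta\lambda^2+\gamma^{-1}\lambda^3&-\alpha\lambda+\bar\alpha\lambda^2\end{pmatrix}\;\middle|\;\alpha,\beta\in\mathbb{C},\ \gamma\in\mathbb{R}^+\right\},$$ identified with the manifold $\mathbb{C}\times\mathbb{C}\times\mathbb{R}^+$ via $(\alpha,\beta,\gamma)$. For $\zeta\in\mathcal{P}_2$, $$U(\zeta)=\begin{pmatrix}\frac{\alpha-\bar\alpha}{2}&-\gamma^{-1}\lambda^{-1}-\gamma\\ \gamma+\gamma^{-1}\lambda&\frac{\bar\alpha-\alpha}{2}\end{pmatrix},\qquad V(\zeta)=i\begin{pmatrix}\frac{\alpha+\bar\alpha}{2}&-\gamma^{-1}\lambda^{-1}+\gamma\\ \gamma-\gamma^{-1}\lambda&-\frac{\alpha+\bar\alpha}{2}\end{pmatrix},$$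 and the commutators $[\zeta,U(\zeta)]$, $[\zeta,V(\zeta)]$ define (commuting) vector fields on $\mathcal{P}_2$. For $\zeta\in\mathcal{P}_2$ one has $\det\zeta=\lambda a(\lambda)$ with a polynomial $a$ of degree four. Set $\mathcal{M}_2=\{a\in\mathbb{C}^4[\lambda]\mid\lambda a(\lambda)=\det\zeta\text{ for some }\zeta\in\mathcal{P}_2\}$ and, for $a\in\mathcal{M}_2$, $I(a)=\{\zeta\in\mathcal{P}_2\mid\det\zeta=\lambda a(\lambda)\}$ (the isospectral set). $\mathcal{M}_2$ is the disjoint union of: $\mathcal{M}_2^1$: $a\in\mathcal{M}_2$ with four pairwise distinct simple roots, none in $\mathbb{S}^1$; $\mathcal{M}_2^2$: $a\in\mathcal{M}_2$ with one double root in $\mathbb{S}^1$ and two simple roots not in $\mathbb{S}^1$; $\mathcal{M}_2^3$: $a\in\mathcal{M}_2$ with two distinct double roots in $\mathbb{S}^1$; $\mathcal{M}_2^4$: $a\in\mathcal{M}_2$ with a fourth-order root in $\mathbb{S}^1$; $\mathcal{M}_2^5$: $a\in\mathcal{M}_2$ with two distinct double roots not in $\mathbb{S}^1$. *)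

theory Defs
  imports "HOL-Analysis.Analysis" "HOL-Computational_Algebra.Polynomial"
begin

text \<open>
  A potential is represented by its coordinates \<open>(\<alpha>, \<beta>, \<gamma>)\<close>; the manifold structure and the topology
  of the space of potentials are those of the open set \<open>P2\<close>.
\<close>

type_synonym potential = "complex \<times> complex \<times> real"

definition P2 :: "potential set" where
  "P2 = {(\<alpha>, \<beta>, \<gamma>) | \<alpha> \<beta> \<gamma>. \<gamma> > 0}"

fun zeta :: "potential \<Rightarrow> complex poly ^ 2 ^ 2" where
  "zeta (\<alpha>, \<beta>, \<gamma>) = vector [
     vector [[:0, \<alpha>, - cnj \<alpha>:],
             [:- of_real (inverse \<gamma>), \<beta>, - of_real \<gamma>:]],
     vector [[:0, of_real \<gamma>, - cnj \<beta>, of_real (inverse \<gamma>):],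
             [:0, - \<alpha>, cnj \<alpha>:]]]"

lemma inj_zeta: "inj zeta"
proof (rule injI)
  fix p q :: potential
  assume eq: "zeta p = zeta q"
  obtain a b c a' b' c' where [simp]: "p = (a, b, c)" "q = (a', b', c')"
    by (metis prod_cases3)
  have "zeta p $ 1 $ 1 = zeta q $ 1 $ 1" "zeta p $ 1 $ 2 = zeta q $ 1 $ 2"
    using eq by auto
  then show "p = q"
    by (simp add: vector_2)
qed

definition zeta_at :: "potential \<Rightarrow> complex \<Rightarrow> complex ^ 2 ^ 2" where
  "zeta_at p z = (\<chi> i j. poly (zeta p $ i $ j) z)"

text \<open>
  \<open>U\<close> and \<open>V\<close> are Laurent polynomials in the spectral parameter, given here by their values; they are
  only meaningful for a parameter \<open>z \<noteq> 0\<close>.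
\<close>

fun U :: "potential \<Rightarrow> complex \<Rightarrow> complex ^ 2 ^ 2" where
  "U (\<alpha>, \<beta>, \<gamma>) z = vector [
     vector [(\<alpha> - cnj \<alpha>) / 2,
             - of_real (inverse \<gamma>) * inverse z - of_real \<gamma>],
     vector [of_real \<gamma> + of_real (inverse \<gamma>) * z,
             (cnj \<alpha> - \<alpha>) / 2]]"

fun V :: "potential \<Rightarrow> complex \<Rightarrow> complex ^ 2 ^ 2" where
  "V (\<alpha>, \<beta>, \<gamma>) z = vector [
     vector [\<i> * ((\<alpha> + cnj \<alpha>) / 2),
             \<i> * (- of_real (inverse \<gamma>) * inverse z + of_real \<gamma>)],
     vector [\<i> * (of_real \<gamma> - of_real (inverse \<gamma>) * z),
             \<i> * (- (\<alpha> + cnj \<alpha>) / 2)]]"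

definition commutator :: "complex ^ 2 ^ 2 \<Rightarrow> complex ^ 2 ^ 2 \<Rightarrow> complex ^ 2 ^ 2" where
  "commutator A B = A ** B - B ** A"

definition M2 :: "complex poly set" where
  "M2 = {a. degree a \<le> 4 \<and> (\<exists>p\<in>P2. [:0, 1:] * a = det (zeta p))}"

definition isospectral :: "complex poly \<Rightarrow> potential set" where
  "isospectral a = {p \<in> P2. det (zeta p) = [:0, 1:] * a}"

text \<open>
  Elements of \<open>M2\<close> are nonzero of degree four, so the multiplicities listed below account for all
  roots. The unit circle is \<open>sphere 0 1\<close>.
\<close>

definition M2_1 :: "complex poly set" where
  "M2_1 = {a \<in> M2. \<exists>A. card A = 4 \<and> (\<forall>z\<in>A. order z a = 1 \<and> z \<notin> sphere 0 1)}"

definition M2_2 :: "complex poly set" where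
  "M2_2 = {a \<in> M2. \<exists>z w1 w2. z \<in> sphere 0 1 \<and> order z a = 2 \<and> w1 \<noteq> w2 \<and>
     w1 \<notin> sphere 0 1 \<and> order w1 a = 1 \<and> w2 \<notin> sphere 0 1 \<and> order w2 a = 1}"

definition M2_3 :: "complex poly set" where
  "M2_3 = {a \<in> M2. \<exists>z w. z \<noteq> w \<and> z \<in> sphere 0 1 \<and> w \<in> sphere 0 1 \<and>
     order z a = 2 \<and> order w a = 2}"

definition M2_4 :: "complex poly set" where
  "M2_4 = {a \<in> M2. \<exists>z\<in>sphere 0 1. order z a = 4}"

definition M2_5 :: "complex poly set" where
  "M2_5 = {a \<in> M2. \<exists>z w. z \<noteq> w \<and> z \<notin> sphere 0 1 \<and> w \<notin> sphere 0 1 \<and>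
     order z a = 2 \<and> order w a = 2}"

definition K_set :: "complex poly \<Rightarrow> complex \<Rightarrow> potential set" where
  "K_set a l = {p \<in> isospectral a. \<forall>z\<in>{l, inverse (cnj l)}. zeta_at p z \<noteq> 0}"

definition L_set :: "complex poly \<Rightarrow> complex \<Rightarrow> potential set" where
  "L_set a l = {p \<in> isospectral a. \<forall>z\<in>{l, inverse (cnj l)}. zeta_at p z = 0}"

definition additive_action_on :: "('g::group_add \<Rightarrow> 'p \<Rightarrow> 'p) \<Rightarrow> 'p set \<Rightarrow> bool" where
  "additive_action_on \<phi> P \<longleftrightarrow>
     (\<forall>g. \<forall>p\<in>P. \<phi> g p \<in> P) \<and>
     (\<forall>p\<in>P. \<phi> 0 p = p) \<and>
     (\<forall>g h. \<forall>p\<in>P. \<phi> (g + h) p = \<phi> g (\<phi> h p))"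

definition action_orbit :: "('g \<Rightarrow> 'p \<Rightarrow> 'p) \<Rightarrow> 'p \<Rightarrow> 'p set" where
  "action_orbit \<phi> p = range (\<lambda>g. \<phi> g p)"

definition transitive_action_on :: "('g \<Rightarrow> 'p \<Rightarrow> 'p) \<Rightarrow> 'p set \<Rightarrow> bool" where
  "transitive_action_on \<phi> S \<longleftrightarrow> (\<forall>p\<in>S. S = action_orbit \<phi> p)"

text \<open>
  \<open>C_k_on k f S\<close> is meant for open \<open>S\<close>. In finite dimension it says that \<open>f\<close> is \<open>k\<close> times continuously
  differentiable: all iterated directional derivatives up to order \<open>k\<close> exist and are continuous.
\<close>

primrec C_k_on ::
  "nat \<Rightarrow> ('a::euclidean_space \<Rightarrow> 'b::euclidean_space) \<Rightarrow> 'a set \<Rightarrow> bool" where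
  "C_k_on 0 f S \<longleftrightarrow> continuous_on S f"
| "C_k_on (Suc k) f S \<longleftrightarrow>
     (\<forall>x\<in>S. f differentiable (at x)) \<and>
     (\<forall>v. C_k_on k (\<lambda>x. frechet_derivative f (at x) v) S)"

definition smooth_on :: "('a::euclidean_space \<Rightarrow> 'b::euclidean_space) \<Rightarrow> 'a set \<Rightarrow> bool" where
  "smooth_on f S \<longleftrightarrow> (\<forall>k. C_k_on k f S)"

text \<open>
  Smooth embedded \<open>k\<close>-dimensional submanifold (without boundary) \<open>S\<close> of an open set \<open>M\<close> of a Euclidean
  space: around each point of \<open>S\<close> there is a smooth chart of \<open>M\<close> that maps \<open>S\<close> to a \<open>k\<close>-dimensional
  linear subspace. Closedness of \<open>S\<close> in \<open>M\<close> is not required.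
\<close>

definition submanifold :: "nat \<Rightarrow> 'a::euclidean_space set \<Rightarrow> 'a set \<Rightarrow> bool" where
  "submanifold k M S \<longleftrightarrow> S \<subseteq> M \<and>
     (\<forall>p\<in>S. \<exists>W W' (f::'a \<Rightarrow> 'a) g L.
        open W \<and> p \<in> W \<and> W \<subseteq> M \<and> open W' \<and>
        homeomorphism W W' f g \<and> smooth_on f W \<and> smooth_on g W' \<and>
        subspace L \<and> dim L = k \<and> f ` (W \<inter> S) = W' \<inter> L)"

text \<open>Topological dimension exactly one, with the small inductive dimension of the library.\<close>

definition one_dimensional :: "'a::topological_space set \<Rightarrow> bool" where
  "one_dimensional S \<longleftrightarrow> top_of_set S dim_le 1 \<and> \<not> top_of_set S dim_le 0"

end

theory Submission
  imports Defs
begin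

text \<open>
  The determinant of a potential is determined by the complex function \<open>spec1\<close> and the real function
  \<open>spec2\<close> of its coordinates, so the isospectral sets are the common fibres of these two functions.
  \<open>spec2\<close> is a sum of squares that bounds all coordinates and also keeps \<open>\<gamma>\<close> away from \<open>0\<close>; hence fibres are
  compact, and the two commutator fields, which preserve \<open>spec1\<close> and \<open>spec2\<close>, have global flows. Their
  bracket vanishes, so the flows commute and form an action of the plane; this is carried out for
  arbitrary fields with a proper conserved function in the two locales below.

  At a potential \<open>(\<alpha>, \<beta>, \<gamma>)\<close> the two fields are linearly independent, and the derivative of
  \<open>(spec1, spec2)\<close> is surjective, unless \<open>\<zeta>\<close> vanishes at a point of the unit circle or \<open>\<alpha> = 0\<close>, \<open>\<gamma> = 1\<close>
  and \<open>\<beta>\<close> is real (\<open>fields_independent\<close>, \<open>spec_derivative_surj\<close>). Away from these singular potentials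
  the fibre is a smooth surface (\<open>local_chart\<close>) and the orbit is open in it (\<open>nonsingular_orbit_open\<close>).

  Transitivity is obtained from the maximum of \<open>\<gamma>\<close>, without computing the topology of the fibre. In a
  compact fibre all of whose orbits are open every orbit is also closed, so \<open>\<gamma>\<close> has a maximum on
  every orbit. There \<open>\<alpha> = 0\<close>, and the second derivatives along the orbit give
  \<open>\<bar>\<beta> \<gamma> - cnj \<beta> / \<gamma>\<bar> \<le> \<gamma>\<^sup>2 - 1 / \<gamma>\<^sup>2\<close>. For \<open>\<alpha> = 0\<close> the fibre is described by one equation for
  \<open>T = (\<gamma> + 1 / \<gamma>)\<^sup>2\<close>, namely \<open>c\<^sub>1\<^sup>2 / T + c\<^sub>2\<^sup>2 / (T - 4) + T = const\<close> with a convex left hand side, and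
  the inequality says that the left hand side is nondecreasing at \<open>T\<close>. So there is only one such point in
  the fibre (\<open>orbit_max_unique\<close>), and it lies on every orbit.

  If \<open>a\<close> has four simple roots off the circle, the whole fibre is nonsingular. A double root \<open>z\<close> on the
  circle forces \<open>\<zeta>\<close> to vanish at \<open>z\<close>; what is left of the fibre is the curve \<open>r\<^sup>2 + \<gamma>\<^sup>2 + 1 / \<gamma>\<^sup>2 = E\<close>, a circle
  on which the same maximum argument applies, or a point. If there are two double roots off the
  circle, they are \<open>r\<close> and \<open>1 / r\<close> for a real \<open>r\<close>, and the fibre has exactly one singular potential, its
  node \<open>(0, r + 1 / r, 1)\<close>, which is fixed. An orbit in the complement of the node is closed there, and \<open>\<gamma>\<close>
  equals \<open>1\<close> at the node, so an extremum of \<open>\<gamma>\<close> different from \<open>1\<close> on the closure of the orbit is attained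
  on the orbit. There are only two candidates for it, and an explicit arc avoiding the node joins them;
  hence there is one orbit. A second explicit arc runs into the node and shows that the node lies in the
  closure of this orbit.
\<close>

section \<open>Global solutions of Lipschitz differential equations\<close>

lemma vector_derivative_imp_continuous_on:
  assumes "\<And>t. (F has_vector_derivative f t) (at t)"
  shows "continuous_on S F"
  using assms has_vector_derivative_continuous by (intro continuous_at_imp_continuous_on) blast

lemma antiderivative_from_0:
  fixes f :: "real \<Rightarrow> 'a::euclidean_space"
  assumes "continuous_on UNIV f"
  obtains F where "F 0 = 0" "\<And>t. (F has_vector_derivative f t) (at t)"
proof -
  have "\<exists>F. \<forall>x. -\<infinity> < ereal x \<longrightarrow> ereal x < \<infinity> \<longrightarrow> (F has_vector_derivative f x) (at x)"
    by (rule einterval_antiderivative) (use assms continuous_on_eq_continuous_at in auto)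
  then obtain F where F: "\<And>t. (F has_vector_derivative f t) (at t)"
    by auto
  show thesis
  proof (rule that[of "\<lambda>t. F t - F 0"])
    show "((\<lambda>t. F t - F 0) has_vector_derivative f t) (at t)" for t
      using has_vector_derivative_diff[OF F has_vector_derivative_const] by simp
  qed simp
qed

lemma has_vector_derivative_reflect:
  assumes "(u has_vector_derivative d) (at (- t :: real))"
  shows "((\<lambda>t. u (- t)) has_vector_derivative - d) (at t)"
proof -
  have "(uminus has_vector_derivative - 1) (at t)"
    using has_vector_derivative_minus[OF has_vector_derivative_id] by (simp add: id_def)
  from vector_diff_chain_at[OF this assms] show ?thesis
    by (simp add: o_def)
qed

lemma antiderivative_power_bound_nonneg:
  fixes F :: "real \<Rightarrow> 'a::real_normed_vector"
  assumes F: "\<And>t. (F has_vector_derivative f t) (at t)" "F 0 = 0"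
    and le: "\<And>s. \<bar>s\<bar> \<le> T \<Longrightarrow> norm (f s) \<le> C * \<bar>s\<bar> ^ n" and t: "0 \<le> t" "t \<le> T"
  shows "norm (F t) \<le> C * t ^ Suc n / Suc n"
proof (cases "t = 0")
  case False
  then have "0 < t" using t by simp
  have "norm (F t - F 0) \<le> C * t ^ Suc n / Suc n - C * 0 ^ Suc n / Suc n"
  proof (rule differentiable_bound_general[of 0 t F "\<lambda>t. C * t ^ Suc n / Suc n" f "\<lambda>t. C * t ^ n"])
    show "continuous_on {0..t} F"
      using F(1) by (rule vector_derivative_imp_continuous_on)
    show "norm (f s) \<le> C * s ^ n" if "0 < s" "s < t" for s
      using le[of s] that t by simp
    show "((\<lambda>t. C * t ^ Suc n / Suc n) has_vector_derivative C * x ^ n) (at x)" for x :: real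
    proof -
      have "((\<lambda>t. C * t ^ Suc n / Suc n) has_real_derivative C * (Suc n * x ^ n) / Suc n) (at x)"
        by (intro derivative_eq_intros refl | simp)+
      then show ?thesis
        by (simp add: has_real_derivative_iff_has_vector_derivative)
    qed
  qed (use \<open>0 < t\<close> t F(1) le in \<open>auto intro!: continuous_intros\<close>)
  then show ?thesis using F(2) by simp
qed (use F in simp)

lemma antiderivative_power_bound:
  fixes F :: "real \<Rightarrow> 'a::real_normed_vector"
  assumes F: "\<And>t. (F has_vector_derivative f t) (at t)" "F 0 = 0"
    and le: "\<And>s. \<bar>s\<bar> \<le> T \<Longrightarrow> norm (f s) \<le> C * \<bar>s\<bar> ^ n" and t: "\<bar>t\<bar> \<le> T"
  shows "norm (F t) \<le> C * \<bar>t\<bar> ^ Suc n / Suc n"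
proof (cases "0 \<le> t")
  case True
  then show ?thesis using antiderivative_power_bound_nonneg[OF F le True] t by simp
next
  case False
  have "norm (- f (- s)) \<le> C * \<bar>s\<bar> ^ n" if "\<bar>s\<bar> \<le> T" for s
    using le[of "- s"] that by simp
  then have "norm (F (- (- t))) \<le> C * (- t) ^ Suc n / Suc n"
    by (intro antiderivative_power_bound_nonneg[where f = "\<lambda>t. - f (- t)" and T = T])
      (use F t False in \<open>auto intro: has_vector_derivative_reflect\<close>)
  then show ?thesis using False by simp
qed


text \<open>
  Picard iteration on the whole real line at once: with \<open>M = norm (G p)\<close> the \<open>n\<close>-th increment at time \<open>t\<close> is
  at most \<open>M * L ^ n * \<bar>t\<bar> ^ (n + 1) / fact (n + 1)\<close>, so the iterates converge uniformly on bounded intervals, and the limit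
  satisfies the integral equation.
\<close>

lemma lipschitz_ode_solution_exists:
  fixes G :: "'a::euclidean_space \<Rightarrow> 'a"
  assumes lip: "L-lipschitz_on UNIV G"
  obtains u where "u 0 = p" "\<And>t. (u has_vector_derivative G (u t)) (at t)"
proof -
  have L: "norm (G x - G y) \<le> L * norm (x - y)" for x y
    using lipschitz_onD[OF lip, of x y] by (simp add: dist_norm)
  have L0: "0 \<le> L"
    using lip by (rule lipschitz_on_nonneg)
  have contG: "continuous_on S G" for S
    using lipschitz_on_continuous_on[OF lip] continuous_on_subset by blast
  define J :: "(real \<Rightarrow> 'a) \<Rightarrow> real \<Rightarrow> 'a"
    where "J f = (SOME F. F 0 = 0 \<and> (\<forall>t. (F has_vector_derivative f t) (at t)))" for f
  have J: "J f 0 = 0" "\<And>t. (J f has_vector_derivative f t) (at t)"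
    if "continuous_on UNIV f" for f
  proof -
    have "\<exists>F. F 0 = 0 \<and> (\<forall>t. (F has_vector_derivative f t) (at t))"
      using antiderivative_from_0[OF that] by metis
    from someI_ex[OF this] show "J f 0 = 0" "\<And>t. (J f has_vector_derivative f t) (at t)"
      by (simp_all add: J_def)
  qed
  have J_cont: "continuous_on UNIV (J f)" if "continuous_on UNIV f" for f
    using J(2)[OF that] by (rule vector_derivative_imp_continuous_on)
  define u where "u = rec_nat (\<lambda>_. p) (\<lambda>_ v t. p + J (\<lambda>s. G (v s)) t)"
  have u0: "u 0 = (\<lambda>_. p)" and uSuc: "\<And>n. u (Suc n) = (\<lambda>t. p + J (\<lambda>s. G (u n s)) t)"
    by (simp_all add: u_def)
  have Gcont: "continuous_on UNIV (\<lambda>s. G (v s))" if "continuous_on UNIV v" for v :: "real \<Rightarrow> 'a"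
    using continuous_on_compose2[OF contG that] by auto
  have ucont: "continuous_on UNIV (u n)" for n
  proof (induction n)
    case (Suc n)
    then show ?case
      unfolding uSuc by (intro continuous_on_add continuous_on_const J_cont Gcont)
  qed (simp add: u0)
  define M where "M = norm (G p)"
  have step: "norm (u (Suc n) t - u n t) \<le> M * L ^ n * \<bar>t\<bar> ^ Suc n / fact (Suc n)" for n t
  proof (induction n arbitrary: t)
    case 0
    have "norm (J (\<lambda>s. G p) t) \<le> M * \<bar>t\<bar> ^ Suc 0 / Suc 0"
      by (rule antiderivative_power_bound[where f = "\<lambda>_. G p" and T = "\<bar>t\<bar>"])
        (use J[of "\<lambda>_. G p"] in \<open>auto simp: M_def\<close>)
    then show ?case by (simp add: u0 uSuc)
  next
    case (Suc n)
    let ?f = "\<lambda>s. G (u (Suc n) s) - G (u n s)"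
    have "norm (?f s) \<le> (M * L ^ Suc n / fact (Suc n)) * \<bar>s\<bar> ^ Suc n" for s
    proof -
      have "norm (?f s) \<le> L * norm (u (Suc n) s - u n s)" by (rule L)
      also have "\<dots> \<le> L * (M * L ^ n * \<bar>s\<bar> ^ Suc n / fact (Suc n))"
        using Suc.IH L0 by (rule mult_left_mono)
      finally show ?thesis by (simp add: mult_ac)
    qed
    then have "norm (J (\<lambda>s. G (u (Suc n) s)) t - J (\<lambda>s. G (u n s)) t)
      \<le> (M * L ^ Suc n / fact (Suc n)) * \<bar>t\<bar> ^ Suc (Suc n) / Suc (Suc n)"
      by (intro antiderivative_power_bound[where f = ?f and T = "\<bar>t\<bar>"] has_vector_derivative_diff)
        (auto simp: J[OF Gcont[OF ucont]])
    also have "\<dots> = M * L ^ Suc n * \<bar>t\<bar> ^ Suc (Suc n) / fact (Suc (Suc n))"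
      by (simp add: field_simps)
    finally show ?case by (simp add: uSuc[of "Suc n"] uSuc[of n])
  qed
  define w where "w t = p + (\<Sum>i. u (Suc i) t - u i t)" for t
  have usum: "u n t = p + (\<Sum>i<n. u (Suc i) t - u i t)" for n t
    using sum_lessThan_telescope[of "\<lambda>i. u i t" n] by (simp add: u0)
  have unif: "uniform_limit {-T..T} u w sequentially" for T
  proof -
    have "uniform_limit {-T..T} (\<lambda>n t. \<Sum>i<n. u (Suc i) t - u i t) (\<lambda>t. \<Sum>i. u (Suc i) t - u i t) sequentially"
    proof (rule Weierstrass_m_test)
      show "summable (\<lambda>n. M * \<bar>T\<bar> * ((L * \<bar>T\<bar>) ^ n /\<^sub>R fact n))"
        by (intro summable_mult summable_exp_generic)
      show "norm (u (Suc n) t - u n t) \<le> M * \<bar>T\<bar> * ((L * \<bar>T\<bar>) ^ n /\<^sub>R fact n)" if "t \<in> {-T..T}" for n t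
      proof -
        have "\<bar>t\<bar> ^ Suc n \<le> \<bar>T\<bar> ^ Suc n" using that by (intro power_mono) auto
        then have "M * L ^ n * \<bar>t\<bar> ^ Suc n / fact (Suc n) \<le> M * L ^ n * \<bar>T\<bar> ^ Suc n / fact n"
          using L0 by (intro frac_le mult_left_mono mult_nonneg_nonneg fact_mono) (auto simp: M_def)
        with step[of n t] have "norm (u (Suc n) t - u n t) \<le> M * L ^ n * \<bar>T\<bar> ^ Suc n / fact n"
          by (rule order_trans)
        then show ?thesis
          by (simp add: divide_inverse_commute power_mult_distrib mult_ac)
      qed
    qed
    from uniform_limit_add[OF uniform_limit_const[where c = "\<lambda>_. p"] this] show ?thesis
      by (simp only: w_def[abs_def] usum[symmetric])
  qed
  have wcont: "continuous_on UNIV w"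
  proof -
    have "isCont w t" for t
    proof -
      have "continuous_on {-(\<bar>t\<bar>+1)..\<bar>t\<bar>+1} w"
        by (rule uniform_limit_theorem[OF _ unif])
          (auto intro!: always_eventually intro: continuous_on_subset[OF ucont])
      then show ?thesis
        by (rule continuous_on_interior) (simp add: abs_less_iff abs_if)
    qed
    then show ?thesis by (simp add: continuous_at_imp_continuous_on)
  qed
  have fixpoint: "w t = p + J (\<lambda>s. G (w s)) t" for t
  proof (rule LIMSEQ_unique)
    show "(\<lambda>n. u (Suc n) t) \<longlonglongrightarrow> w t"
      by (rule LIMSEQ_Suc[OF tendsto_uniform_limitI[OF unif[of "\<bar>t\<bar>"]]]) (simp, arith)
    show "(\<lambda>n. u (Suc n) t) \<longlonglongrightarrow> p + J (\<lambda>s. G (w s)) t"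
    proof (rule tendstoI)
      fix e :: real assume "e > 0"
      define d where "d = e / (2 * (L + 1) * (\<bar>t\<bar> + 1))"
      have "d > 0" using \<open>e > 0\<close> L0 by (simp add: d_def)
      from uniform_limitD[OF unif[of "\<bar>t\<bar>"] this]
      show "\<forall>\<^sub>F n in sequentially. dist (u (Suc n) t) (p + J (\<lambda>s. G (w s)) t) < e"
      proof (eventually_elim)
        case (elim n)
        have "norm (J (\<lambda>s. G (u n s)) t - J (\<lambda>s. G (w s)) t) \<le> (L * d) * \<bar>t\<bar> ^ Suc 0 / Suc 0"
        proof (rule antiderivative_power_bound[where f = "\<lambda>s. G (u n s) - G (w s)" and T = "\<bar>t\<bar>"])
          show "norm (G (u n s) - G (w s)) \<le> L * d * \<bar>s\<bar> ^ 0" if "\<bar>s\<bar> \<le> \<bar>t\<bar>" for s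
          proof -
            have "dist (u n s) (w s) < d" using elim that by (auto simp: abs_le_iff)
            then show ?thesis
              using L[of "u n s" "w s"] mult_left_mono[OF _ L0, of "norm (u n s - w s)" d]
              by (simp add: dist_norm)
          qed
        qed (auto simp: J[OF Gcont[OF ucont]] J[OF Gcont[OF wcont]] intro!: has_vector_derivative_diff)
        also have "\<dots> \<le> ((L + 1) * d) * (\<bar>t\<bar> + 1)"
          using L0 \<open>d > 0\<close> by (auto intro!: mult_mono)
        also have "\<dots> = e / 2" 
        proof -
          have "L + 1 \<noteq> 0" "\<bar>t\<bar> + 1 \<noteq> 0" using L0 by linarith+
          moreover have "(a * (e / (2 * a * b))) * b = e / 2" if "a \<noteq> 0" "b \<noteq> 0" for a b :: real
            using that by simp
          ultimately show ?thesis unfolding d_def by blast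
        qed
        also have "\<dots> < e" using \<open>e > 0\<close> by simp
        finally show ?case by (simp add: dist_norm uSuc)
      qed
    qed
  qed
  show thesis
  proof (rule that[of w])
    show "w 0 = p" using fixpoint[of 0] J(1)[OF Gcont[OF wcont]] by simp
    have "((\<lambda>t. p + J (\<lambda>s. G (w s)) t) has_vector_derivative 0 + G (w t)) (at t)" for t
      by (intro has_vector_derivative_add has_vector_derivative_const J(2)[OF Gcont[OF wcont]])
    then show "(w has_vector_derivative G (w t)) (at t)" for t
      by (simp flip: fixpoint)
  qed
qed

text \<open>
  The function \<open>\<bar>u\<bar>\<^sup>2 exp (- (2 L + 1) t) - e\<^sup>2 t\<close> is nonincreasing. Working with the square of the norm
  avoids the points where the norm is not differentiable.
\<close>

lemma gronwall_nonneg: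
  fixes u :: "real \<Rightarrow> 'a::real_inner"
  assumes u: "\<And>t. 0 \<le> t \<Longrightarrow> t \<le> T \<Longrightarrow> (u has_vector_derivative u' t) (at t)"
    and le: "\<And>t. 0 \<le> t \<Longrightarrow> t \<le> T \<Longrightarrow> norm (u' t) \<le> L * norm (u t) + e"
    and "0 \<le> T" "0 \<le> L"
  shows "(norm (u T))\<^sup>2 \<le> ((norm (u 0))\<^sup>2 + e\<^sup>2 * T) * exp ((2 * L + 1) * T)"
proof -
  define k where "k = 2 * L + 1"
  let ?g = "\<lambda>t. (u t \<bullet> u t) * exp (- k * t) - e\<^sup>2 * t"
  have "?g T \<le> ?g 0"
  proof (rule DERIV_nonpos_imp_nonincreasing[OF \<open>0 \<le> T\<close>])
    fix t assume t: "0 \<le> t" "t \<le> T"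
    have uu: "((\<lambda>t. u t \<bullet> u t) has_real_derivative 2 * (u t \<bullet> u' t)) (at t)"
      using bounded_bilinear.has_vector_derivative[OF bounded_bilinear_inner u[OF t] u[OF t]]
      by (simp add: has_real_derivative_iff_has_vector_derivative inner_commute)
    have d: "(?g has_real_derivative (2 * (u t \<bullet> u' t) - k * (u t \<bullet> u t)) * exp (- k * t) - e\<^sup>2) (at t)"
      by (rule derivative_eq_intros uu refl | simp add: algebra_simps)+
    have "2 * (u t \<bullet> u' t) \<le> 2 * norm (u t) * norm (u' t)"
      using norm_cauchy_schwarz[of "u t" "u' t"] by simp
    also have "\<dots> \<le> 2 * norm (u t) * (L * norm (u t) + e)"
      using le[OF t] by (intro mult_left_mono) auto
    also have "\<dots> \<le> k * (norm (u t))\<^sup>2 + e\<^sup>2"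
      using sum_squares_bound[of "norm (u t)" e] by (simp add: k_def power2_eq_square algebra_simps)
    finally have "2 * (u t \<bullet> u' t) - k * (u t \<bullet> u t) \<le> e\<^sup>2"
      by (simp add: power2_norm_eq_inner)
    then have "(2 * (u t \<bullet> u' t) - k * (u t \<bullet> u t)) * exp (- k * t) \<le> e\<^sup>2 * exp (- k * t)"
      by (intro mult_right_mono) auto
    also have "\<dots> \<le> e\<^sup>2 * 1"
      using t \<open>0 \<le> L\<close> by (intro mult_left_mono) (auto simp: k_def intro!: mult_nonpos_nonneg)
    finally show "\<exists>y. (?g has_real_derivative y) (at t) \<and> y \<le> 0"
      using d by auto
  qed
  then have "(norm (u T))\<^sup>2 * exp (- (k * T)) \<le> (norm (u 0))\<^sup>2 + e\<^sup>2 * T"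
    by (simp add: power2_norm_eq_inner)
  then have "(norm (u T))\<^sup>2 * exp (- (k * T)) * exp (k * T) \<le> ((norm (u 0))\<^sup>2 + e\<^sup>2 * T) * exp (k * T)"
    by (rule mult_right_mono) auto
  then show ?thesis
    by (simp add: k_def mult.assoc flip: exp_add)
qed

lemma gronwall:
  fixes u :: "real \<Rightarrow> 'a::real_inner"
  assumes u: "\<And>t. (u has_vector_derivative u' t) (at t)"
    and le: "\<And>t. norm (u' t) \<le> L * norm (u t) + e" and "0 \<le> L"
  shows "(norm (u T))\<^sup>2 \<le> ((norm (u 0))\<^sup>2 + e\<^sup>2 * \<bar>T\<bar>) * exp ((2 * L + 1) * \<bar>T\<bar>)"
proof (cases "0 \<le> T")
  case True
  with gronwall_nonneg[OF u le True \<open>0 \<le> L\<close>] show ?thesis by simp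
next
  case False
  have "norm (- u' (- t)) \<le> L * norm (u (- t)) + e" for t
    using le[of "- t"] by simp
  from gronwall_nonneg[OF has_vector_derivative_reflect[OF u] this _ \<open>0 \<le> L\<close>, of "- T"] False
  show ?thesis by simp
qed

section \<open>Complete flows of fields with a proper conserved function\<close>

text \<open>
  A continuously differentiable field on a convex open set whose solutions are confined to compact
  sublevel sets of a conserved function. This makes all solutions global.
\<close>

locale proper_conserved_field =
  fixes P :: "'a::euclidean_space set" and X :: "'a \<Rightarrow> 'a" and X' :: "'a \<Rightarrow> 'a \<Rightarrow> 'a"
    and H :: "'a \<Rightarrow> real" and H' :: "'a \<Rightarrow> 'a \<Rightarrow> real"
  assumes open_P: "open P" and convex_P: "convex P"
    and X_deriv: "p \<in> P \<Longrightarrow> (X has_derivative X' p) (at p)"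
    and X'_cont: "continuous_on (P \<times> UNIV) (\<lambda>(p, v). X' p v)"
    and H_deriv: "p \<in> P \<Longrightarrow> (H has_derivative H' p) (at p)"
    and conserved: "p \<in> P \<Longrightarrow> H' p (X p) = 0"
    and proper: "compact {p \<in> P. H p \<le> d}"
begin

definition solution :: "(real \<Rightarrow> 'a) \<Rightarrow> bool" where
  "solution u \<longleftrightarrow> (\<forall>t. u t \<in> P \<and> (u has_vector_derivative X (u t)) (at t))"

lemma X'_linear: "p \<in> P \<Longrightarrow> linear (X' p)"
  using X_deriv has_derivative_linear by blast

lemma H_cont: "continuous_on P H"
  by (meson H_deriv continuous_at_imp_continuous_on has_derivative_continuous)

lemma X_cont: "continuous_on P X"
  by (meson X_deriv continuous_at_imp_continuous_on has_derivative_continuous)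

text \<open>
  The convex hull of a slightly larger sublevel set. Convexity is needed to turn the bound on the
  derivative of the field into a Lipschitz constant, and to have a closest point projection.
\<close>

lemma sublevel_in_convex_compact:
  obtains B where "compact B" "convex B" "B \<subseteq> P" "{p \<in> P. H p \<le> d} \<subseteq> interior B"
proof
  let ?B = "convex hull {p \<in> P. H p \<le> d + 1}"
  show "compact ?B" using proper by (rule compact_convex_hull)
  show "convex ?B" by (rule convex_convex_hull)
  show "?B \<subseteq> P" using convex_P by (intro hull_minimal) auto
  have "open {p \<in> P. H p < d + 1}"
    using continuous_open_preimage[OF H_cont open_P, of "{..<d+1}"] by (simp add: vimage_def Int_def)
  moreover have "{p \<in> P. H p < d + 1} \<subseteq> ?B"
    by (rule order_trans[OF _ hull_subset]) auto
  ultimately have "{p \<in> P. H p < d + 1} \<subseteq> interior ?B"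
    by (rule interior_maximal[rotated])
  then show "{p \<in> P. H p \<le> d} \<subseteq> interior ?B" by auto
qed

lemma X'_bounded:
  assumes "compact B" "B \<subseteq> P"
  obtains C where "C \<ge> 0" "\<And>p v. p \<in> B \<Longrightarrow> norm (X' p v) \<le> C * norm v"
proof -
  have "compact (B \<times> sphere 0 1 :: ('a \<times> 'a) set)"
    using assms by (intro compact_Times) auto
  moreover have "continuous_on (B \<times> sphere 0 1) (\<lambda>(p, v). X' p v)"
    by (rule continuous_on_subset[OF X'_cont]) (use assms in auto)
  ultimately have "bounded ((\<lambda>(p, v). X' p v) ` (B \<times> sphere 0 1))"
    by (intro compact_imp_bounded compact_continuous_image)
  then obtain C where C: "C > 0" "\<And>y. y \<in> (\<lambda>(p, v). X' p v) ` (B \<times> sphere 0 1) \<Longrightarrow> norm y \<le> C"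
    unfolding bounded_pos by blast
  show thesis
  proof (rule that[of C])
    fix p v assume p: "p \<in> B"
    show "norm (X' p v) \<le> C * norm v"
    proof (cases "v = 0")
      case True
      then show ?thesis using linear_0[OF X'_linear, of p] p assms by auto
    next
      case False
      have "norm (X' p (v /\<^sub>R norm v)) \<le> C"
        by (rule C(2)) (use p False in \<open>force intro!: image_eqI[of _ _ "(p, v /\<^sub>R norm v)"]\<close>)
      moreover have "X' p (v /\<^sub>R norm v) = X' p v /\<^sub>R norm v"
        using linear_scale[OF X'_linear] p assms by blast
      ultimately show ?thesis using False by (simp add: field_simps)
    qed
  qed (use C in simp)
qed

lemma lipschitz_on_convex_compact:
  assumes "compact B" "convex B" "B \<subseteq> P"
  obtains L where "L-lipschitz_on B X"
proof -
  obtain C where C: "C \<ge> 0" "\<And>p v. p \<in> B \<Longrightarrow> norm (X' p v) \<le> C * norm v"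
    using X'_bounded[OF assms(1,3)] by blast
  have "norm (X x - X y) \<le> C * norm (x - y)" if "x \<in> B" "y \<in> B" for x y
  proof (rule differentiable_bound[OF \<open>convex B\<close>])
    show "(X has_derivative X' z) (at z within B)" if "z \<in> B" for z
      using X_deriv that assms has_derivative_at_withinI by blast
    show "onorm (X' z) \<le> C" if "z \<in> B" for z
      using C that by (intro onorm_le) auto
  qed (use that in auto)
  then have "C-lipschitz_on B X"
    by (intro lipschitz_onI) (use C in \<open>auto simp: dist_norm\<close>)
  then show thesis by (rule that)
qed

lemma solution_conserved:
  assumes "solution u"
  shows "H (u t) = H (u 0)"
proof -
  have deriv: "((\<lambda>t. H (u t)) has_vector_derivative 0) (at t within UNIV)" for t
  proof -
    have "((\<lambda>t. H (u t)) has_derivative (\<lambda>s. H' (u t) (s *\<^sub>R X (u t)))) (at t)"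
      using assms H_deriv[of "u t"] unfolding solution_def has_vector_derivative_def
      by (auto intro: has_derivative_compose)
    moreover have "linear (H' (u t))"
      using assms H_deriv has_derivative_linear unfolding solution_def by blast
    ultimately show ?thesis
      using conserved assms by (simp add: has_vector_derivative_def linear_scale solution_def)
  qed
  obtain c where "\<And>t. t \<in> UNIV \<Longrightarrow> H (u t) = c"
    using has_vector_derivative_zero_constant[OF convex_UNIV deriv] by metis
  then show ?thesis by simp
qed

lemma solution_unique:
  assumes u: "solution u" and v: "solution v" and eq: "u 0 = v 0"
  shows "u t = v t"
proof -
  obtain B where B: "compact B" "convex B" "B \<subseteq> P" "{p \<in> P. H p \<le> H (u 0)} \<subseteq> interior B"
    by (rule sublevel_in_convex_compact)
  obtain L where L: "L-lipschitz_on B X"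
    using lipschitz_on_convex_compact B by blast
  have in_B: "u t \<in> B" "v t \<in> B" for t
    using B(4) interior_subset[of B] solution_conserved[OF u, of t] solution_conserved[OF v, of t] u v eq
    by (simp_all add: solution_def subset_iff)
  have "(norm (u t - v t))\<^sup>2 \<le> ((norm (u 0 - v 0))\<^sup>2 + 0\<^sup>2 * \<bar>t\<bar>) * exp ((2 * L + 1) * \<bar>t\<bar>)"
  proof (rule gronwall[where u' = "\<lambda>t. X (u t) - X (v t)"])
    show "((\<lambda>t. u t - v t) has_vector_derivative X (u t) - X (v t)) (at t)" for t
      using u v by (intro has_vector_derivative_diff) (auto simp: solution_def)
    show "norm (X (u t) - X (v t)) \<le> L * norm (u t - v t) + 0" for t
      using lipschitz_onD[OF L in_B, of t t] by (simp add: dist_norm)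
    show "0 \<le> L" using L by (rule lipschitz_on_nonneg)
  qed
  then show ?thesis using eq by simp
qed

text \<open>
  The field is composed with the closest point projection onto a compact convex neighbourhood \<open>B\<close> of the
  sublevel set of \<open>p\<close>, which makes it globally Lipschitz. The times at which the solution of the modified
  equation lies in the sublevel set form a closed set. This set is also open, because the solution
  stays in \<open>B\<close> for nearby times, where the two fields agree, so that \<open>H\<close> is constant there. Hence the solution never
  leaves \<open>B\<close>, and it solves the original equation.
\<close>

lemma solution_exists:
  assumes p: "p \<in> P"
  obtains u where "solution u" "u 0 = p"
proof -
  let ?K = "{q \<in> P. H q \<le> H p}"
  obtain B where B: "compact B" "convex B" "B \<subseteq> P" "?K \<subseteq> interior B"
    by (rule sublevel_in_convex_compact)
  obtain L where L: "L-lipschitz_on B X"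
    using lipschitz_on_convex_compact B by blast
  have ne: "B \<noteq> {}" using B(4) interior_subset[of B] p by auto
  define \<pi> where "\<pi> = closest_point B"
  have "(L * 1)-lipschitz_on UNIV (\<lambda>x. X (\<pi> x))"
  proof (rule lipschitz_on_compose2[where f = \<pi>])
    show "1-lipschitz_on UNIV \<pi>"
      using closest_point_lipschitz[OF B(2) compact_imp_closed[OF B(1)] ne]
      by (intro lipschitz_onI) (auto simp: \<pi>_def)
    show "L-lipschitz_on (\<pi> ` UNIV) X"
      by (rule lipschitz_on_subset[OF L])
        (auto simp: \<pi>_def closest_point_in_set[OF compact_imp_closed[OF B(1)] ne])
  qed
  then obtain u where u: "u 0 = p" "\<And>t. (u has_vector_derivative X (\<pi> (u t))) (at t)"
    using lipschitz_ode_solution_exists[of "L * 1" "\<lambda>x. X (\<pi> x)" p] by metis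
  have u_cont: "continuous_on UNIV u"
    using u(2) by (rule vector_derivative_imp_continuous_on)
  define C where "C = u -` ?K"
  have "closed C"
    unfolding C_def
    by (intro continuous_closed_vimage compact_imp_closed proper)
      (use u_cont in \<open>simp add: continuous_on_eq_continuous_at\<close>)
  moreover have "open C"
    unfolding open_contains_ball
  proof
    fix t assume t: "t \<in> C"
    have "open (u -` interior B)"
      by (rule open_vimage) (use u_cont in auto)
    moreover have "t \<in> u -` interior B" using t B(4) by (auto simp: C_def)
    ultimately obtain e where e: "e > 0" "ball t e \<subseteq> u -` interior B"
      by (meson open_contains_ball)
    have in_B: "u s \<in> B" if "s \<in> ball t e" for s
      using e(2) that interior_subset by blast
    have deriv: "((\<lambda>t. H (u t)) has_vector_derivative 0) (at s within ball t e)" if s: "s \<in> ball t e" for s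
    proof -
      have us: "u s \<in> P" "\<pi> (u s) = u s"
        using in_B[OF s] B by (auto simp: \<pi>_def closest_point_self)
      have "((\<lambda>t. H (u t)) has_derivative (\<lambda>r. H' (u s) (r *\<^sub>R X (u s)))) (at s)"
        using u(2)[of s] H_deriv[OF us(1)] us unfolding has_vector_derivative_def
        by (auto intro: has_derivative_compose)
      moreover have "linear (H' (u s))"
        using H_deriv[OF us(1)] has_derivative_linear by blast
      ultimately have "((\<lambda>t. H (u t)) has_vector_derivative 0) (at s)"
        by (simp add: has_vector_derivative_def linear_scale conserved us(1))
      then show ?thesis by (rule has_vector_derivative_at_within)
    qed
    obtain c where c: "\<And>s. s \<in> ball t e \<Longrightarrow> H (u s) = c"
      using has_vector_derivative_zero_constant[OF convex_ball deriv] by metis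
    then have "H (u s) = H (u t)" if "s \<in> ball t e" for s
      using that e(1) by (metis centre_in_ball)
    then have "ball t e \<subseteq> C" using t in_B B(3) by (auto simp: C_def subset_iff)
    then show "\<exists>e>0. ball t e \<subseteq> C" using e(1) by blast
  qed
  moreover have "0 \<in> C" using u(1) p by (simp add: C_def)
  ultimately have "C = UNIV" using clopen by blast
  then have uK: "u t \<in> ?K" for t by (auto simp: C_def)
  have "\<pi> (u t) = u t" for t
    using uK[of t] B(4) interior_subset[of B] by (auto simp: \<pi>_def intro!: closest_point_self)
  then have "solution u" using u(2) uK by (auto simp: solution_def)
  then show thesis using that u(1) by blast
qed

definition flow :: "real \<Rightarrow> 'a \<Rightarrow> 'a" where
  "flow t p = (SOME u. solution u \<and> u 0 = p) t"

lemma flow_solution: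
  assumes "p \<in> P"
  shows "solution (\<lambda>t. flow t p)" "flow 0 p = p"
proof -
  have "\<exists>u. solution u \<and> u 0 = p" using solution_exists[OF assms] by blast
  from someI_ex[OF this] show "solution (\<lambda>t. flow t p)" "flow 0 p = p"
    by (simp_all add: flow_def)
qed

lemma flow_in: "p \<in> P \<Longrightarrow> flow t p \<in> P"
  using flow_solution(1) by (simp add: solution_def)

lemma flow_deriv: "p \<in> P \<Longrightarrow> ((\<lambda>t. flow t p) has_vector_derivative X (flow t p)) (at t)"
  using flow_solution(1) by (simp add: solution_def)

lemma flow_conserved: "p \<in> P \<Longrightarrow> H (flow t p) = H p"
  using flow_solution[of p] solution_conserved by metis

lemma flow_unique: "solution u \<Longrightarrow> u 0 = p \<Longrightarrow> u t = flow t p"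
  using solution_unique[of u "\<lambda>t. flow t p" t] flow_solution[of p] by (auto simp: solution_def)

lemma solution_shift:
  assumes "solution u"
  shows "solution (\<lambda>t. u (t + s))"
  unfolding solution_def
proof (intro allI conjI)
  fix t
  show "u (t + s) \<in> P" using assms by (simp add: solution_def)
  have "((\<lambda>t. t + s) has_vector_derivative 1) (at t)"
    by (auto intro!: derivative_eq_intros)
  moreover have "(u has_vector_derivative X (u (t + s))) (at (t + s))"
    using assms by (simp add: solution_def)
  ultimately show "((\<lambda>t. u (t + s)) has_vector_derivative X (u (t + s))) (at t)"
    using vector_diff_chain_at[of "\<lambda>t. t + s" 1 t u "X (u (t + s))"] by (simp add: o_def)
qed

lemma flow_add:
  assumes "p \<in> P"
  shows "flow (t + s) p = flow t (flow s p)"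
  using flow_unique[OF solution_shift[OF flow_solution(1)[OF assms]], of s "flow s p" t]
  by simp

end

section \<open>Commuting flows and the action of the plane\<close>

text \<open>
  The last assumption says that the Lie bracket of the two fields vanishes.
\<close>

locale commuting_conserved_fields =
  X: proper_conserved_field P X X' H H' + Y: proper_conserved_field P Y Y' H H'
  for P :: "'a::euclidean_space set" and X X' Y Y' H H' +
  assumes commute: "p \<in> P \<Longrightarrow> X' p (Y p) = Y' p (X p)"
begin

text \<open>
  The error of the linear approximation of \<open>Y\<close> in the direction of \<open>X\<close> is uniformly small on a sublevel
  set, because the derivative of \<open>Y\<close> along the segments from \<open>q\<close> to \<open>q + h X q\<close> is uniformly continuous on the compact
  set of all these \<open>h\<close> and \<open>q\<close>.
\<close>

lemma uniform_linearization:
  assumes e: "e > 0"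
  obtains r where "r > 0" "\<And>q h. q \<in> P \<Longrightarrow> H q \<le> d \<Longrightarrow> \<bar>h\<bar> \<le> r \<Longrightarrow> q + h *\<^sub>R X q \<in> P \<and>
    norm (Y (q + h *\<^sub>R X q) - Y q - h *\<^sub>R Y' q (X q)) \<le> e * \<bar>h\<bar>"
    "\<And>q h. q \<in> P \<Longrightarrow> H q \<le> d \<Longrightarrow> \<bar>h\<bar> \<le> r \<Longrightarrow> H (q + h *\<^sub>R X q) \<le> d + 1"
proof -
  let ?K = "{q \<in> P. H q \<le> d}"
  have compK: "compact ?K" by (rule X.proper)
  let ?f = "\<lambda>(h, q). q + h *\<^sub>R X q"
  let ?O = "{q \<in> P. H q < d + 1}"
  have openO: "open ?O"
    using continuous_open_preimage[OF X.H_cont X.open_P, of "{..<d+1}"] by (simp add: vimage_def Int_def)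
  have contX: "continuous_on (S \<times> ?K) (\<lambda>x. X (snd x))" for S :: "real set"
    by (rule continuous_on_compose2[OF X.X_cont]) (auto intro!: continuous_intros)
  obtain s where s: "s > 0" "\<And>q h. q \<in> ?K \<Longrightarrow> \<bar>h\<bar> \<le> s \<Longrightarrow> q + h *\<^sub>R X q \<in> ?O"
  proof -
    obtain \<epsilon> where \<epsilon>: "\<epsilon> > 0" "(\<Union>x\<in>?K. ball x \<epsilon>) \<subseteq> ?O"
      using compact_subset_open_imp_ball_epsilon_subset[OF compK openO, of thesis] by force
    have "bounded (X ` ?K)"
      by (intro compact_imp_bounded compact_continuous_image compK)
        (rule continuous_on_subset[OF X.X_cont], auto)
    then obtain M where M: "M > 0" "\<And>q. q \<in> ?K \<Longrightarrow> norm (X q) \<le> M"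
      by (auto simp: bounded_pos)
    show thesis
    proof (rule that[of "\<epsilon> / (2 * M)"])
      fix q h assume q: "q \<in> ?K" and h: "\<bar>h\<bar> \<le> \<epsilon> / (2 * M)"
      have "norm (h *\<^sub>R X q) \<le> \<epsilon> / (2 * M) * M"
        unfolding norm_scaleR by (intro mult_mono h M q) (use M \<epsilon> in auto)
      also have "\<dots> < \<epsilon>" using M \<epsilon> by simp
      finally have "q + h *\<^sub>R X q \<in> ball q \<epsilon>" by (simp add: dist_norm)
      then show "q + h *\<^sub>R X q \<in> ?O" using \<epsilon>(2) q by blast
    qed (use M \<epsilon> in simp)
  qed
  let ?g = "\<lambda>(h, q). Y' (q + h *\<^sub>R X q) (X q)"
  have cg: "continuous_on ({-s..s} \<times> ?K) ?g"
  proof -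
    have *: "continuous_on ({-s..s} \<times> ?K) (\<lambda>x. (snd x + fst x *\<^sub>R X (snd x), X (snd x)))"
      by (intro continuous_intros contX)
    show ?thesis
      using continuous_on_compose2[OF Y.X'_cont *] s(2) by (force simp: case_prod_beta abs_le_iff)
  qed
  have "uniformly_continuous_on ({-s..s} \<times> ?K) ?g"
    by (intro compact_uniformly_continuous[OF cg] compact_Times compK) auto
  then obtain r where r: "r > 0" "\<And>x x'. x \<in> {-s..s} \<times> ?K \<Longrightarrow> x' \<in> {-s..s} \<times> ?K \<Longrightarrow>
      dist x' x < r \<Longrightarrow> dist (?g x') (?g x) < e"
    unfolding uniformly_continuous_on_def using e by meson
  show thesis
  proof (rule that[of "min s (r / 2)"])
    show "min s (r / 2) > 0" using s r by simp
    fix q h assume q: "q \<in> P" "H q \<le> d" and h: "\<bar>h\<bar> \<le> min s (r / 2)"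
    have in_O: "q + k *\<^sub>R X q \<in> ?O" if "\<bar>k\<bar> \<le> \<bar>h\<bar>" for k
      using s(2)[of q k] q that h by auto
    show "H (q + h *\<^sub>R X q) \<le> d + 1" using in_O[of h] by simp
    have deriv: "((\<lambda>k. Y (q + k *\<^sub>R X q) - k *\<^sub>R Y' q (X q)) has_derivative
        (\<lambda>j. j *\<^sub>R (Y' (q + k *\<^sub>R X q) (X q) - Y' q (X q)))) (at k within {-\<bar>h\<bar>..\<bar>h\<bar>})"
      if k: "k \<in> {-\<bar>h\<bar>..\<bar>h\<bar>}" for k
    proof -
      have kP: "q + k *\<^sub>R X q \<in> P" using in_O[of k] k by auto
      have "((\<lambda>k. q + k *\<^sub>R X q) has_derivative (\<lambda>j. j *\<^sub>R X q)) (at k)"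
        by (auto intro!: derivative_eq_intros)
      from has_derivative_compose[OF this Y.X_deriv[OF kP]]
      have "((\<lambda>k. Y (q + k *\<^sub>R X q)) has_derivative (\<lambda>j. j *\<^sub>R Y' (q + k *\<^sub>R X q) (X q))) (at k)"
        using linear_scale[OF Y.X'_linear[OF kP]] by simp
      then have "((\<lambda>k. Y (q + k *\<^sub>R X q) - k *\<^sub>R Y' q (X q)) has_derivative
        (\<lambda>j. j *\<^sub>R Y' (q + k *\<^sub>R X q) (X q) - j *\<^sub>R Y' q (X q))) (at k)"
        by (intro has_derivative_diff) (auto intro!: derivative_eq_intros)
      then show ?thesis
        by (auto simp: algebra_simps intro: has_derivative_at_withinI)
    qed
    have "norm ((Y (q + h *\<^sub>R X q) - h *\<^sub>R Y' q (X q)) - (Y (q + 0 *\<^sub>R X q) - 0 *\<^sub>R Y' q (X q))) \<le> e * norm (h - 0)"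
    proof (rule differentiable_bound[OF _ deriv])
      fix k assume k: "k \<in> {-\<bar>h\<bar>..\<bar>h\<bar>}"
      have "norm (Y' (q + k *\<^sub>R X q) (X q) - Y' q (X q)) \<le> e"
      proof -
        have "k \<in> {-s..s}" "\<bar>k\<bar> < r" "0 \<in> {-s..s}" using k h s(1) r(1) by auto
        then show ?thesis
          using r(2)[of "(0, q)" "(k, q)"] q by (simp add: dist_norm dist_Pair_Pair)
      qed
      then show "onorm (\<lambda>j. j *\<^sub>R (Y' (q + k *\<^sub>R X q) (X q) - Y' q (X q))) \<le> e"
        by (intro onorm_le) (auto simp: mult.commute[of e] intro: mult_left_mono)
    qed auto
    then show "q + h *\<^sub>R X q \<in> P \<and> norm (Y (q + h *\<^sub>R X q) - Y q - h *\<^sub>R Y' q (X q)) \<le> e * \<bar>h\<bar>"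
      using in_O[of h] by (simp add: algebra_simps)
  qed
qed

text \<open>
  This is the infinitesimal form of commutation of the flows. It is proved without differentiating a
  flow with respect to its initial value. With \<open>\<zeta> t\<close> the flow of \<open>Y\<close> through \<open>X.flow x p\<close>, the curve
  \<open>t \<rightarrow> \<zeta> t + h X (\<zeta> t)\<close> satisfies the equation of \<open>Y\<close> up to \<open>o(h)\<close>, since \<open>X' Y = Y' X\<close>, and starts
  \<open>o(h)\<close>-close to \<open>X.flow (x + h) p\<close>. By Gronwall's inequality it stays \<open>o(h)\<close>-close to the \<open>Y\<close>-flow of that point.
\<close>

lemma flows_deriv:
  assumes p: "p \<in> P"
  shows "((\<lambda>x. Y.flow y (X.flow x p)) has_vector_derivative X (Y.flow y (X.flow x p))) (at x)"
proof -
  define q where "q = X.flow x p"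
  define \<zeta> where "\<zeta> t = Y.flow t q" for t
  have q: "q \<in> P" "H q = H p" unfolding q_def using X.flow_in X.flow_conserved p by auto
  have \<zeta>: "\<zeta> t \<in> P" "H (\<zeta> t) = H p" "(\<zeta> has_vector_derivative Y (\<zeta> t)) (at t)" for t
    using Y.flow_in Y.flow_conserved Y.flow_deriv q by (auto simp: \<zeta>_def[abs_def])
  obtain B where B: "compact B" "convex B" "B \<subseteq> P" "{q \<in> P. H q \<le> H p + 1} \<subseteq> interior B"
    by (rule X.sublevel_in_convex_compact)
  obtain L where L: "L-lipschitz_on B Y"
    using Y.lipschitz_on_convex_compact B by blast
  have L0: "0 \<le> L" using L by (rule lipschitz_on_nonneg)
  have in_B: "z \<in> B" if "z \<in> P" "H z \<le> H p + 1" for z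
    using that B(4) interior_subset[of B] by auto
  define C where "C = (1 + \<bar>y\<bar>) * exp ((2 * L + 1) * \<bar>y\<bar>)"
  have C: "C > 0" by (auto simp: C_def intro!: mult_pos_pos)
  show ?thesis
    unfolding has_vector_derivative_def has_derivative_at_alt
  proof (intro conjI allI impI)
    show "bounded_linear (\<lambda>h. h *\<^sub>R X (Y.flow y (X.flow x p)))"
      by (rule bounded_linear_scaleR_left)
    fix e' :: real assume "e' > 0"
    define e where "e = e' / sqrt C"
    have e: "e > 0" "e\<^sup>2 * C = e'\<^sup>2" using \<open>e' > 0\<close> C by (auto simp: e_def power_divide)
    obtain r where r: "r > 0" "\<And>q h. q \<in> P \<Longrightarrow> H q \<le> H p \<Longrightarrow> \<bar>h\<bar> \<le> r \<Longrightarrow> q + h *\<^sub>R X q \<in> P \<and>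
        norm (Y (q + h *\<^sub>R X q) - Y q - h *\<^sub>R Y' q (X q)) \<le> e * \<bar>h\<bar>"
      "\<And>q h. q \<in> P \<Longrightarrow> H q \<le> H p \<Longrightarrow> \<bar>h\<bar> \<le> r \<Longrightarrow> H (q + h *\<^sub>R X q) \<le> H p + 1"
      using uniform_linearization[OF e(1), of "H p"] by metis
    obtain r' where r': "r' > 0"
      "\<And>x'. norm (x' - x) < r' \<Longrightarrow> norm (X.flow x' p - X.flow x p - (x' - x) *\<^sub>R X q) \<le> e * norm (x' - x)"
      using X.flow_deriv[OF p, of x] e(1) unfolding has_vector_derivative_def has_derivative_at_alt q_def
      by blast
    show "\<exists>d>0. \<forall>x'. norm (x' - x) < d \<longrightarrow>
      norm (Y.flow y (X.flow x' p) - Y.flow y (X.flow x p) - (x' - x) *\<^sub>R X (Y.flow y (X.flow x p))) \<le> e' * norm (x' - x)"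
    proof (intro exI[of _ "min r r'"] conjI allI impI)
      show "min r r' > 0" using r r' by simp
      fix x' assume x': "norm (x' - x) < min r r'"
      define h where "h = x' - x"
      have h: "\<bar>h\<bar> \<le> r" "\<bar>h\<bar> < r'" using x' by (auto simp: h_def)
      define v where "v t = Y.flow t (X.flow x' p)" for t
      have v: "v t \<in> P" "H (v t) = H p" "(v has_vector_derivative Y (v t)) (at t)" for t
        using Y.flow_in[OF X.flow_in[OF p]] Y.flow_conserved[OF X.flow_in[OF p]] X.flow_conserved[OF p]
          Y.flow_deriv[OF X.flow_in[OF p]]
        by (auto simp: v_def[abs_def])
      define w where "w t = v t - \<zeta> t - h *\<^sub>R X (\<zeta> t)" for t
      have "(norm (w y))\<^sup>2 \<le> ((norm (w 0))\<^sup>2 + (e * \<bar>h\<bar>)\<^sup>2 * \<bar>y\<bar>) * exp ((2 * L + 1) * \<bar>y\<bar>)"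
      proof (rule gronwall[OF _ _ L0])
        fix t
        have "((\<lambda>t. X (\<zeta> t)) has_vector_derivative X' (\<zeta> t) (Y (\<zeta> t))) (at t)"
          using has_derivative_compose[OF \<zeta>(3)[unfolded has_vector_derivative_def] X.X_deriv[OF \<zeta>(1)]]
          by (simp add: has_vector_derivative_def linear_scale[OF X.X'_linear[OF \<zeta>(1)]])
        then show "(w has_vector_derivative Y (v t) - Y (\<zeta> t) - h *\<^sub>R Y' (\<zeta> t) (X (\<zeta> t))) (at t)"
          unfolding w_def[abs_def] using commute[OF \<zeta>(1)]
          by (auto intro!: derivative_eq_intros v(3) \<zeta>(3))
        let ?c = "\<zeta> t + h *\<^sub>R X (\<zeta> t)"
        have c: "?c \<in> P" "norm (Y ?c - Y (\<zeta> t) - h *\<^sub>R Y' (\<zeta> t) (X (\<zeta> t))) \<le> e * \<bar>h\<bar>" "H ?c \<le> H p + 1"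
          using r(2,3)[of "\<zeta> t" h] \<zeta> h by auto
        \<comment> \<open>\<open>?c\<close> is the approximate solution; \<open>w\<close> is the difference of \<open>v\<close> and it\<close>
        have "norm (Y (v t) - Y ?c) \<le> L * norm (v t - ?c)"
          using lipschitz_onD[OF L, of "v t" ?c] in_B[OF c(1,3)] in_B[of "v t"] v[of t]
          by (simp add: dist_norm)
        then show "norm (Y (v t) - Y (\<zeta> t) - h *\<^sub>R Y' (\<zeta> t) (X (\<zeta> t))) \<le> L * norm (w t) + e * \<bar>h\<bar>"
          using c(2) norm_triangle_ineq[of "Y (v t) - Y ?c" "Y ?c - Y (\<zeta> t) - h *\<^sub>R Y' (\<zeta> t) (X (\<zeta> t))"]
          by (simp add: w_def algebra_simps)
      qed
      also have "\<dots> \<le> ((e * \<bar>h\<bar>)\<^sup>2 + (e * \<bar>h\<bar>)\<^sup>2 * \<bar>y\<bar>) * exp ((2 * L + 1) * \<bar>y\<bar>)"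
      proof -
        have "norm (w 0) \<le> e * \<bar>h\<bar>"
          using r'(2)[of x'] h q X.flow_in[OF p] Y.flow_solution(2)
          by (simp add: w_def v_def \<zeta>_def h_def q_def)
        then have "(norm (w 0))\<^sup>2 \<le> (e * \<bar>h\<bar>)\<^sup>2" by (rule power_mono) simp
        then show ?thesis by (intro mult_right_mono add_mono) auto
      qed
      also have "\<dots> = e\<^sup>2 * C * h\<^sup>2" by (simp add: C_def power_mult_distrib algebra_simps)
      also have "\<dots> = (e' * \<bar>h\<bar>)\<^sup>2" using e(2) by (simp add: power_mult_distrib)
      finally have "norm (w y) \<le> e' * \<bar>h\<bar>"
        by (rule power2_le_imp_le) (use \<open>e' > 0\<close> in auto)
      then show "norm (Y.flow y (X.flow x' p) - Y.flow y (X.flow x p) - (x' - x) *\<^sub>R X (Y.flow y (X.flow x p)))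
          \<le> e' * norm (x' - x)"
        by (simp add: w_def v_def \<zeta>_def h_def q_def)
    qed
  qed
qed

lemma flows_commute:
  assumes p: "p \<in> P"
  shows "Y.flow y (X.flow x p) = X.flow x (Y.flow y p)"
proof -
  have "X.solution (\<lambda>x. Y.flow y (X.flow x p))"
    using flows_deriv X.flow_in Y.flow_in p by (auto simp: X.solution_def)
  from X.flow_unique[OF this] show ?thesis
    using X.flow_solution(2)[OF p] by simp
qed

definition action :: "real \<times> real \<Rightarrow> 'a \<Rightarrow> 'a" where
  "action g p = Y.flow (snd g) (X.flow (fst g) p)"

lemma action_in: "p \<in> P \<Longrightarrow> action g p \<in> P"
  by (simp add: action_def X.flow_in Y.flow_in)

lemma action_zero: "p \<in> P \<Longrightarrow> action 0 p = p"
  by (simp add: action_def X.flow_solution Y.flow_solution)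

lemma action_add:
  assumes "p \<in> P"
  shows "action (g + h) p = action g (action h p)"
proof -
  have "action (g + h) p = Y.flow (snd g) (Y.flow (snd h) (X.flow (fst g) (X.flow (fst h) p)))"
    by (simp add: action_def X.flow_add Y.flow_add X.flow_in assms)
  also have "\<dots> = action g (action h p)"
    using flows_commute[of "X.flow (fst h) p" "snd h" "fst g"] by (simp add: action_def X.flow_in assms)
  finally show ?thesis .
qed

lemma action_deriv_fst:
  "p \<in> P \<Longrightarrow> ((\<lambda>x. action (x, y) p) has_vector_derivative X (action (x, y) p)) (at x)"
  by (simp add: action_def flows_deriv)

lemma action_deriv_snd:
  "p \<in> P \<Longrightarrow> ((\<lambda>y. action (x, y) p) has_vector_derivative Y (action (x, y) p)) (at y)"
  by (simp add: action_def Y.flow_deriv X.flow_in)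

lemma action_fixed:
  assumes "p \<in> P" "X p = 0" "Y p = 0"
  shows "action g p = p"
proof -
  have "X.solution (\<lambda>_. p)" "Y.solution (\<lambda>_. p)"
    using assms by (auto simp: X.solution_def Y.solution_def)
  then show ?thesis
    using X.flow_unique Y.flow_unique by (metis action_def)
qed

lemma field_bounded_on_sublevel:
  obtains M where "M \<ge> 0" "\<And>q. q \<in> P \<Longrightarrow> H q \<le> d \<Longrightarrow> norm (X q) \<le> M \<and> norm (Y q) \<le> M"
proof -
  let ?K = "{q \<in> P. H q \<le> d}"
  have "bounded (X ` ?K)" "bounded (Y ` ?K)"
    by (intro compact_imp_bounded compact_continuous_image X.proper;
        rule continuous_on_subset[OF X.X_cont] continuous_on_subset[OF Y.X_cont]; blast)+
  then obtain M N where "M > 0" "\<And>q. q \<in> ?K \<Longrightarrow> norm (X q) \<le> M" "\<And>q. q \<in> ?K \<Longrightarrow> norm (Y q) \<le> N"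
    by (auto simp: bounded_pos)
  then show thesis
    by (intro that[of "max M N"]) (auto simp: le_max_iff_disj)
qed

lemma action_continuous:
  assumes p: "p \<in> P"
  shows "continuous_on UNIV (\<lambda>g. action g p)"
proof -
  obtain M where M: "M \<ge> 0" "\<And>q. q \<in> P \<Longrightarrow> H q \<le> H p \<Longrightarrow> norm (X q) \<le> M \<and> norm (Y q) \<le> M"
    using field_bounded_on_sublevel by blast
  have HA: "H (action g p) \<le> H p" for g
    using p by (simp add: action_def Y.flow_conserved X.flow_conserved X.flow_in)
  have lipx: "norm (action (x, y) p - action (x', y) p) \<le> M * norm (x - x')" for x x' y
    by (rule differentiable_bound[OF convex_UNIV action_deriv_fst[OF p, unfolded has_vector_derivative_def]])
      (auto intro!: onorm_le simp: mult.commute[of M] mult_left_mono M(2) action_in p HA)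
  have lipy: "norm (action (x, y) p - action (x, y') p) \<le> M * norm (y - y')" for x y y'
    by (rule differentiable_bound[OF convex_UNIV action_deriv_snd[OF p, unfolded has_vector_derivative_def]])
      (auto intro!: onorm_le simp: mult.commute[of M] mult_left_mono M(2) action_in p HA)
  have "(2 * M)-lipschitz_on UNIV (\<lambda>g. action g p)"
  proof (rule lipschitz_onI)
    fix g h :: "real \<times> real"
    have "norm (action g p - action h p) \<le> M * norm (fst g - fst h) + M * norm (snd g - snd h)"
      using lipx[of "fst g" "snd g" "fst h"] lipy[of "fst h" "snd g" "snd h"]
        norm_triangle_ineq[of "action g p - action (fst h, snd g) p" "action (fst h, snd g) p - action h p"]
      by simp
    also have "\<dots> \<le> M * norm (g - h) + M * norm (g - h)"
      using norm_fst_le[of "fst g - fst h" "snd g - snd h"] norm_snd_le[of "snd g - snd h" "fst g - fst h"] M(1)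
      by (intro add_mono mult_left_mono) (auto simp: minus_prod_def)
    finally show "dist (action g p) (action h p) \<le> 2 * M * dist g h"
      by (simp add: dist_norm)
  qed (use M in simp)
  then show ?thesis by (rule lipschitz_on_continuous_on)
qed

text \<open>
  The action has continuous partial derivatives.
\<close>

lemma action_deriv:
  assumes p: "p \<in> P"
  shows "((\<lambda>g. action g p) has_derivative (\<lambda>h. fst h *\<^sub>R X (action g p) + snd h *\<^sub>R Y (action g p))) (at g)"
proof -
  obtain x y where g: "g = (x, y)" by (cases g)
  have contY: "continuous_on UNIV (\<lambda>g. Y (action g p))"
    by (rule continuous_on_compose2[OF Y.X_cont action_continuous[OF p]]) (use action_in p in auto)
  have "((\<lambda>(x, y). action (x, y) p) has_derivative
      (\<lambda>(tx, ty). tx *\<^sub>R X (action (x, y) p) + blinfun_apply (blinfun_scaleR_left (Y (action (x, y) p))) ty))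
      (at (x, y) within UNIV \<times> UNIV)"
  proof (rule has_derivative_partialsI)
    have "isCont (\<lambda>g. blinfun_scaleR_left (Y (action g p))) (x, y)"
      using contY continuous_on_eq_continuous_at[OF open_UNIV]
      by (intro bounded_linear.continuous[OF bounded_linear_blinfun_scaleR_left]) blast
    then show "continuous (at (x, y) within UNIV \<times> UNIV)
        (\<lambda>(x, y). blinfun_scaleR_left (Y (action (x, y) p)))"
      by (simp add: case_prod_unfold)
  qed (use action_deriv_fst[OF p] action_deriv_snd[OF p] in \<open>auto simp: has_vector_derivative_def\<close>)
  then show ?thesis by (simp add: g case_prod_unfold)
qed

end

section \<open>Open orbits\<close>

context commuting_conserved_fields
begin

lemma action_conserved:
  fixes K :: "'a \<Rightarrow> 'b::real_normed_vector"
  assumes K: "\<And>p. p \<in> P \<Longrightarrow> (K has_derivative K' p) (at p)"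
    and "\<And>p. p \<in> P \<Longrightarrow> K' p (X p) = 0" "\<And>p. p \<in> P \<Longrightarrow> K' p (Y p) = 0" and p: "p \<in> P"
  shows "K (action g p) = K p"
proof -
  have deriv: "((\<lambda>g. K (action g p)) has_derivative (\<lambda>h. 0)) (at g within UNIV)" for g
  proof -
    have q: "action g p \<in> P" using action_in[OF p] .
    have "linear (K' (action g p))" using K[OF q] by (rule has_derivative_linear)
    then have "(\<lambda>h. K' (action g p) (fst h *\<^sub>R X (action g p) + snd h *\<^sub>R Y (action g p))) = (\<lambda>h. 0)"
      using assms(2,3)[OF q] by (simp add: linear_add linear_scale)
    then show ?thesis
      using has_derivative_compose[OF action_deriv[OF p, of g] K[OF q]] by simp
  qed
  have "K (action g p) = K (action 0 p)"
    using has_derivative_zero_unique[OF convex_UNIV deriv, of g 0] by simp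
  then show ?thesis by (simp add: action_zero[OF p])
qed

lemma action_inverse: "p \<in> P \<Longrightarrow> action (- g) (action g p) = p"
  using action_add[of p "- g" g] by (simp add: action_zero)

lemma action_orbit_eq:
  assumes p: "p \<in> P" and q: "q \<in> action_orbit action p"
  shows "action_orbit action q = action_orbit action p"
proof -
  obtain g where g: "q = action g p" using q by (auto simp: action_orbit_def)
  have "action h q = action (h + g) p" for h by (simp add: g action_add p)
  moreover have "action h p = action (h - g) q" for h
    using action_add[OF p, of "h - g" g] by (simp add: g)
  ultimately show ?thesis unfolding action_orbit_def by (metis (no_types, lifting) image_cong rangeE rangeI subsetI subset_antisym)
qed

lemma action_orbit_self: "p \<in> P \<Longrightarrow> p \<in> action_orbit action p"
  using action_zero unfolding action_orbit_def by (metis rangeI)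

context
  fixes S :: "'a set"
  assumes SP: "S \<subseteq> P" and inv: "\<And>p g. p \<in> S \<Longrightarrow> action g p \<in> S"
    and orbit_open: "\<And>p. p \<in> S \<Longrightarrow> \<exists>W. open W \<and> p \<in> W \<and> S \<inter> W \<subseteq> action_orbit action p"
begin

text \<open>
  Orbits are equal or disjoint, so inside \<open>S\<close> the complement of an orbit is a union of open orbits.
\<close>

lemma orbit_closed:
  assumes p: "p \<in> S"
  shows "S \<inter> closure (action_orbit action p) \<subseteq> action_orbit action p"
proof
  fix q assume q: "q \<in> S \<inter> closure (action_orbit action p)"
  then obtain W where W: "open W" "q \<in> W" "S \<inter> W \<subseteq> action_orbit action q" using orbit_open by blast
  have "W \<inter> action_orbit action p \<noteq> {}"
    using q W(1,2) by (metis IntD2 IntI closure_iff_nhds_not_empty emptyE subset_refl inf_commute)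
  then obtain r where r: "r \<in> W" "r \<in> action_orbit action p" by blast
  then have "r \<in> action_orbit action q" using W(3) inv[OF p] by (auto simp: action_orbit_def)
  then have "action_orbit action q = action_orbit action p"
    using action_orbit_eq[of q r] action_orbit_eq[of p r] r(2) q p SP by auto
  then show "q \<in> action_orbit action p" using action_orbit_self[of q] q SP by auto
qed

lemma connected_in_orbit:
  assumes "connected C" "C \<subseteq> S" "p \<in> C" "q \<in> C"
  shows "q \<in> action_orbit action p"
proof (rule ccontr)
  assume nq: "q \<notin> action_orbit action p"
  obtain W where W: "\<And>r. r \<in> S \<Longrightarrow> open (W r) \<and> r \<in> W r \<and> S \<inter> W r \<subseteq> action_orbit action r"
    using orbit_open by metis
  define A where "A = (\<Union>r \<in> S \<inter> action_orbit action p. W r)"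
  define B where "B = (\<Union>r \<in> S - action_orbit action p. W r)"
  have pS: "p \<in> S" "q \<in> S" using assms by auto
  have "open A" "open B" using W by (auto simp: A_def B_def)
  moreover have "C \<subseteq> A \<union> B" using W assms(2) by (fastforce simp: A_def B_def)
  moreover have "A \<inter> B \<inter> C = {}"
  proof (rule ccontr)
    assume "A \<inter> B \<inter> C \<noteq> {}"
    then obtain s r r' where s: "s \<in> S" "r \<in> S" "r' \<in> S" "s \<in> W r" "s \<in> W r'"
      "r \<in> action_orbit action p" "r' \<notin> action_orbit action p"
      using assms(2) by (auto simp: A_def B_def)
    then have "s \<in> action_orbit action r" "s \<in> action_orbit action r'" using W by blast+
    then have "action_orbit action r = action_orbit action r'"
      using action_orbit_eq s SP by (metis subsetD)
    moreover have "action_orbit action r = action_orbit action p"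
      using action_orbit_eq s pS SP by blast
    ultimately show False using action_orbit_self[of r'] s SP by auto
  qed
  moreover have "A \<inter> C \<noteq> {}" "B \<inter> C \<noteq> {}"
  proof -
    have "p \<in> A" using W[OF pS(1)] pS action_orbit_self SP by (auto simp: A_def)
    moreover have "q \<in> B" using W[OF pS(2)] pS nq by (auto simp: B_def)
    ultimately show "A \<inter> C \<noteq> {}" "B \<inter> C \<noteq> {}" using assms by auto
  qed
  ultimately show False using connectedD[OF assms(1), of A B] by blast
qed

end

end

text \<open>
  A map into \<open>S\<close> covers a neighbourhood of \<open>c 0\<close> in \<open>S\<close> as soon as its composition with an injective
  coordinate map \<open>h\<close> has a surjective derivative at the single point \<open>0\<close>: by Sussmann's open mapping theorem this
  composition covers a neighbourhood of \<open>h (c 0)\<close>.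
\<close>

lemma parametrization_covers_neighborhood:
  fixes c :: "'m::euclidean_space \<Rightarrow> 'a::euclidean_space" and h :: "'a \<Rightarrow> 'n::euclidean_space"
  assumes c: "continuous_on UNIV c" "range c \<subseteq> S" and W: "open W" "c 0 \<in> W"
    and h: "continuous_on W h" "inj_on h (S \<inter> W)"
    and d: "((\<lambda>t. h (c t)) has_derivative D) (at 0)" "surj D"
  obtains W' where "open W'" "c 0 \<in> W'" "S \<inter> W' \<subseteq> range c"
proof -
  define N where "N = c -` W"
  have N: "open N" "0 \<in> N" using W c(1) by (auto simp: N_def intro!: open_vimage)
  have lin: "linear D" using d(1) by (rule has_derivative_linear)
  obtain g where g: "linear g" "D \<circ> g = id" using linear_surjective_right_inverse[OF lin d(2)] by blast
  have "continuous_on N (\<lambda>t. h (c t))"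
    by (rule continuous_on_compose2[OF h(1) continuous_on_subset[OF c(1)]]) (auto simp: N_def)
  from sussmann_open_mapping[OF N(1) this N(2) d(1) _ g(2) subset_refl]
  have "h (c 0) \<in> interior ((\<lambda>t. h (c t)) ` N)"
    using g(1) linear_conv_bounded_linear interior_open[OF N(1)] N(2) by blast
  then have I: "h (c 0) \<in> interior ((\<lambda>t. h (c t)) ` N)" .
  \<comment> \<open>a point of \<open>S\<close> in this set has the same \<open>h\<close>-value as a point \<open>c t\<close>, and \<open>h\<close> is injective\<close>
  define W' where "W' = W \<inter> h -` interior ((\<lambda>t. h (c t)) ` N)"
  have "open W'" unfolding W'_def
    by (rule continuous_open_preimage[OF h(1) W(1) open_interior])
  moreover have "c 0 \<in> W'" using I W(2) by (simp add: W'_def)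
  moreover have "S \<inter> W' \<subseteq> range c"
  proof
    fix q assume q: "q \<in> S \<inter> W'"
    then have "h q \<in> (\<lambda>t. h (c t)) ` N" using interior_subset by (auto simp: W'_def)
    then obtain t where t: "t \<in> N" "h q = h (c t)" by blast
    have "c t \<in> S \<inter> W" using t(1) c(2) by (auto simp: N_def)
    then have "q = c t" using inj_onD[OF h(2) t(2)] q by (auto simp: W'_def)
    then show "q \<in> range c" by simp
  qed
  ultimately show thesis by (rule that)
qed

section \<open>Calculus of iterated derivatives and smooth local inverses\<close>

lemma C_k_on_cong:
  assumes S: "open S" and eq: "\<And>x. x \<in> S \<Longrightarrow> f x = g x"
  shows "C_k_on k f S \<longleftrightarrow> C_k_on k g S"
proof -
  have *: "C_k_on k f S \<Longrightarrow> C_k_on k g S" if "\<And>x. x \<in> S \<Longrightarrow> f x = g x" for f g :: "'a \<Rightarrow> 'b"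
    using that
  proof (induction k arbitrary: f g)
    case 0
    then show ?case by (simp cong: continuous_on_cong)
  next
    case (Suc k)
    have d: "(f has_derivative D) (at x) \<longleftrightarrow> (g has_derivative D) (at x)" if "x \<in> S" for x D
      using has_derivative_transform_within_open[OF _ S that, of f D UNIV g]
        has_derivative_transform_within_open[OF _ S that, of g D UNIV f] Suc.prems(2) by auto
    then have "frechet_derivative f (at x) = frechet_derivative g (at x)" if "x \<in> S" for x
      using that by (simp add: frechet_derivative_def)
    moreover have "g differentiable (at x)" if "x \<in> S" for x
      using Suc.prems(1) d that by (auto simp: differentiable_def)
    ultimately show ?case
      using Suc.prems(1) Suc.IH[of "\<lambda>x. frechet_derivative f (at x) v" "\<lambda>x. frechet_derivative g (at x) v" for v]
      by auto
  qed
  from *[of f g] *[of g f] eq show ?thesis by metis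
qed

lemma C_k_on_SucI:
  assumes "open S" and d: "\<And>x. x \<in> S \<Longrightarrow> (f has_derivative f' x) (at x)"
    and "\<And>v. C_k_on k (\<lambda>x. f' x v) S"
  shows "C_k_on (Suc k) f S"
proof -
  have "frechet_derivative f (at x) = f' x" if "x \<in> S" for x
    using frechet_derivative_at[OF d[OF that]] by simp
  then have "C_k_on k (\<lambda>x. frechet_derivative f (at x) v) S" for v
    using assms(3)[of v] C_k_on_cong[OF \<open>open S\<close>, of "\<lambda>x. frechet_derivative f (at x) v" "\<lambda>x. f' x v"] by simp
  then show ?thesis using d by (auto simp: differentiable_def)
qed

lemma C_k_on_has_derivative:
  "C_k_on (Suc k) f S \<Longrightarrow> x \<in> S \<Longrightarrow> (f has_derivative frechet_derivative f (at x)) (at x)"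
  by (simp add: frechet_derivative_works)

lemma C_k_on_frechet:
  "C_k_on (Suc k) f S \<Longrightarrow> C_k_on k (\<lambda>x. frechet_derivative f (at x) v) S"
  by simp

lemma C_k_on_continuous_on:
  assumes "C_k_on k f S"
  shows "continuous_on S f"
proof (cases k)
  case (Suc m)
  then have "isCont f x" if "x \<in> S" for x
    using assms that differentiable_imp_continuous_within by auto
  then show ?thesis by (simp add: continuous_at_imp_continuous_on)
qed (use assms in simp)

lemma C_k_on_Suc_D: "C_k_on (Suc k) f S \<Longrightarrow> C_k_on k f S"
proof (induction k arbitrary: f)
  case 0
  then show ?case using C_k_on_continuous_on[of "Suc 0"] by simp
next
  case (Suc k)
  have "C_k_on k (\<lambda>x. frechet_derivative f (at x) v) S" for v
    by (rule Suc.IH[OF C_k_on_frechet[OF Suc.prems]])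
  then show ?case using Suc.prems by simp
qed

lemma C_k_on_subset: "C_k_on k f S \<Longrightarrow> T \<subseteq> S \<Longrightarrow> C_k_on k f T"
  by (induction k arbitrary: f) (auto intro: continuous_on_subset)

lemma C_k_on_const: "open S \<Longrightarrow> C_k_on k (\<lambda>x. c) S"
proof (induction k arbitrary: c)
  case (Suc k)
  show ?case
    by (rule C_k_on_SucI[OF Suc.prems has_derivative_const]) (rule Suc.IH[OF Suc.prems])
qed simp

lemma C_k_on_linear:
  assumes "open S" "bounded_linear f"
  shows "C_k_on k f S"
proof (cases k)
  case (Suc m)
  then show ?thesis
    using C_k_on_SucI[OF assms(1) bounded_linear_imp_has_derivative[OF assms(2)]] C_k_on_const[OF assms(1)] by metis
qed (use assms linear_continuous_on in auto)

lemma C_k_on_add: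
  assumes "open S" "C_k_on k f S" "C_k_on k g S"
  shows "C_k_on k (\<lambda>x. f x + g x) S"
  using assms(2,3)
proof (induction k arbitrary: f g)
  case (Suc k)
  have "C_k_on k (\<lambda>x. frechet_derivative f (at x) v + frechet_derivative g (at x) v) S" for v
    by (rule Suc.IH[OF C_k_on_frechet[OF Suc.prems(1)] C_k_on_frechet[OF Suc.prems(2)]])
  then show ?case
    by (rule C_k_on_SucI[OF assms(1), where f' = "\<lambda>x v. frechet_derivative f (at x) v + frechet_derivative g (at x) v", rotated])
      (rule has_derivative_add[OF C_k_on_has_derivative[OF Suc.prems(1)] C_k_on_has_derivative[OF Suc.prems(2)]]; assumption)
qed (auto intro: continuous_intros)

lemma C_k_on_bilinear:
  assumes "open S" "bounded_bilinear B" "C_k_on k f S" "C_k_on k g S"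
  shows "C_k_on k (\<lambda>x. B (f x) (g x)) S"
  using assms(3,4)
proof (induction k arbitrary: f g)
  case 0
  then show ?case using bounded_bilinear.continuous_on[OF assms(2)] by auto
next
  case (Suc k)
  have "C_k_on k (\<lambda>x. B (f x) (frechet_derivative g (at x) v) + B (frechet_derivative f (at x) v) (g x)) S" for v
    by (rule C_k_on_add[OF assms(1) Suc.IH[OF C_k_on_Suc_D[OF Suc.prems(1)] C_k_on_frechet[OF Suc.prems(2)]]
          Suc.IH[OF C_k_on_frechet[OF Suc.prems(1)] C_k_on_Suc_D[OF Suc.prems(2)]]])
  then show ?case
    by (rule C_k_on_SucI[OF assms(1), where f' = "\<lambda>x v. B (f x) (frechet_derivative g (at x) v) + B (frechet_derivative f (at x) v) (g x)", rotated])
      (rule bounded_bilinear.FDERIV[OF assms(2) C_k_on_has_derivative[OF Suc.prems(1)] C_k_on_has_derivative[OF Suc.prems(2)]]; assumption)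
qed

lemma C_k_on_sum:
  assumes "open S" "\<And>i. i \<in> I \<Longrightarrow> C_k_on k (f i) S"
  shows "C_k_on k (\<lambda>x. \<Sum>i\<in>I. f i x) S"
  using assms(2) by (induction I rule: infinite_finite_induct) (auto intro: C_k_on_const C_k_on_add assms(1))

lemma C_k_on_bounded_linear_compose:
  assumes "open S" "bounded_linear L" "C_k_on k f S"
  shows "C_k_on k (\<lambda>x. L (f x)) S"
  using assms(3)
proof (induction k arbitrary: f)
  case 0
  then show ?case using bounded_linear.continuous_on[OF assms(2)] by auto
next
  case (Suc k)
  show ?case
    by (rule C_k_on_SucI[OF assms(1), where f' = "\<lambda>x v. L (frechet_derivative f (at x) v)", rotated], rule Suc.IH[OF C_k_on_frechet[OF Suc.prems]])
      (intro bounded_linear.has_derivative[OF assms(2)] C_k_on_has_derivative[OF Suc.prems]; assumption)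
qed

lemma linear_expand:
  assumes "linear A"
  shows "A w = (\<Sum>b\<in>Basis. (w \<bullet> b) *\<^sub>R A b)"
  using linear_sum[OF assms, of "\<lambda>b. (w \<bullet> b) *\<^sub>R b" Basis]
  by (simp add: euclidean_representation linear_scale[OF assms])

lemma C_k_on_apply_linear:
  assumes "open S" and lin: "\<And>x. x \<in> S \<Longrightarrow> linear (A x)"
    and "\<And>v. C_k_on k (\<lambda>x. A x v) S" "C_k_on k w S"
  shows "C_k_on k (\<lambda>x. A x (w x)) S"
proof -
  have "C_k_on k (\<lambda>x. \<Sum>b\<in>Basis. (w x \<bullet> b) *\<^sub>R A x b) S"
    by (intro C_k_on_sum assms(1) C_k_on_bilinear[OF _ bounded_bilinear_scaleR] assms(3)
        C_k_on_bounded_linear_compose[OF _ bounded_linear_inner_left] assms(4))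
  then show ?thesis
    using C_k_on_cong[OF assms(1), of "\<lambda>x. A x (w x)" "\<lambda>x. \<Sum>b\<in>Basis. (w x \<bullet> b) *\<^sub>R A x b"] linear_expand[OF lin]
    by blast
qed

lemma C_k_on_compose:
  assumes "open S" "open T" "C_k_on k f T" "C_k_on k g S" "g ` S \<subseteq> T"
  shows "C_k_on k (\<lambda>x. f (g x)) S"
  using assms(3,4)
proof (induction k arbitrary: f)
  case 0
  then show ?case using continuous_on_compose2 assms(5) by auto
next
  case (Suc k)
  have in_T: "g x \<in> T" if "x \<in> S" for x using assms(5) that by blast
  show ?case
  proof (rule C_k_on_SucI[OF assms(1)])
    show "((\<lambda>x. f (g x)) has_derivative
        (\<lambda>v. frechet_derivative f (at (g x)) (frechet_derivative g (at x) v))) (at x)" if "x \<in> S" for x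
      by (rule has_derivative_compose[OF C_k_on_has_derivative[OF Suc.prems(2) that]
            C_k_on_has_derivative[OF Suc.prems(1) in_T[OF that]]])
    show "C_k_on k (\<lambda>x. frechet_derivative f (at (g x)) (frechet_derivative g (at x) v)) S" for v
    proof (rule C_k_on_apply_linear[OF assms(1), where A = "\<lambda>x. frechet_derivative f (at (g x))"])
      show "linear (frechet_derivative f (at (g x)))" if "x \<in> S" for x
        using Suc.prems(1) in_T[OF that] by (auto intro: linear_frechet_derivative)
    next
      show "C_k_on k (\<lambda>x. frechet_derivative f (at (g x)) v) S" for v
        by (rule Suc.IH[OF C_k_on_frechet[OF Suc.prems(1)] C_k_on_Suc_D[OF Suc.prems(2)]])
      show "C_k_on k (\<lambda>x. frechet_derivative g (at x) v) S"
        by (rule C_k_on_frechet[OF Suc.prems(2)])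
    qed
  qed
qed

text \<open>
  Only continuity of \<open>f\<close> is assumed; this suffices because \<open>\<psi>\<close> vanishes at the point. It is the step by
  which differentiability of inverse operators follows from their continuity.
\<close>

lemma continuous_times_vanishing_has_derivative:
  fixes f :: "'a::real_normed_vector \<Rightarrow> real" and \<psi> :: "'a \<Rightarrow> 'b::real_normed_vector"
  assumes f: "isCont f y" and \<psi>: "(\<psi> has_derivative \<psi>') (at y)" "\<psi> y = 0"
  shows "((\<lambda>x. f x *\<^sub>R \<psi> x) has_derivative (\<lambda>h. f y *\<^sub>R \<psi>' h)) (at y)"
proof -
  interpret bounded_linear \<psi>' using \<psi>(1) by (rule has_derivative_bounded_linear)
  obtain C where C: "\<And>h. norm (\<psi>' h) \<le> norm h * C" using bounded by blast
  have "((\<lambda>x. (f x - f y) *\<^sub>R \<psi> x) has_derivative (\<lambda>h. 0)) (at y)"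
    unfolding has_derivative_at_alt
  proof (intro conjI allI impI)
    fix e :: real assume "e > 0"
    define K where "K = \<bar>C\<bar> + 1"
    have K: "K > 0" by (simp add: K_def)
    obtain d where d: "d > 0" "\<And>x. norm (x - y) < d \<Longrightarrow> norm (\<psi> x - \<psi> y - \<psi>' (x - y)) \<le> 1 * norm (x - y)"
      using \<psi>(1) unfolding has_derivative_at_alt by (meson zero_less_one)
    have "e / K > 0" using \<open>e > 0\<close> K by simp
    then obtain d' where d': "d' > 0" "\<And>x. dist x y < d' \<Longrightarrow> dist (f x) (f y) < e / K"
      using f unfolding continuous_at_eps_delta by metis
    show "\<exists>d>0. \<forall>x. norm (x - y) < d \<longrightarrow>
        norm ((f x - f y) *\<^sub>R \<psi> x - (f y - f y) *\<^sub>R \<psi> y - 0) \<le> e * norm (x - y)"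
    proof (intro exI[of _ "min d d'"] conjI allI impI)
      fix x assume x: "norm (x - y) < min d d'"
      have "norm (\<psi> x) \<le> norm (\<psi> x - \<psi> y - \<psi>' (x - y)) + norm (\<psi>' (x - y))"
        using norm_triangle_ineq[of "\<psi> x - \<psi>' (x - y)" "\<psi>' (x - y)"] \<psi>(2) by simp
      also have "\<dots> \<le> norm (x - y) + norm (x - y) * C" using d(2)[of x] C[of "x - y"] x by simp
      also have "\<dots> \<le> norm (x - y) + norm (x - y) * \<bar>C\<bar>" by (intro add_left_mono mult_left_mono) auto
      also have "\<dots> = K * norm (x - y)" by (simp add: K_def algebra_simps)
      finally have 1: "norm (\<psi> x) \<le> K * norm (x - y)" .
      have "\<bar>f x - f y\<bar> \<le> e / K" using d'(2)[of x] x by (simp add: dist_norm)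
      then have "\<bar>f x - f y\<bar> * norm (\<psi> x) \<le> (e / K) * (K * norm (x - y))"
        using 1 \<open>e / K > 0\<close> by (intro mult_mono) auto
      also have "\<dots> = e * norm (x - y)" using K by simp
      finally show "norm ((f x - f y) *\<^sub>R \<psi> x - (f y - f y) *\<^sub>R \<psi> y - 0) \<le> e * norm (x - y)" by simp
    qed (use d d' in auto)
  qed simp
  moreover have "((\<lambda>x. f y *\<^sub>R \<psi> x) has_derivative (\<lambda>h. f y *\<^sub>R \<psi>' h)) (at y)"
    by (rule has_derivative_scaleR_right[OF \<psi>(1)])
  ultimately have "((\<lambda>x. (f x - f y) *\<^sub>R \<psi> x + f y *\<^sub>R \<psi> x) has_derivative (\<lambda>h. 0 + f y *\<^sub>R \<psi>' h)) (at y)"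
    by (rule has_derivative_add)
  then show ?thesis by (simp add: algebra_simps)
qed

context
  fixes S :: "'b::euclidean_space set" and A E :: "'b \<Rightarrow> 'a::euclidean_space \<Rightarrow> 'a"
  assumes S: "open S" and A: "\<And>y. y \<in> S \<Longrightarrow> linear (A y)" and E: "\<And>y. y \<in> S \<Longrightarrow> linear (E y)"
    and AE: "\<And>y v. y \<in> S \<Longrightarrow> A y (E y v) = v" and EA: "\<And>y v. y \<in> S \<Longrightarrow> E y (A y v) = v"
begin

text \<open>
  The resolvent identity \<open>E y = E y0 - E y0 (A y - A y0) E y\<close> in a basis. It yields first the continuity of
  \<open>E\<close>, then its derivative.
\<close>

lemma inverse_family_expand:
  assumes "y \<in> S" "y0 \<in> S"
  shows "E y v = E y0 v - (\<Sum>b\<in>Basis. (E y v \<bullet> b) *\<^sub>R E y0 (A y b - A y0 b))"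
proof -
  have "(\<Sum>b\<in>Basis. (E y v \<bullet> b) *\<^sub>R E y0 (A y b - A y0 b)) = E y0 (A y (E y v)) - E y0 (A y0 (E y v))"
    using linear_expand[OF linear_compose[OF A E], OF assms, of "E y v"]
      linear_expand[OF linear_compose[OF A E], OF assms(2,2), of "E y v"]
    by (simp add: linear_diff[OF E[OF assms(2)]] scaleR_diff_right sum_subtractf)
  then show ?thesis by (simp add: AE EA assms)
qed

lemma inverse_family_continuous:
  assumes cont: "\<And>v. continuous_on S (\<lambda>y. A y v)"
  shows "continuous_on S (\<lambda>y. E y v)"
  unfolding continuous_on_eq_continuous_at[OF S]
proof
  fix y0 assume y0: "y0 \<in> S"
  define \<eta> where "\<eta> y = (\<Sum>b\<in>Basis. norm (E y0 (A y b - A y0 b)))" for y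
  have "isCont (\<lambda>y. E y0 (A y b - A y0 b)) y0" for b
    using cont[of b] y0 linear_conv_bounded_linear E[OF y0]
    by (intro bounded_linear.continuous[of "E y0"] continuous_intros)
      (auto simp: continuous_on_eq_continuous_at[OF S])
  then have "isCont \<eta> y0" unfolding \<eta>_def by (intro continuous_intros) auto
  moreover have "\<eta> y0 = 0" by (simp add: \<eta>_def linear_0[OF E[OF y0]])
  ultimately have \<eta>0: "(\<eta> \<longlongrightarrow> 0) (at y0)" by (simp add: isCont_def)
  have bound: "norm (E y v - E y0 v) \<le> norm (E y v) * \<eta> y" if "y \<in> S" for y
  proof -
    have "norm (E y v - E y0 v) = norm (\<Sum>b\<in>Basis. (E y v \<bullet> b) *\<^sub>R E y0 (A y b - A y0 b))"
      using inverse_family_expand[OF that y0, of v] by (metis add_diff_cancel_left' diff_add_cancel norm_minus_commute)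
    also have "\<dots> \<le> (\<Sum>b\<in>Basis. norm (E y v) * norm (E y0 (A y b - A y0 b)))"
      by (rule sum_norm_le) (auto intro!: mult_right_mono Basis_le_norm)
    finally show ?thesis by (simp add: \<eta>_def sum_distrib_left)
  qed
  have "\<forall>\<^sub>F y in at y0. dist (\<eta> y) 0 < 1/2" using \<eta>0 by (rule tendstoD) simp
  moreover have "\<forall>\<^sub>F y in at y0. y \<in> S" using S y0 eventually_at_in_open' by blast
  ultimately have "\<forall>\<^sub>F y in at y0. norm (E y v - E y0 v) \<le> 2 * norm (E y0 v) * \<eta> y"
  proof eventually_elim
    case (elim y)
    have \<eta>: "0 \<le> \<eta> y" by (auto simp: \<eta>_def intro: sum_nonneg)
    have "norm (E y v) \<le> norm (E y0 v) + norm (E y v - E y0 v)"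
      using norm_triangle_ineq[of "E y0 v" "E y v - E y0 v"] by simp
    also have "norm (E y v - E y0 v) \<le> norm (E y v) * (1/2)"
      by (rule order_trans[OF bound[OF elim(2)] mult_left_mono]) (use elim(1) in auto)
    finally have "norm (E y v) \<le> 2 * norm (E y0 v)" by simp
    from mult_right_mono[OF this \<eta>] show ?case by (rule order_trans[OF bound[OF elim(2)]])
  qed
  then have "((\<lambda>y. E y v - E y0 v) \<longlongrightarrow> 0) (at y0)"
    by (rule Lim_null_comparison) (rule tendsto_mult_right_zero[OF \<eta>0])
  then show "isCont (\<lambda>y. E y v) y0" by (simp add: isCont_def LIM_zero_iff)
qed

lemma C_k_on_inverse_family:
  assumes "\<And>v. C_k_on k (\<lambda>y. A y v) S"
  shows "C_k_on k (\<lambda>y. E y v) S"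
  using assms
proof (induction k arbitrary: v)
  case 0
  then show ?case using inverse_family_continuous by simp
next
  case (Suc k)
  let ?A' = "\<lambda>b y. frechet_derivative (\<lambda>y. A y b) (at y)"
  have contE: "continuous_on S (\<lambda>y. E y v)" for v
    by (rule inverse_family_continuous[OF C_k_on_continuous_on[OF Suc.prems]])
  show ?case
  proof (rule C_k_on_SucI[OF S])
    fix y0 assume y0: "y0 \<in> S"
    have "((\<lambda>y. E y0 v - (\<Sum>b\<in>Basis. (E y v \<bullet> b) *\<^sub>R E y0 (A y b - A y0 b))) has_derivative
        (\<lambda>h. 0 - (\<Sum>b\<in>Basis. (E y0 v \<bullet> b) *\<^sub>R E y0 (?A' b y0 h - 0)))) (at y0)"
    proof (intro has_derivative_diff has_derivative_const has_derivative_sum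
        continuous_times_vanishing_has_derivative)
      fix b :: 'a
      show "isCont (\<lambda>y. E y v \<bullet> b) y0"
        using contE y0 by (intro continuous_intros) (auto simp: continuous_on_eq_continuous_at[OF S])
      show "((\<lambda>y. E y0 (A y b - A y0 b)) has_derivative (\<lambda>h. E y0 (?A' b y0 h - 0))) (at y0)"
        using E[OF y0] linear_conv_bounded_linear
        by (intro bounded_linear.has_derivative[of "E y0"] has_derivative_diff has_derivative_const
            C_k_on_has_derivative[OF Suc.prems y0]) auto
    qed (simp add: linear_0[OF E[OF y0]])
    from has_derivative_transform_within_open[OF this S y0 inverse_family_expand[OF _ y0, symmetric]]
    show "((\<lambda>y. E y v) has_derivative (\<lambda>h. - (\<Sum>b\<in>Basis. (E y0 v \<bullet> b) *\<^sub>R E y0 (?A' b y0 h)))) (at y0)"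
      by simp
  next
    fix u
    have E': "C_k_on k (\<lambda>y. E y v) S" for v
      by (rule Suc.IH[OF C_k_on_Suc_D[OF Suc.prems]])
    have "C_k_on k (\<lambda>y. (E y v \<bullet> b) *\<^sub>R E y (?A' b y u)) S" for b
      by (rule C_k_on_bilinear[OF S bounded_bilinear_scaleR
            C_k_on_bounded_linear_compose[OF S bounded_linear_inner_left E']
            C_k_on_apply_linear[OF S E E' C_k_on_frechet[OF Suc.prems]]])
    then have "C_k_on k (\<lambda>y. \<Sum>b\<in>Basis. (E y v \<bullet> b) *\<^sub>R E y (?A' b y u)) S"
      by (intro C_k_on_sum[OF S])
    from C_k_on_bounded_linear_compose[OF S bounded_linear_minus[OF bounded_linear_ident] this]
    show "C_k_on k (\<lambda>y. - (\<Sum>b\<in>Basis. (E y v \<bullet> b) *\<^sub>R E y (?A' b y u))) S" .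
  qed
qed

end


text \<open>
  The derivative of \<open>g\<close> at \<open>y\<close> is the inverse of the derivative of \<open>f\<close> at \<open>g y\<close>; if \<open>g\<close> is \<open>C\<^sup>k\<close>, the latter is a
  \<open>C\<^sup>k\<close> family of operators, hence so is the family of inverses, and \<open>g\<close> is \<open>k + 1\<close> times continuously differentiable.
\<close>

theorem C_k_on_inverse:
  fixes f :: "'a::euclidean_space \<Rightarrow> 'a"
  assumes W: "open W" "open W'" and f: "\<And>k. C_k_on k f W"
    and g: "\<And>y. y \<in> W' \<Longrightarrow> g y \<in> W"
    and g': "\<And>y. y \<in> W' \<Longrightarrow> (g has_derivative g' y) (at y)"
    and inverse: "\<And>y v. y \<in> W' \<Longrightarrow> frechet_derivative f (at (g y)) (g' y v) = v"
      "\<And>y v. y \<in> W' \<Longrightarrow> g' y (frechet_derivative f (at (g y)) v) = v"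
  shows "C_k_on k g W'"
proof (induction k)
  case 0
  show ?case
    using has_derivative_continuous[OF g'] by (simp add: continuous_at_imp_continuous_on)
next
  case (Suc k)
  have "C_k_on k (\<lambda>y. frechet_derivative f (at (g y)) v) W'" for v
    by (rule C_k_on_compose[OF W(2,1) C_k_on_frechet[OF f] Suc]) (use g in auto)
  moreover have "linear (frechet_derivative f (at (g y)))" if "y \<in> W'" for y
    using C_k_on_has_derivative[OF f g[OF that]] has_derivative_linear by blast
  moreover have "linear (g' y)" if "y \<in> W'" for y
    using g'[OF that] has_derivative_linear by blast
  ultimately have smooth': "C_k_on k (\<lambda>y. g' y v) W'" for v
    using C_k_on_inverse_family[OF W(2), of "\<lambda>y. frechet_derivative f (at (g y))" g' k v] inverse by metis
  show ?case
    by (rule C_k_on_SucI[OF W(2) g' smooth'])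
qed

lemma smooth_on_const: "open S \<Longrightarrow> smooth_on (\<lambda>x. c) S"
  by (simp add: smooth_on_def C_k_on_const)

lemma smooth_on_linear: "open S \<Longrightarrow> bounded_linear f \<Longrightarrow> smooth_on f S"
  by (simp add: smooth_on_def C_k_on_linear)

lemma smooth_on_add: "open S \<Longrightarrow> smooth_on f S \<Longrightarrow> smooth_on g S \<Longrightarrow> smooth_on (\<lambda>x. f x + g x) S"
  by (simp add: smooth_on_def C_k_on_add)

lemma smooth_on_bilinear:
  "open S \<Longrightarrow> bounded_bilinear B \<Longrightarrow> smooth_on f S \<Longrightarrow> smooth_on g S \<Longrightarrow> smooth_on (\<lambda>x. B (f x) (g x)) S"
  by (simp add: smooth_on_def C_k_on_bilinear)

lemma smooth_on_linear_compose:
  "open S \<Longrightarrow> bounded_linear L \<Longrightarrow> smooth_on f S \<Longrightarrow> smooth_on (\<lambda>x. L (f x)) S"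
  by (simp add: smooth_on_def C_k_on_bounded_linear_compose)

lemma smooth_on_diff:
  assumes "open S" "smooth_on f S" "smooth_on g S"
  shows "smooth_on (\<lambda>x. f x - g x) S"
  using smooth_on_add[OF assms(1,2) smooth_on_linear_compose[OF assms(1)
        bounded_linear_minus[OF bounded_linear_ident] assms(3)]] by simp

lemma smooth_on_Pair:
  assumes "open S" "smooth_on f S" "smooth_on g S"
  shows "smooth_on (\<lambda>x. (f x, g x)) S"
  using smooth_on_add[OF assms(1)
      smooth_on_linear_compose[OF assms(1) bounded_linear_Pair[OF bounded_linear_ident bounded_linear_zero] assms(2)]
      smooth_on_linear_compose[OF assms(1) bounded_linear_Pair[OF bounded_linear_zero bounded_linear_ident] assms(3)]]
  by simp

lemma smooth_on_subset: "smooth_on f S \<Longrightarrow> T \<subseteq> S \<Longrightarrow> smooth_on f T"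
  unfolding smooth_on_def using C_k_on_subset by blast

lemma smooth_on_inverse:
  fixes f :: "'a::euclidean_space \<Rightarrow> real"
  assumes S: "open S" and f: "smooth_on f S" and ne: "\<And>x. x \<in> S \<Longrightarrow> f x \<noteq> 0"
  shows "smooth_on (\<lambda>x. inverse (f x)) S"
proof -
  have inv: "C_k_on k inverse (- {0 :: real})" for k
  proof (induction k)
    case (Suc k)
    have "C_k_on k (\<lambda>x :: real. (- 1) *\<^sub>R (inverse x * v * inverse x)) (- {0})" for v
      by (intro C_k_on_bounded_linear_compose[OF _ bounded_linear_scaleR_right]
          C_k_on_bilinear[OF _ bounded_bilinear_mult] Suc C_k_on_const) auto
    then have "C_k_on k (\<lambda>x :: real. - (inverse x * v * inverse x)) (- {0})" for v
      by simp
    then show ?case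
      by (intro C_k_on_SucI[where f' = "\<lambda>x v. - (inverse x * v * inverse x)"] has_derivative_inverse') auto
  qed (auto intro!: continuous_intros)
  have "C_k_on k (\<lambda>x. inverse (f x)) S" for k
    by (rule C_k_on_compose[OF S _ inv f[unfolded smooth_on_def, rule_format]]) (use ne in auto)
  then show ?thesis by (simp add: smooth_on_def)
qed

lemma smooth_on_imp_has_derivative:
  "smooth_on f S \<Longrightarrow> x \<in> S \<Longrightarrow> (f has_derivative frechet_derivative f (at x)) (at x)"
  using C_k_on_has_derivative unfolding smooth_on_def by blast

theorem smooth_local_diffeomorphism:
  fixes f :: "'a::euclidean_space \<Rightarrow> 'a"
  assumes S: "open S" and f: "smooth_on f S" and p: "p \<in> S"
    and d: "(f has_derivative f') (at p)" and inj: "inj f'"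
  obtains W W' g where "open W" "p \<in> W" "W \<subseteq> S" "open W'" "homeomorphism W W' f g" "smooth_on g W'"
proof -
  define Df where "Df x = Blinfun (frechet_derivative f (at x))" for x
  have Df: "blinfun_apply (Df x) = frechet_derivative f (at x)" if "x \<in> S" for x
    unfolding Df_def
    by (rule bounded_linear_Blinfun_apply[OF has_derivative_bounded_linear[OF smooth_on_imp_has_derivative[OF f that]]])
  have "continuous_on S (\<lambda>x. frechet_derivative f (at x) v)" for v
    using f[unfolded smooth_on_def, rule_format, of "Suc 0"] by simp
  then have cont: "continuous_on S Df"
    by (intro continuous_on_blinfun_componentwise) (simp add: Df cong: continuous_on_cong)
  have f': "f' = frechet_derivative f (at p)"
    using frechet_derivative_at[OF d] by simp
  have lin: "linear f'" using d by (rule has_derivative_linear)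
  obtain h where h: "linear h" "h \<circ> f' = id"
    using linear_injective_left_inverse[OF lin inj] by blast
  have inv: "Blinfun h o\<^sub>L Df p = id_blinfun"
  proof (rule blinfun_eqI)
    fix v
    show "blinfun_apply (Blinfun h o\<^sub>L Df p) v = blinfun_apply id_blinfun v"
      using h(2) linear_conv_bounded_linear[of h] h(1)
      by (simp add: Df[OF p] bounded_linear_Blinfun_apply fun_eq_iff f')
  qed
  have d1: "(f has_derivative blinfun_apply (Df x)) (at x)" if "x \<in> S" for x
    using smooth_on_imp_has_derivative[OF f that] by (simp add: Df[OF that])
  show thesis
  proof (rule inverse_function_theorem[OF S d1 cont p inv])
  fix W W' g g' assume W: "open W" "W \<subseteq> S" "p \<in> W" "open W'" "homeomorphism W W' f g"
    and g': "\<And>y. y \<in> W' \<Longrightarrow> (g has_derivative g' y) (at y)"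
      "\<And>y. y \<in> W' \<Longrightarrow> g' y = inv (blinfun_apply (Df (g y)))"
      "\<And>y. y \<in> W' \<Longrightarrow> bij (blinfun_apply (Df (g y)))"
  have g: "g y \<in> W" if "y \<in> W'" for y
    using W(5) that by (auto simp: homeomorphism_def)
  have "C_k_on k g W'" for k
  proof (rule C_k_on_inverse[OF W(1,4) _ g g'(1)])
    show "C_k_on k f W" for k
      using f W(2) C_k_on_subset unfolding smooth_on_def by blast
    fix y v assume y: "y \<in> W'"
    have e: "frechet_derivative f (at (g y)) = blinfun_apply (Df (g y))"
      using Df g[OF y] W(2) by auto
    show "frechet_derivative f (at (g y)) (g' y v) = v" "g' y (frechet_derivative f (at (g y)) v) = v"
      unfolding e g'(2)[OF y] using g'(3)[OF y] by (simp_all add: bij_is_surj surj_f_inv_f bij_is_inj inv_f_f)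
  qed
  then have "smooth_on g W'" by (simp add: smooth_on_def)
  then show thesis using that W by blast
  qed
qed

section \<open>The vector fields in coordinates\<close>

text \<open>
  The commutators of \<open>\<zeta>\<close> with \<open>U\<close> and \<open>V\<close> are again of the form of the derivative of a curve of
  potentials; comparing coefficients of the spectral parameter gives the fields in the
  coordinates \<open>\<alpha>, \<beta>, \<gamma>\<close> (see \<open>lax_equation\<close>).
\<close>

definition field_U :: "potential \<Rightarrow> potential" where
  "field_U p = (let \<alpha> = fst p; \<beta> = fst (snd p); \<gamma> = snd (snd p) in
     (\<beta> * of_real \<gamma> - cnj \<beta> * of_real (inverse \<gamma>) + of_real (\<gamma>\<^sup>2 - (inverse \<gamma>)\<^sup>2),
      2 * cnj \<alpha> * of_real (inverse \<gamma>) - 2 * \<alpha> * of_real \<gamma> - (\<alpha> - cnj \<alpha>) * \<beta>,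
      - 2 * \<gamma> * Re \<alpha>))"

definition field_V :: "potential \<Rightarrow> potential" where
  "field_V p = (let \<alpha> = fst p; \<beta> = fst (snd p); \<gamma> = snd (snd p) in
     (\<i> * (\<beta> * of_real \<gamma> - cnj \<beta> * of_real (inverse \<gamma>) - of_real (\<gamma>\<^sup>2 - (inverse \<gamma>)\<^sup>2)),
      \<i> * (2 * cnj \<alpha> * of_real (inverse \<gamma>) + 2 * \<alpha> * of_real \<gamma> - (\<alpha> + cnj \<alpha>) * \<beta>),
      2 * \<gamma> * Im \<alpha>))"

text \<open>
  With \<open>c = spec1 p\<close> and \<open>d = spec2 p\<close> the determinant of \<open>\<zeta>\<close> is
  \<open>\<lambda> (1 - c \<lambda> + d \<lambda>\<^sup>2 - cnj c \<lambda>\<^sup>3 + \<lambda>\<^sup>4)\<close>.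
\<close>

definition spec1 :: "potential \<Rightarrow> complex" where
  "spec1 p = (let \<alpha> = fst p; \<beta> = fst (snd p); \<gamma> = snd (snd p) in
     \<alpha>\<^sup>2 + cnj \<beta> * of_real (inverse \<gamma>) + \<beta> * of_real \<gamma>)"

definition spec2 :: "potential \<Rightarrow> real" where
  "spec2 p = (let \<alpha> = fst p; \<beta> = fst (snd p); \<gamma> = snd (snd p) in
     2 * (\<alpha> \<bullet> \<alpha>) + \<beta> \<bullet> \<beta> + \<gamma>\<^sup>2 + (inverse \<gamma>)\<^sup>2)"

text \<open>
  The primed functions are the derivatives at \<open>p\<close> in direction \<open>v\<close>; the number \<open>d\<close> is the derivative of \<open>1 / \<gamma>\<close>.
\<close>

definition field_U' :: "potential \<Rightarrow> potential \<Rightarrow> potential" where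
  "field_U' p v = (let \<alpha> = fst p; \<beta> = fst (snd p); \<gamma> = snd (snd p); a = fst v; b = fst (snd v);
       g = snd (snd v); d = - (inverse \<gamma> * g * inverse \<gamma>) in
     (b * of_real \<gamma> + \<beta> * of_real g - (cnj b * of_real (inverse \<gamma>) + cnj \<beta> * of_real d)
        + of_real (2 * \<gamma> * g - 2 * inverse \<gamma> * d),
      2 * (cnj a * of_real (inverse \<gamma>) + cnj \<alpha> * of_real d) - 2 * (a * of_real \<gamma> + \<alpha> * of_real g)
        - ((a - cnj a) * \<beta> + (\<alpha> - cnj \<alpha>) * b),
      - 2 * (g * Re \<alpha> + \<gamma> * Re a)))"

definition field_V' :: "potential \<Rightarrow> potential \<Rightarrow> potential" where
  "field_V' p v = (let \<alpha> = fst p; \<beta> = fst (snd p); \<gamma> = snd (snd p); a = fst v; b = fst (snd v);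
       g = snd (snd v); d = - (inverse \<gamma> * g * inverse \<gamma>) in
     (\<i> * (b * of_real \<gamma> + \<beta> * of_real g - (cnj b * of_real (inverse \<gamma>) + cnj \<beta> * of_real d)
        - of_real (2 * \<gamma> * g - 2 * inverse \<gamma> * d)),
      \<i> * (2 * (cnj a * of_real (inverse \<gamma>) + cnj \<alpha> * of_real d) + 2 * (a * of_real \<gamma> + \<alpha> * of_real g)
        - ((a + cnj a) * \<beta> + (\<alpha> + cnj \<alpha>) * b)),
      2 * (g * Im \<alpha> + \<gamma> * Im a)))"

definition spec1' :: "potential \<Rightarrow> potential \<Rightarrow> complex" where
  "spec1' p v = (let \<alpha> = fst p; \<beta> = fst (snd p); \<gamma> = snd (snd p); a = fst v; b = fst (snd v);
       g = snd (snd v); d = - (inverse \<gamma> * g * inverse \<gamma>) in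
     2 * \<alpha> * a + (cnj b * of_real (inverse \<gamma>) + cnj \<beta> * of_real d) + (b * of_real \<gamma> + \<beta> * of_real g))"

definition spec2' :: "potential \<Rightarrow> potential \<Rightarrow> real" where
  "spec2' p v = (let \<alpha> = fst p; \<beta> = fst (snd p); \<gamma> = snd (snd p); a = fst v; b = fst (snd v);
       g = snd (snd v); d = - (inverse \<gamma> * g * inverse \<gamma>) in
     4 * (\<alpha> \<bullet> a) + 2 * (\<beta> \<bullet> b) + 2 * \<gamma> * g + 2 * inverse \<gamma> * d)"

lemma in_P2_iff: "p \<in> P2 \<longleftrightarrow> 0 < snd (snd p)"
  by (cases p) (auto simp: P2_def)

lemma P2_mem [simp]: "(\<alpha>, \<beta>, \<gamma>) \<in> P2 \<longleftrightarrow> 0 < \<gamma>"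
  by (simp add: in_P2_iff)

lemma open_P2: "open P2"
proof -
  have "P2 = (\<lambda>p. snd (snd p)) -` {0<..}" by (auto simp: in_P2_iff)
  moreover have "open ((\<lambda>p :: potential. snd (snd p)) -` {0<..})"
    by (intro open_vimage continuous_intros open_greaterThan)
  ultimately show ?thesis by simp
qed

lemma convex_P2: "convex P2"
proof -
  have "P2 = (\<lambda>p. snd (snd p)) -` {0<..}" by (auto simp: in_P2_iff)
  moreover have "linear (\<lambda>p :: potential. snd (snd p))"
    by (auto intro!: linearI)
  ultimately show ?thesis
    using convex_linear_vimage[of "\<lambda>p :: potential. snd (snd p)" "{0<..}"] by simp
qed

lemma potential_pos: "p \<in> P2 \<Longrightarrow> snd (snd p) \<noteq> 0" "p \<in> P2 \<Longrightarrow> 0 < snd (snd p)"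
  by (auto simp: in_P2_iff)

lemma field_U_deriv: "p \<in> P2 \<Longrightarrow> (field_U has_derivative field_U' p) (at p)"
  unfolding field_U_def[abs_def] field_U'_def[abs_def] Let_def
  by (rule derivative_eq_intros refl potential_pos | simp add: algebra_simps power2_eq_square)+

lemma field_V_deriv: "p \<in> P2 \<Longrightarrow> (field_V has_derivative field_V' p) (at p)"
  unfolding field_V_def[abs_def] field_V'_def[abs_def] Let_def
  by (rule derivative_eq_intros refl potential_pos | simp add: algebra_simps power2_eq_square)+

lemma spec1_deriv: "p \<in> P2 \<Longrightarrow> (spec1 has_derivative spec1' p) (at p)"
  unfolding spec1_def[abs_def] spec1'_def[abs_def] Let_def
  by (rule derivative_eq_intros refl potential_pos | simp add: algebra_simps power2_eq_square)+

lemma spec2_deriv: "p \<in> P2 \<Longrightarrow> (spec2 has_derivative spec2' p) (at p)"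
  unfolding spec2_def[abs_def] spec2'_def[abs_def] Let_def
  by (rule derivative_eq_intros refl potential_pos | simp add: algebra_simps power2_eq_square inner_commute)+

lemma field_U'_cont: "continuous_on (P2 \<times> UNIV) (\<lambda>(p, v). field_U' p v)"
  unfolding field_U'_def Let_def case_prod_unfold
  by (intro continuous_intros) (auto simp: in_P2_iff)

lemma field_V'_cont: "continuous_on (P2 \<times> UNIV) (\<lambda>(p, v). field_V' p v)"
  unfolding field_V'_def Let_def case_prod_unfold
  by (intro continuous_intros) (auto simp: in_P2_iff)

lemma potential_coords:
  obtains a1 a2 b1 b2 g where "p = (Complex a1 a2, Complex b1 b2, g)"
  by (metis complex_surj prod.exhaust)

text \<open>
  In real coordinates all the identities below are polynomial identities modulo \<open>\<gamma> (1 / \<gamma>) = 1\<close>.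
\<close>

lemma field_U_Complex:
  "field_U (Complex a1 a2, Complex b1 b2, g) =
    (Complex (b1 * g - b1 * inverse g + g\<^sup>2 - (inverse g)\<^sup>2) (b2 * g + b2 * inverse g),
     Complex (2 * a1 * inverse g - 2 * a1 * g + 2 * a2 * b2) (- 2 * a2 * inverse g - 2 * a2 * g - 2 * a2 * b1),
     - 2 * g * a1)"
  by (simp add: field_U_def Let_def complex_eq_iff algebra_simps del: of_real_inverse)

lemma field_V_Complex:
  "field_V (Complex a1 a2, Complex b1 b2, g) =
    (Complex (- b2 * g - b2 * inverse g) (b1 * g - b1 * inverse g - g\<^sup>2 + (inverse g)\<^sup>2),
     Complex (2 * a2 * inverse g - 2 * a2 * g + 2 * a1 * b2) (2 * a1 * inverse g + 2 * a1 * g - 2 * a1 * b1),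
     2 * g * a2)"
  by (simp add: field_V_def Let_def complex_eq_iff algebra_simps del: of_real_inverse)

lemma spec1_Complex:
  "spec1 (Complex a1 a2, Complex b1 b2, g) =
    Complex (a1\<^sup>2 - a2\<^sup>2 + b1 * (g + inverse g)) (2 * a1 * a2 + b2 * (g - inverse g))"
  by (simp add: spec1_def Let_def complex_eq_iff algebra_simps power2_eq_square del: of_real_inverse)

lemma spec2_Complex:
  "spec2 (Complex a1 a2, Complex b1 b2, g) =
    2 * a1\<^sup>2 + 2 * a2\<^sup>2 + b1\<^sup>2 + b2\<^sup>2 + g\<^sup>2 + (inverse g)\<^sup>2"
  by (simp add: spec2_def Let_def inner_complex_def power2_eq_square)

lemma field_U'_Complex:
  "field_U' (Complex a1 a2, Complex b1 b2, g) (Complex u1 u2, Complex w1 w2, h) =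
    (Complex (w1 * g + b1 * h - w1 * inverse g + b1 * (inverse g)\<^sup>2 * h + 2 * g * h + 2 * (inverse g)^3 * h)
       (w2 * g + b2 * h + w2 * inverse g - b2 * (inverse g)\<^sup>2 * h),
     Complex (2 * u1 * inverse g - 2 * a1 * (inverse g)\<^sup>2 * h - 2 * u1 * g - 2 * a1 * h + 2 * u2 * b2 + 2 * a2 * w2)
       (- 2 * u2 * inverse g + 2 * a2 * (inverse g)\<^sup>2 * h - 2 * u2 * g - 2 * a2 * h - 2 * u2 * b1 - 2 * a2 * w1),
     - 2 * (h * a1 + g * u1))"
  by (simp add: field_U'_def Let_def complex_eq_iff algebra_simps power2_eq_square power3_eq_cube del: of_real_inverse)

lemma field_V'_Complex:
  "field_V' (Complex a1 a2, Complex b1 b2, g) (Complex u1 u2, Complex w1 w2, h) =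
    (Complex (- w2 * g - b2 * h - w2 * inverse g + b2 * (inverse g)\<^sup>2 * h)
       (w1 * g + b1 * h - w1 * inverse g + b1 * (inverse g)\<^sup>2 * h - 2 * g * h - 2 * (inverse g)^3 * h),
     Complex (2 * u2 * inverse g - 2 * a2 * (inverse g)\<^sup>2 * h - 2 * u2 * g - 2 * a2 * h + 2 * u1 * b2 + 2 * a1 * w2)
       (2 * u1 * inverse g - 2 * a1 * (inverse g)\<^sup>2 * h + 2 * u1 * g + 2 * a1 * h - 2 * u1 * b1 - 2 * a1 * w1),
     2 * (h * a2 + g * u2))"
  by (simp add: field_V'_def Let_def complex_eq_iff algebra_simps power2_eq_square power3_eq_cube del: of_real_inverse)

lemma spec1'_Complex:
  "spec1' (Complex a1 a2, Complex b1 b2, g) (Complex u1 u2, Complex w1 w2, h) =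
    Complex (2 * (a1 * u1 - a2 * u2) + w1 * (g + inverse g) + b1 * (h - (inverse g)\<^sup>2 * h))
      (2 * (a1 * u2 + a2 * u1) + w2 * (g - inverse g) + b2 * (h + (inverse g)\<^sup>2 * h))"
  by (simp add: spec1'_def Let_def complex_eq_iff algebra_simps power2_eq_square del: of_real_inverse)

lemma spec2'_Complex:
  "spec2' (Complex a1 a2, Complex b1 b2, g) (Complex u1 u2, Complex w1 w2, h) =
    4 * (a1 * u1 + a2 * u2) + 2 * (b1 * w1 + b2 * w2) + 2 * (g - (inverse g)^3) * h"
  by (simp add: spec2'_def Let_def inner_complex_def algebra_simps power3_eq_cube)

lemmas Complex_coords = field_U_Complex field_V_Complex spec1_Complex spec2_Complex
  field_U'_Complex field_V'_Complex spec1'_Complex spec2'_Complex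

lemma spec1_conserved:
  assumes "p \<in> P2"
  shows "spec1' p (field_U p) = 0" "spec1' p (field_V p) = 0"
proof -
  obtain a1 a2 b1 b2 g where p: "p = (Complex a1 a2, Complex b1 b2, g)"
    by (rule potential_coords)
  define d where "d = inverse g"
  have gd: "g * d = 1" using assms p by (simp add: d_def)
  show "spec1' p (field_U p) = 0"
    unfolding p Complex_coords d_def[symmetric] complex_eq_iff complex.sel using gd
    by (simp, intro conjI; algebra)
  show "spec1' p (field_V p) = 0"
    unfolding p Complex_coords d_def[symmetric] complex_eq_iff complex.sel using gd
    by (simp, intro conjI; algebra)
qed

lemma spec2_conserved:
  assumes "p \<in> P2"
  shows "spec2' p (field_U p) = 0" "spec2' p (field_V p) = 0"
proof -
  obtain a1 a2 b1 b2 g where p: "p = (Complex a1 a2, Complex b1 b2, g)"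
    by (rule potential_coords)
  define d where "d = inverse g"
  have gd: "g * d = 1" using assms p by (simp add: d_def)
  show "spec2' p (field_U p) = 0"
    unfolding p Complex_coords d_def[symmetric] using gd by algebra
  show "spec2' p (field_V p) = 0"
    unfolding p Complex_coords d_def[symmetric] using gd by algebra
qed

lemma fields_commute:
  assumes "p \<in> P2"
  shows "field_U' p (field_V p) = field_V' p (field_U p)"
proof -
  obtain a1 a2 b1 b2 g where p: "p = (Complex a1 a2, Complex b1 b2, g)"
    by (rule potential_coords)
  define d where "d = inverse g"
  have gd: "g * d = 1" using assms p by (simp add: d_def)
  show ?thesis
    unfolding p Complex_coords d_def[symmetric] prod.inject complex.inject using gd
    by (intro conjI; (algebra | simp add: algebra_simps))
qed

lemma spec2_bounds:
  assumes p: "p \<in> P2" and le: "spec2 p \<le> d"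
  shows "norm (fst p) \<le> 1 + d" "norm (fst (snd p)) \<le> 1 + d" "snd (snd p) \<le> 1 + d" "inverse (snd (snd p)) \<le> 1 + d"
proof -
  have aux: "x \<le> 1 + d" if "x\<^sup>2 \<le> d" for x :: real
  proof -
    have "0 \<le> (x - 1)\<^sup>2" by simp
    then have "2 * x \<le> 1 + x\<^sup>2" by (simp add: power2_eq_square algebra_simps)
    moreover have "0 \<le> d" using that zero_le_power2[of x] by linarith
    ultimately show ?thesis using that by linarith
  qed
  have "2 * (norm (fst p))\<^sup>2 + (norm (fst (snd p)))\<^sup>2 + (snd (snd p))\<^sup>2 + (inverse (snd (snd p)))\<^sup>2 \<le> d"
    using le by (simp add: spec2_def Let_def power2_norm_eq_inner)
  then show "norm (fst p) \<le> 1 + d" "norm (fst (snd p)) \<le> 1 + d" "snd (snd p) \<le> 1 + d" "inverse (snd (snd p)) \<le> 1 + d"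
    using zero_le_power2[of "norm (fst p)"] zero_le_power2[of "norm (fst (snd p))"]
      zero_le_power2[of "snd (snd p)"] zero_le_power2[of "inverse (snd (snd p))"]
    by (intro aux; linarith)+
qed

text \<open>
  A bound on \<open>spec2\<close> bounds the coordinates and \<open>1 / \<gamma>\<close>, so it keeps the potential in a compact part of \<open>P2\<close>.
\<close>

lemma spec2_proper: "compact {p \<in> P2. spec2 p \<le> d}"
proof -
  define S where "S = cball (0 :: complex) (1 + d) \<times> (cball (0 :: complex) (1 + d) \<times> {inverse (1 + \<bar>d\<bar>)..1 + d})"
  have "0 < inverse (1 + \<bar>d\<bar>)" by simp
  then have S: "S \<subseteq> P2"
    unfolding S_def by (auto simp del: inverse_positive_iff_positive dest: less_le_trans)
  have "continuous_on S spec2"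
    using spec2_deriv S by (meson continuous_at_imp_continuous_on has_derivative_continuous subsetD)
  then have "closedin (top_of_set S) (S \<inter> spec2 -` {..d})"
    by (intro continuous_closedin_preimage) auto
  moreover have "compact S" unfolding S_def by (intro compact_Times) auto
  ultimately have "compact (S \<inter> spec2 -` {..d})" by (rule closedin_compact[rotated])
  moreover have "{p \<in> P2. spec2 p \<le> d} \<subseteq> S"
  proof
    fix p assume "p \<in> {p \<in> P2. spec2 p \<le> d}"
    then have p: "p \<in> P2" "spec2 p \<le> d" by auto
    have "0 < snd (snd p)" using p by (simp add: in_P2_iff)
    have "inverse (snd (snd p)) \<le> 1 + \<bar>d\<bar>" using spec2_bounds(4)[OF p] by linarith
    then have "inverse (1 + \<bar>d\<bar>) \<le> inverse (inverse (snd (snd p)))"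
      using \<open>0 < snd (snd p)\<close> by (intro le_imp_inverse_le) auto
    then show "p \<in> S" using spec2_bounds[OF p] by (cases p) (simp add: S_def)
  qed
  then have "{p \<in> P2. spec2 p \<le> d} = S \<inter> spec2 -` {..d}" using S by auto
  ultimately show ?thesis by simp
qed

interpretation flow: commuting_conserved_fields P2 field_U field_U' field_V field_V' spec2 spec2'
  by unfold_locales
    (fact open_P2 convex_P2 field_U_deriv field_V_deriv field_U'_cont field_V'_cont spec2_deriv
      spec2_conserved spec2_proper fields_commute)+

section \<open>Singular potentials and charts of the fibres\<close>

text \<open>
  In the first alternative \<open>\<zeta>\<close> vanishes at the point \<open>z\<close> of the unit circle; in the second one the two fields and the
  differential of \<open>Im spec1\<close> vanish.
\<close>

definition singular :: "potential \<Rightarrow> bool" where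
  "singular p \<longleftrightarrow> (let \<alpha> = fst p; \<beta> = fst (snd p); \<gamma> = snd (snd p) in
     (\<exists>z. norm z = 1 \<and> \<alpha> = z * cnj \<alpha> \<and> \<beta> = of_real \<gamma> * z + of_real (inverse \<gamma>) * cnj z) \<or>
     (\<alpha> = 0 \<and> \<gamma> = 1 \<and> Im \<beta> = 0))"

lemma singular_iff:
  "singular (\<alpha>, \<beta>, \<gamma>) \<longleftrightarrow>
     (\<exists>z. norm z = 1 \<and> \<alpha> = z * cnj \<alpha> \<and> \<beta> = of_real \<gamma> * z + of_real (inverse \<gamma>) * cnj z) \<or>
     (\<alpha> = 0 \<and> \<gamma> = 1 \<and> Im \<beta> = 0)"
  by (simp add: singular_def)

lemma cnj_unit: "norm z = 1 \<Longrightarrow> z * cnj z = 1"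
  by (simp add: complex_norm_square[symmetric])

text \<open>
  Put \<open>e = x + i y\<close> and \<open>z = - cnj e / e\<close>. The \<open>\<gamma>\<close>-component of a relation says that \<open>\<alpha> e\<close> is imaginary, i.e.
  \<open>\<alpha> = z cnj \<alpha>\<close>, and the other two components then determine \<open>\<beta>\<close> in terms of \<open>z\<close>, except when
  \<open>\<alpha> = 0\<close> and \<open>\<gamma> = 1\<close>, where they say that \<open>\<beta>\<close> is real.
\<close>

lemma fields_independent:
  assumes p: "p \<in> P2" "\<not> singular p" and dep: "x *\<^sub>R field_U p + y *\<^sub>R field_V p = 0"
  shows "x = 0 \<and> y = 0"
proof (rule ccontr)
  assume ne: "\<not> (x = 0 \<and> y = 0)"
  obtain \<alpha> \<beta> \<gamma> where pe: "p = (\<alpha>, \<beta>, \<gamma>)" by (cases p)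
  define \<delta> where "\<delta> = inverse \<gamma>"
  define e where "e = Complex x y"
  have \<gamma>: "0 < \<gamma>" "0 < \<delta>" "\<gamma> * \<delta> = 1" using p(1) by (auto simp: pe \<delta>_def)
  have e: "e \<noteq> 0" using ne by (simp add: e_def complex_eq_iff)
  have ee: "e = of_real x + \<i> * of_real y" "cnj e = of_real x - \<i> * of_real y"
    by (simp_all add: e_def complex_eq_iff)
  have "of_real x * (\<beta> * of_real \<gamma> - cnj \<beta> * of_real \<delta> + of_real (\<gamma>\<^sup>2 - \<delta>\<^sup>2)) +
      of_real y * (\<i> * (\<beta> * of_real \<gamma> - cnj \<beta> * of_real \<delta> - of_real (\<gamma>\<^sup>2 - \<delta>\<^sup>2))) = 0"
    using dep by (simp add: pe field_U_def field_V_def \<delta>_def zero_prod_def scaleR_conv_of_real)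
  then have E1: "e * (\<beta> * of_real \<gamma> - cnj \<beta> * of_real \<delta>) + cnj e * of_real (\<gamma>\<^sup>2 - \<delta>\<^sup>2) = 0"
    by (simp add: ee algebra_simps)
  have "of_real x * (2 * cnj \<alpha> * of_real \<delta> - 2 * \<alpha> * of_real \<gamma> - (\<alpha> - cnj \<alpha>) * \<beta>) +
      of_real y * (\<i> * (2 * cnj \<alpha> * of_real \<delta> + 2 * \<alpha> * of_real \<gamma> - (\<alpha> + cnj \<alpha>) * \<beta>)) = 0"
    using dep by (simp add: pe field_U_def field_V_def \<delta>_def zero_prod_def scaleR_conv_of_real)
  then have E2: "2 * cnj \<alpha> * e * of_real \<delta> - 2 * \<alpha> * of_real \<gamma> * cnj e - \<beta> * (\<alpha> * e - cnj \<alpha> * cnj e) = 0"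
    by (simp add: ee algebra_simps)
  have "x * (- 2 * \<gamma> * Re \<alpha>) + y * (2 * \<gamma> * Im \<alpha>) = 0"
    using dep by (simp add: pe field_U_def field_V_def zero_prod_def)
  then have "\<gamma> * (x * Re \<alpha> - y * Im \<alpha>) = 0" by (auto simp: algebra_simps)
  then have "Re (\<alpha> * e) = 0" using \<gamma> by (simp add: e_def algebra_simps)
  then have E3: "cnj \<alpha> * cnj e = - (\<alpha> * e)"
    by (metis complex_cnj_mult complex_cnj_cancel_iff add.commute add_eq_0_iff complex_add_cnj mult_zero_right of_real_0)
  define z where "z = - cnj e / e"
  have z: "norm z = 1" using e by (simp add: z_def norm_divide)
  have ze: "cnj z = - e / cnj e" by (simp add: z_def)
  have \<alpha>z: "\<alpha> = z * cnj \<alpha>" using E3 e by (simp add: z_def field_simps)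
  have "singular p"
  proof (cases "\<alpha> = 0")
    case False
    have "\<beta> * (2 * \<alpha> * e) = 2 * cnj \<alpha> * e * of_real \<delta> - 2 * \<alpha> * of_real \<gamma> * cnj e"
      using E2 E3 by (simp add: algebra_simps)
    moreover have "cnj \<alpha> = cnj z * \<alpha>" using \<alpha>z by (metis complex_cnj_cnj complex_cnj_mult)
    moreover have "cnj e = - (z * e)" using e by (simp add: z_def)
    ultimately have "\<beta> * (2 * \<alpha> * e) = 2 * (cnj z * \<alpha>) * e * of_real \<delta> - 2 * \<alpha> * of_real \<gamma> * (- (z * e))"
      by simp
    then have "\<beta> * (2 * \<alpha> * e) = (of_real \<gamma> * z + of_real \<delta> * cnj z) * (2 * \<alpha> * e)"
      by (simp add: algebra_simps)
    then have "\<beta> = of_real \<gamma> * z + of_real \<delta> * cnj z" using False e by simp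
    then show ?thesis using z \<alpha>z unfolding pe singular_iff \<delta>_def by blast
  next
    case True
    have w: "\<beta> * of_real \<gamma> - cnj \<beta> * of_real \<delta> = z * of_real (\<gamma>\<^sup>2 - \<delta>\<^sup>2)"
      using E1 e by (simp add: z_def field_simps eq_neg_iff_add_eq_0)
    show ?thesis
    proof (cases "\<gamma> = 1")
      case 1: True
      then have "\<beta> = cnj \<beta>" using w by (simp add: \<delta>_def)
      then have "Im \<beta> = 0" by (metis Reals_cnj_iff complex_is_Real_iff)
      then show ?thesis using 1 True by (simp add: singular_def pe)
    next
      case False
      have "\<gamma> \<noteq> \<delta>" using False \<gamma> by (metis abs_of_pos abs_square_eq_1 power2_eq_square)
      then have ne: "complex_of_real (\<gamma>\<^sup>2 - \<delta>\<^sup>2) \<noteq> 0"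
        using \<gamma> by (simp add: power2_eq_iff del: of_real_diff of_real_power)
      have wc: "cnj \<beta> * of_real \<gamma> - \<beta> * of_real \<delta> = cnj z * of_real (\<gamma>\<^sup>2 - \<delta>\<^sup>2)"
        using arg_cong[OF w, of cnj] by simp
      have gd: "complex_of_real \<gamma> * of_real \<delta> = 1" using \<gamma>(3) by (metis of_real_1 of_real_mult)
      have "\<beta> * of_real (\<gamma>\<^sup>2 - \<delta>\<^sup>2) =
          of_real \<gamma> * (\<beta> * of_real \<gamma> - cnj \<beta> * of_real \<delta>) + of_real \<delta> * (cnj \<beta> * of_real \<gamma> - \<beta> * of_real \<delta>)"
        by (simp add: algebra_simps power2_eq_square)
      also have "\<dots> = (of_real \<gamma> * z + of_real \<delta> * cnj z) * of_real (\<gamma>\<^sup>2 - \<delta>\<^sup>2)"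
        unfolding w wc by (simp add: algebra_simps)
      finally have "\<beta> = of_real \<gamma> * z + of_real \<delta> * cnj z" using ne by (metis mult_right_cancel)
      then show ?thesis using z \<alpha>z unfolding pe singular_iff \<delta>_def by blast
    qed
  qed
  then show False using p(2) by simp
qed

text \<open>
  A Lagrange multiplier argument: a functional \<open>(\<mu>, \<nu>)\<close> that annihilates the range gives the five real equations
  below. If \<open>\<nu> = 0\<close>, they lead to the second kind of singular potential. Otherwise \<open>z = - \<mu> / (2 \<nu>)\<close>
  satisfies \<open>\<alpha> = z cnj \<alpha>\<close> and \<open>\<beta> = \<gamma> z + cnj z / \<gamma>\<close>, and either \<open>z\<close> is on the unit circle or \<open>\<alpha> = 0\<close> and \<open>\<gamma> = 1\<close>.
\<close>

lemma spec_derivative_surj: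
  assumes p: "p \<in> P2" "\<not> singular p"
  shows "surj (\<lambda>v. (spec1' p v, spec2' p v))"
proof (rule ccontr)
  let ?T = "\<lambda>v. (spec1' p v, spec2' p v)"
  assume "\<not> surj ?T"
  have lin: "linear ?T"
    using has_derivative_Pair[OF spec1_deriv[OF p(1)] spec2_deriv[OF p(1)]] by (rule has_derivative_linear)
  have sub: "subspace (range ?T)" using linear_subspace_image[OF lin subspace_UNIV] by simp
  have "span (range ?T) = range ?T" using span_eq_iff sub by blast
  then have "span (range ?T) \<noteq> UNIV" using \<open>\<not> surj ?T\<close> by argo
  then obtain m where m0: "m \<noteq> 0" "\<forall>x\<in>span (range ?T). m \<bullet> x = 0"
    using span_not_UNIV_orthogonal[of "range ?T"] by blast
  have m: "m \<noteq> 0" "m \<bullet> ?T v = 0" for v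
    using m0(1) bspec[OF m0(2) span_base[OF rangeI]] by auto
  obtain \<mu>1 \<mu>2 \<nu> where me: "m = (Complex \<mu>1 \<mu>2, \<nu>)" by (metis complex_surj prod.exhaust)
  obtain a1 a2 b1 b2 g where pe: "p = (Complex a1 a2, Complex b1 b2, g)" by (rule potential_coords)
  define d where "d = inverse g"
  have g: "0 < g" "0 < d" "g * d = 1" using p(1) by (auto simp: pe d_def)
  have T: "\<mu>1 * Re (spec1' p v) + \<mu>2 * Im (spec1' p v) + \<nu> * spec2' p v = 0" for v
    using m(2)[of v] by (simp add: me inner_complex_def)
  note coords = spec1'_Complex spec2'_Complex d_def[symmetric] pe
  have E1: "\<mu>1 * a1 + \<mu>2 * a2 + 2 * \<nu> * a1 = 0"
    using T[of "(Complex 1 0, Complex 0 0, 0)"] unfolding coords by (simp add: algebra_simps)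
  have E2: "- \<mu>1 * a2 + \<mu>2 * a1 + 2 * \<nu> * a2 = 0"
    using T[of "(Complex 0 1, Complex 0 0, 0)"] unfolding coords by (simp add: algebra_simps)
  have E3: "\<mu>1 * (g + d) + 2 * \<nu> * b1 = 0"
    using T[of "(Complex 0 0, Complex 1 0, 0)"] unfolding coords by (simp add: algebra_simps)
  have E4: "\<mu>2 * (g - d) + 2 * \<nu> * b2 = 0"
    using T[of "(Complex 0 0, Complex 0 1, 0)"] unfolding coords by (simp add: algebra_simps)
  have E5: "\<mu>1 * b1 * (1 - d\<^sup>2) + \<mu>2 * b2 * (1 + d\<^sup>2) + 2 * \<nu> * (g - d^3) = 0"
    using T[of "(Complex 0 0, Complex 0 0, 1)"] unfolding coords by (simp add: algebra_simps)
  have g1: "g = 1" if "g = d"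
    using that g by (metis abs_of_pos abs_square_eq_1 power2_eq_square)
  have "singular p"
  proof (cases "\<nu> = 0")
    case True
    have "\<mu>1 = 0" using E3 True g by simp
    then have \<mu>2: "\<mu>2 \<noteq> 0" using m(1) True by (auto simp: me zero_prod_def complex_eq_iff)
    then have "g = d" using E4 True by simp
    moreover have "a1 = 0" "a2 = 0" using E1 E2 True \<open>\<mu>1 = 0\<close> \<mu>2 by auto
    moreover have "b2 = 0"
    proof -
      have "\<mu>2 * b2 * (1 + d\<^sup>2) = 0" using E5 True \<open>\<mu>1 = 0\<close> by simp
      moreover have "1 + d\<^sup>2 \<noteq> 0" using zero_le_power2[of d] by linarith
      ultimately show ?thesis using \<mu>2 by simp
    qed
    ultimately show ?thesis using g1 by (simp add: singular_def pe complex_eq_iff)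
  next
    case False
    define M1 M2 where "M1 = - \<mu>1 / (2 * \<nu>)" and "M2 = - \<mu>2 / (2 * \<nu>)"
    have \<mu>: "\<mu>1 = - 2 * \<nu> * M1" "\<mu>2 = - 2 * \<nu> * M2" using False by (auto simp: M1_def M2_def)
    have "2 * \<nu> * (a1 - (M1 * a1 + M2 * a2)) = 0" "2 * \<nu> * (a2 - (M2 * a1 - M1 * a2)) = 0"
      "2 * \<nu> * (b1 - M1 * (g + d)) = 0" "2 * \<nu> * (b2 - M2 * (g - d)) = 0"
      "2 * \<nu> * (g - d^3 - (M1 * b1 * (1 - d\<^sup>2) + M2 * b2 * (1 + d\<^sup>2))) = 0"
      subgoal using E1 unfolding \<mu> by (simp add: algebra_simps)
      subgoal using E2 unfolding \<mu> by (simp add: algebra_simps)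
      subgoal using E3 unfolding \<mu> by (simp add: algebra_simps)
      subgoal using E4 unfolding \<mu> by (simp add: algebra_simps)
      subgoal using E5 unfolding \<mu> by (simp add: algebra_simps)
      done
    then have F: "a1 = M1 * a1 + M2 * a2" "a2 = M2 * a1 - M1 * a2"
      "b1 = M1 * (g + d)" "b2 = M2 * (g - d)"
      "g - d^3 = M1 * b1 * (1 - d\<^sup>2) + M2 * b2 * (1 + d\<^sup>2)"
      using False by auto
    define z where "z = Complex M1 M2"
    have \<alpha>: "Complex a1 a2 = z * cnj (Complex a1 a2)" using F(1,2) by (simp add: z_def complex_eq_iff)
    have \<beta>: "Complex b1 b2 = of_real g * z + of_real d * cnj z"
      using F(3,4) by (simp add: z_def complex_eq_iff algebra_simps)
    show ?thesis
    proof (cases "norm z = 1")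
      case True
      then show ?thesis unfolding pe singular_iff using \<alpha> \<beta>[unfolded d_def] by blast
    next
      case nz: False
      have "Complex a1 a2 = 0"
      proof (rule ccontr)
        assume ne: "Complex a1 a2 \<noteq> 0"
        have "norm (Complex a1 a2) = norm z * norm (Complex a1 a2)"
          using arg_cong[OF \<alpha>, of norm] by (simp only: norm_mult complex_mod_cnj)
        then show False using ne nz by simp
      qed
      moreover have "g = 1"
      proof -
        have "M1 * b1 * (1 - d\<^sup>2) + M2 * b2 * (1 + d\<^sup>2) = (M1\<^sup>2 + M2\<^sup>2) * (g - d^3)"
          unfolding F(3,4) using g(3) by algebra
        then have "(M1\<^sup>2 + M2\<^sup>2) * (g - d^3) = g - d^3" using F(5) by argo
        then have "(M1\<^sup>2 + M2\<^sup>2 - 1) * (g - d^3) = 0"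
          by (simp only: left_diff_distrib[of "M1\<^sup>2 + M2\<^sup>2" 1]) simp
        moreover have "M1\<^sup>2 + M2\<^sup>2 \<noteq> 1"
          using nz by (simp add: z_def cmod_def)
        ultimately have "g = d^3" by simp
        then have "g^4 = 1" using g(3) by algebra
        then show ?thesis using g(1) power_eq_iff_eq_base[of 4 g 1] by simp
      qed
      moreover have "b2 = 0" using F(4) \<open>g = 1\<close> by (simp add: d_def)
      ultimately show ?thesis by (simp add: singular_def pe)
    qed
  qed
  then show False using p(2) by simp
qed


text \<open>
  The map is given by the Gram matrix of the two independent fields.
\<close>

lemma field_pairing_surj:
  assumes p: "p \<in> P2" "\<not> singular p"
  shows "surj (\<lambda>w :: complex. let u = Re w *\<^sub>R field_U p + Im w *\<^sub>R field_V p in Complex (field_U p \<bullet> u) (field_V p \<bullet> u))"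
    (is "surj ?G")
proof (rule linear_injective_imp_surjective)
  show lin: "linear ?G"
    by (rule linearI) (simp_all add: Let_def complex_eq_iff inner_add_right algebra_simps)
  show "inj ?G"
    unfolding linear_injective_0[OF lin]
  proof (intro allI impI)
    fix w assume w: "?G w = 0"
    define u where "u = Re w *\<^sub>R field_U p + Im w *\<^sub>R field_V p"
    have "field_U p \<bullet> u = 0" "field_V p \<bullet> u = 0"
      using w by (simp_all add: Let_def u_def[symmetric] complex_eq_iff)
    then have "u \<bullet> u = 0"
      unfolding u_def[of] by (simp add: inner_add_left) 
    then have "u = 0" by simp
    then show "w = 0"
      using fields_independent[OF p, of "Re w" "Im w"] by (simp add: u_def complex_eq_iff)
  qed
qed simp

lemma smooth_on_spec:
  "smooth_on spec1 P2" "smooth_on spec2 P2"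
proof -
  have fst: "smooth_on (\<lambda>p :: potential. fst p) P2"
    by (intro smooth_on_linear open_P2 bounded_linear_fst)
  have fs: "smooth_on (\<lambda>p :: potential. fst (snd p)) P2"
    by (intro smooth_on_linear open_P2 bounded_linear_fst_comp bounded_linear_snd)
  have ss: "smooth_on (\<lambda>p :: potential. snd (snd p)) P2"
    by (intro smooth_on_linear open_P2 bounded_linear_snd_comp bounded_linear_snd)
  have inv: "smooth_on (\<lambda>p :: potential. inverse (snd (snd p))) P2"
    by (rule smooth_on_inverse[OF open_P2 ss]) (auto simp: in_P2_iff)
  note mult = smooth_on_bilinear[OF open_P2 bounded_bilinear_mult]
  note inner = smooth_on_bilinear[OF open_P2 bounded_bilinear_inner]
  note real = smooth_on_linear_compose[OF open_P2 bounded_linear_of_real]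
  note cnj = smooth_on_linear_compose[OF open_P2 bounded_linear_cnj]
  note add = smooth_on_add[OF open_P2]
  show "smooth_on spec1 P2"
    unfolding spec1_def[abs_def] Let_def power2_eq_square
    by (intro add mult real cnj fst fs ss inv)
  show "smooth_on spec2 P2"
    unfolding spec2_def[abs_def] Let_def power2_eq_square
    by (intro add mult inner fst fs ss inv smooth_on_const open_P2)
qed

definition spec_fibre :: "potential \<Rightarrow> potential set" where
  "spec_fibre p = {q \<in> P2. spec1 q = spec1 p \<and> spec2 q = spec2 p}"

text \<open>
  Pairing with the two fields at \<open>p\<close> provides the two coordinates along the fibre: the fields are tangent
  to the fibre and independent.
\<close>

definition chart :: "potential \<Rightarrow> potential \<Rightarrow> potential" where
  "chart p q = (spec1 q - spec1 p, Complex (field_U p \<bullet> q) (field_V p \<bullet> q), spec2 q - spec2 p)"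

lemma bounded_linear_Complex_inner:
  "bounded_linear (\<lambda>q :: potential. Complex (u \<bullet> q) (v \<bullet> q))"
  by (rule linear_conv_bounded_linear[THEN iffD1], rule linearI)
    (simp_all add: complex_eq_iff inner_add_right algebra_simps)

lemma local_chart:
  assumes p: "p \<in> P2" "\<not> singular p" and N: "open N" "p \<in> N"
  obtains W W' g where "open W" "p \<in> W" "W \<subseteq> P2" "W \<subseteq> N" "open W'"
    "homeomorphism W W' (chart p) g" "smooth_on (chart p) W" "smooth_on g W'"
proof -
  define f' where "f' v = (spec1' p v, Complex (field_U p \<bullet> v) (field_V p \<bullet> v), spec2' p v)" for v
  have d: "(chart p has_derivative f') (at p)"
  proof -
    have "((\<lambda>q. (spec1 q - spec1 p, Complex (field_U p \<bullet> q) (field_V p \<bullet> q), spec2 q - spec2 p)) has_derivative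
        (\<lambda>v. (spec1' p v - 0, Complex (field_U p \<bullet> v) (field_V p \<bullet> v), spec2' p v - 0))) (at p)"
      by (intro has_derivative_Pair has_derivative_diff has_derivative_const spec1_deriv spec2_deriv p(1)
          bounded_linear_imp_has_derivative[OF bounded_linear_Complex_inner])
    then show ?thesis by (simp add: chart_def[abs_def] f'_def[abs_def])
  qed
  have lin: "linear f'" using d by (rule has_derivative_linear)
  have lins: "linear (spec1' p)" "linear (spec2' p)"
    using has_derivative_linear[OF spec1_deriv[OF p(1)]] has_derivative_linear[OF spec2_deriv[OF p(1)]] .
  have "surj f'"
    unfolding surj_def
  proof
    fix y :: potential
    obtain c w r where y: "y = (c, w, r)" by (cases y)
    obtain v where v: "spec1' p v = c" "spec2' p v = r"
      using surjD[OF spec_derivative_surj[OF p], of "(c, r)"] by auto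
    obtain z where z: "(let u = Re z *\<^sub>R field_U p + Im z *\<^sub>R field_V p in Complex (field_U p \<bullet> u) (field_V p \<bullet> u))
        = w - Complex (field_U p \<bullet> v) (field_V p \<bullet> v)"
      using surjD[OF field_pairing_surj[OF p]] by metis
    let ?u = "Re z *\<^sub>R field_U p + Im z *\<^sub>R field_V p"
    have "spec1' p ?u = 0" "spec2' p ?u = 0"
      using lins spec1_conserved[OF p(1)] spec2_conserved[OF p(1)] by (simp_all add: linear_add linear_scale)
    then have "f' (v + ?u) = y"
      using z v lins by (simp add: f'_def y linear_add Let_def complex_eq_iff inner_add_right)
    then show "\<exists>x. y = f' x" by metis
  qed
  then have inj: "inj f'" using linear_surjective_imp_injective[OF lin] by simp
  have open_N: "open (P2 \<inter> N)" using open_P2 N by blast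
  have smooth: "smooth_on (chart p) P2"
    unfolding chart_def[abs_def]
    by (intro smooth_on_Pair smooth_on_diff smooth_on_const smooth_on_spec smooth_on_linear
        bounded_linear_Complex_inner open_P2)
  then have smoothN: "smooth_on (chart p) (P2 \<inter> N)" using smooth_on_subset by blast
  obtain W W' g where W: "open W" "p \<in> W" "W \<subseteq> P2 \<inter> N" "open W'" "homeomorphism W W' (chart p) g" "smooth_on g W'"
    using smooth_local_diffeomorphism[OF open_N smoothN _ d inj] p(1) N(2) by blast
  moreover have "smooth_on (chart p) W" using smooth smooth_on_subset W(3) by blast
  ultimately show thesis using that by blast
qed

lemma chart_fibre:
  assumes W: "W \<subseteq> P2" "homeomorphism W W' (chart p) g"
  shows "chart p ` (W \<inter> spec_fibre p) = W' \<inter> range (\<lambda>w. (0, w, 0))"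
proof
  show "chart p ` (W \<inter> spec_fibre p) \<subseteq> W' \<inter> range (\<lambda>w. (0, w, 0))"
    using W(2) by (auto simp: homeomorphism_def chart_def spec_fibre_def)
  show "W' \<inter> range (\<lambda>w. (0, w, 0)) \<subseteq> chart p ` (W \<inter> spec_fibre p)"
  proof
    fix y assume y: "y \<in> W' \<inter> range (\<lambda>w. (0, w, 0))"
    then have g: "g y \<in> W" "chart p (g y) = y" using W(2) by (auto simp: homeomorphism_def)
    then have "g y \<in> spec_fibre p" using y W(1) by (auto simp: chart_def spec_fibre_def)
    then show "y \<in> chart p ` (W \<inter> spec_fibre p)" using g by (metis IntI image_eqI)
  qed
qed

lemma submanifold_fibre:
  assumes S: "S \<subseteq> P2" and nonsing: "\<And>p. p \<in> S \<Longrightarrow> \<not> singular p"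
    and N: "\<And>p. p \<in> S \<Longrightarrow> \<exists>N. open N \<and> p \<in> N \<and> S \<inter> N = spec_fibre p \<inter> N"
  shows "submanifold 2 P2 S"
  unfolding submanifold_def
proof (intro conjI ballI S)
  fix p assume p: "p \<in> S"
  then obtain N where N: "open N" "p \<in> N" "S \<inter> N = spec_fibre p \<inter> N" using N by blast
  obtain W W' g where W: "open W" "p \<in> W" "W \<subseteq> P2" "W \<subseteq> N" "open W'"
    "homeomorphism W W' (chart p) g" "smooth_on (chart p) W" "smooth_on g W'"
    using local_chart[OF _ nonsing N(1,2)] p S by blast
  let ?L = "range (\<lambda>w :: complex. (0 :: complex, w, 0 :: real))"
  have lin: "linear (\<lambda>w :: complex. (0 :: complex, w, 0 :: real))" by (auto intro!: linearI)
  have "inj (\<lambda>w :: complex. (0 :: complex, w, 0 :: real))" by (auto intro!: injI)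
  then have "dim ?L = dim (UNIV :: complex set)"
    by (intro dim_image_eq[OF lin]) (auto simp: inj_on_def)
  then have "dim ?L = 2" by simp
  moreover have "subspace ?L" using linear_subspace_image[OF lin subspace_UNIV] .
  moreover have "chart p ` (W \<inter> S) = W' \<inter> ?L"
  proof -
    have "W \<inter> S = W \<inter> spec_fibre p" using N(3) W(4) by blast
    then show ?thesis using chart_fibre[OF W(3,6)] by simp
  qed
  ultimately show "\<exists>W W' (f :: potential \<Rightarrow> potential) g L. open W \<and> p \<in> W \<and> W \<subseteq> P2 \<and> open W' \<and> homeomorphism W W' f g \<and>
      smooth_on f W \<and> smooth_on g W' \<and> subspace L \<and> dim L = 2 \<and> f ` (W \<inter> S) = W' \<inter> L"
    using W by blast
qed

lemma spec_action:
  assumes "p \<in> P2"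
  shows "spec1 (flow.action g p) = spec1 p" "spec2 (flow.action g p) = spec2 p"
  by (rule flow.action_conserved[OF spec1_deriv spec1_conserved assms]
      flow.action_conserved[OF spec2_deriv spec2_conserved assms]; assumption)+

text \<open>
  On the fibre the middle component of the chart is injective near \<open>p\<close>, and its derivative along the
  orbit map is the Gram matrix of the fields.
\<close>

lemma nonsingular_orbit_open:
  assumes p: "p \<in> P2" "\<not> singular p"
  shows "\<exists>W. open W \<and> p \<in> W \<and> spec_fibre p \<inter> W \<subseteq> action_orbit flow.action p"
proof -
  obtain W W' g where W: "open W" "p \<in> W" "W \<subseteq> P2" "open W'" "homeomorphism W W' (chart p) g"
    using local_chart[OF p open_UNIV] by (metis UNIV_I)
  define h where "h q = Complex (field_U p \<bullet> q) (field_V p \<bullet> q)" for q :: potential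
  have blh: "bounded_linear h" unfolding h_def[abs_def] by (rule bounded_linear_Complex_inner)
  define c where "c w = flow.action (Re w, Im w) p" for w
  have c0: "c 0 = p" using flow.action_zero[OF p(1)] by (simp add: c_def zero_prod_def)
  have inj: "inj_on h (spec_fibre p \<inter> W)"
  proof (rule inj_onI)
    fix q r assume "q \<in> spec_fibre p \<inter> W" "r \<in> spec_fibre p \<inter> W" "h q = h r"
    then have "chart p q = chart p r" "q \<in> W" "r \<in> W"
      by (auto simp: chart_def spec_fibre_def h_def)
    then show "q = r" using W(5) by (metis homeomorphism_apply1)
  qed
  have pair: "((\<lambda>w. (Re w, Im w)) has_derivative (\<lambda>w. (Re w, Im w))) (at 0)"
    by (intro bounded_linear_imp_has_derivative bounded_linear_Pair bounded_linear_Re bounded_linear_Im)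
  have "(c has_derivative (\<lambda>w. Re w *\<^sub>R field_U p + Im w *\<^sub>R field_V p)) (at 0)"
    unfolding c_def[abs_def]
    using has_derivative_compose[OF pair flow.action_deriv[OF p(1)]] flow.action_zero[OF p(1)]
    by (simp add: zero_prod_def)
  from bounded_linear.has_derivative[OF blh this]
  have deriv: "((\<lambda>w. h (c w)) has_derivative
      (\<lambda>w. let u = Re w *\<^sub>R field_U p + Im w *\<^sub>R field_V p in Complex (field_U p \<bullet> u) (field_V p \<bullet> u))) (at 0)"
    by (simp add: h_def Let_def)
  have contc: "continuous_on UNIV c"
    unfolding c_def[abs_def]
    by (rule continuous_on_compose2[OF flow.action_continuous[OF p(1)]]) (auto intro!: continuous_intros)
  have rangec: "range c \<subseteq> spec_fibre p"
    by (rule image_subsetI) (simp add: c_def spec_fibre_def flow.action_in[OF p(1)] spec_action[OF p(1)])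
  have "c 0 \<in> W" using c0 W(2) by simp
  obtain V' where V': "open V'" "c 0 \<in> V'" "spec_fibre p \<inter> V' \<subseteq> range c"
    by (rule parametrization_covers_neighborhood[OF contc rangec W(1) \<open>c 0 \<in> W\<close> linear_continuous_on[OF blh]
          inj deriv field_pairing_surj[OF p]])
  have "range c \<subseteq> action_orbit flow.action p"
    unfolding c_def action_orbit_def by (intro image_subsetI rangeI)
  then have "spec_fibre p \<inter> V' \<subseteq> action_orbit flow.action p"
    by (rule order_trans[OF V'(3)])
  then show ?thesis using V'(1,2) unfolding c0 by (intro exI[of _ V'] conjI)
qed

section \<open>Extrema of the third coordinate along orbits\<close>

lemma action_line_deriv:
  assumes p: "p \<in> P2"
  shows "((\<lambda>t. flow.action (t * x, t * y) p) has_vector_derivative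
    x *\<^sub>R field_U (flow.action (t * x, t * y) p) + y *\<^sub>R field_V (flow.action (t * x, t * y) p)) (at t)"
proof -
  have "((\<lambda>t. (t * x, t * y)) has_derivative (\<lambda>h. (h * x, h * y))) (at t)"
    by (auto intro!: derivative_eq_intros)
  from has_derivative_compose[OF this flow.action_deriv[OF p]]
  show ?thesis by (simp add: has_vector_derivative_def scaleR_add_right mult.commute)
qed

lemma gamma_line_deriv:
  assumes p: "p \<in> P2"
  shows "((\<lambda>t. snd (snd (flow.action (t * x, t * y) p))) has_real_derivative
    - 2 * snd (snd (flow.action (t * x, t * y) p)) *
      (x * Re (fst (flow.action (t * x, t * y) p)) - y * Im (fst (flow.action (t * x, t * y) p)))) (at t)"
proof -
  have "bounded_linear (\<lambda>q :: potential. snd (snd q))"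
    by (intro bounded_linear_snd_comp bounded_linear_snd)
  from bounded_linear.has_vector_derivative[OF this action_line_deriv[OF p]]
  have "((\<lambda>t. snd (snd (flow.action (t * x, t * y) p))) has_vector_derivative
    snd (snd (x *\<^sub>R field_U (flow.action (t * x, t * y) p) + y *\<^sub>R field_V (flow.action (t * x, t * y) p)))) (at t)" .
  moreover have "snd (snd (x *\<^sub>R field_U q + y *\<^sub>R field_V q)) =
      - 2 * snd (snd q) * (x * Re (fst q) - y * Im (fst q))" for q
    by (simp add: field_U_def field_V_def Let_def algebra_simps)
  ultimately show ?thesis by (simp only: has_real_derivative_iff_has_vector_derivative)
qed

text \<open>
  Along the direction \<open>(x, y)\<close> the derivative of \<open>\<gamma>\<close> is \<open>- 2 \<gamma> Re (\<alpha> (x + i y))\<close>.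
\<close>

lemma orbit_extremum_alpha:
  assumes p: "p \<in> P2"
    and ext: "(\<forall>g. snd (snd (flow.action g p)) \<le> snd (snd p)) \<or> (\<forall>g. snd (snd p) \<le> snd (snd (flow.action g p)))"
  shows "fst p = 0"
proof -
  have zero: "- 2 * snd (snd p) * (x * Re (fst p) - y * Im (fst p)) = 0" for x y
  proof -
    have d: "((\<lambda>t. snd (snd (flow.action (t * x, t * y) p))) has_real_derivative
        - 2 * snd (snd p) * (x * Re (fst p) - y * Im (fst p))) (at 0)"
      using gamma_line_deriv[OF p, of x y 0] flow.action_zero[OF p] by (simp add: zero_prod_def)
    have 0: "snd (snd (flow.action (0 * x, 0 * y) p)) = snd (snd p)"
      using flow.action_zero[OF p] by (simp add: zero_prod_def)
    show ?thesis
      using ext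
    proof
      assume "\<forall>g. snd (snd (flow.action g p)) \<le> snd (snd p)"
      then show ?thesis using DERIV_local_max[OF d zero_less_one] unfolding 0 by blast
    next
      assume "\<forall>g. snd (snd p) \<le> snd (snd (flow.action g p))"
      then show ?thesis using DERIV_local_min[OF d zero_less_one] unfolding 0 by blast
    qed
  qed
  show ?thesis
    using zero[of 1 0] zero[of 0 1] p by (simp add: complex_eq_iff in_P2_iff)
qed

lemma nonneg_form_discriminant:
  fixes r v w :: real
  assumes Q: "\<And>x y. 0 \<le> x\<^sup>2 * (v + r) - 2 * x * y * w - y\<^sup>2 * (v - r)"
  shows "0 \<le> r" "v\<^sup>2 + w\<^sup>2 \<le> r\<^sup>2"
proof -
  have 1: "0 \<le> v + r" "v - r \<le> 0" using Q[of 1 0] Q[of 0 1] by auto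
  then show "0 \<le> r" by linarith
  show "v\<^sup>2 + w\<^sup>2 \<le> r\<^sup>2"
  proof (cases "v + r = 0")
    case False
    \<comment> \<open>the form at \<open>(w, v + r)\<close>\<close>
    have "0 \<le> (v + r) * (r\<^sup>2 - v\<^sup>2 - w\<^sup>2)"
      using Q[of w "v + r"] by (simp add: power2_eq_square algebra_simps)
    then show ?thesis using 1 False by (simp add: zero_le_mult_iff)
  next
    case True
    have "w = 0"
    proof (rule ccontr)
      assume "w \<noteq> 0"
      then show False using Q[of "(r + 1) / w" 1] True by (simp add: power2_eq_square)
    qed
    moreover have "v = - r" using True by simp
    ultimately show ?thesis by simp
  qed
qed

text \<open>
  At a maximum \<open>\<alpha> = 0\<close>, so the second derivative of \<open>\<gamma>\<close> in direction \<open>(x, y)\<close> is \<open>- 2 \<gamma>\<close> times the quadratic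
  form \<open>Q\<close> below, which must therefore be nonnegative. By \<open>nonneg_form_discriminant\<close> this means
  \<open>\<bar>\<beta> \<gamma> - cnj \<beta> / \<gamma>\<bar> \<le> \<gamma>\<^sup>2 - 1 / \<gamma>\<^sup>2\<close>.
\<close>

lemma orbit_max_second_order:
  assumes p: "p \<in> P2" and max: "\<And>g. snd (snd (flow.action g p)) \<le> snd (snd p)"
    and pe: "p = (Complex a1 a2, Complex b1 b2, g)"
  shows "a1 = 0" "a2 = 0" "1 \<le> g"
    "(b1 * (g - inverse g))\<^sup>2 + (b2 * (g + inverse g))\<^sup>2 \<le> ((g - inverse g) * (g + inverse g))\<^sup>2"
proof -
  show a: "a1 = 0" "a2 = 0"
    using orbit_extremum_alpha[OF p] max by (simp_all add: pe complex_eq_iff)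
  have g: "0 < g" using p by (simp add: pe)
  define d where "d = inverse g"
  have gd: "0 < d" "g * d = 1" using g by (auto simp: d_def)
  have Q: "0 \<le> x\<^sup>2 * (b1 * (g - d) + (g\<^sup>2 - d\<^sup>2)) - 2 * x * y * (b2 * (g + d)) - y\<^sup>2 * (b1 * (g - d) - (g\<^sup>2 - d\<^sup>2))" for x y
  proof (rule ccontr)
    let ?c = "\<lambda>t. flow.action (t * x, t * y) p"
    let ?h = "\<lambda>t. snd (snd (?c t))"
    let ?k = "\<lambda>t. - 2 * ?h t * (x * Re (fst (?c t)) - y * Im (fst (?c t)))"
    let ?Q = "x\<^sup>2 * (b1 * (g - d) + (g\<^sup>2 - d\<^sup>2)) - 2 * x * y * (b2 * (g + d)) - y\<^sup>2 * (b1 * (g - d) - (g\<^sup>2 - d\<^sup>2))"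
    assume neg: "\<not> 0 \<le> ?Q"
    have c0: "?c 0 = p" using flow.action_zero[OF p] by (simp add: zero_prod_def)
    let ?A = "fst (x *\<^sub>R field_U p + y *\<^sub>R field_V p)"
    have dfst: "((\<lambda>t. fst (?c t)) has_vector_derivative ?A) (at 0)"
      using bounded_linear.has_vector_derivative[OF bounded_linear_fst action_line_deriv[OF p, of x y 0]]
      unfolding c0 .
    have dRe: "((\<lambda>t. Re (fst (?c t))) has_real_derivative Re ?A) (at 0)"
      using bounded_linear.has_vector_derivative[OF bounded_linear_Re dfst]
      by (simp only: has_real_derivative_iff_has_vector_derivative)
    have dIm: "((\<lambda>t. Im (fst (?c t))) has_real_derivative Im ?A) (at 0)"
      using bounded_linear.has_vector_derivative[OF bounded_linear_Im dfst]
      by (simp only: has_real_derivative_iff_has_vector_derivative)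
    have dk: "(?k has_real_derivative - 2 * g * (x * Re ?A - y * Im ?A)) (at 0)"
    proof -
      have f: "x * Re (fst p) - y * Im (fst p) = 0" "snd (snd p) = g" by (simp_all add: pe a)
      show ?thesis
        using DERIV_mult'[OF DERIV_cmult[OF gamma_line_deriv[OF p, of x y 0], of "- 2"]
            DERIV_diff[OF DERIV_cmult[OF dRe, of x] DERIV_cmult[OF dIm, of y]]]
        unfolding c0 f by simp
    qed
    have "x * Re ?A - y * Im ?A = ?Q"
      unfolding pe field_U_Complex field_V_Complex d_def[symmetric] a
      by (simp add: power2_eq_square algebra_simps)
    then have "0 < - 2 * g * (x * Re ?A - y * Im ?A)"
      using neg g by (simp add: mult_less_0_iff)
    from DERIV_pos_inc_right[OF dk this] obtain e where
      e: "0 < e" "\<And>t. 0 < t \<Longrightarrow> t < e \<Longrightarrow> ?k 0 < ?k t" by auto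
    have k0: "?k 0 = 0" by (simp only: c0) (simp add: pe a)
    have "\<exists>z>0. z < e / 2 \<and> ?h (e / 2) - ?h 0 = (e / 2 - 0) * ?k z"
      by (rule MVT2) (use e(1) gamma_line_deriv[OF p] in auto)
    then obtain z where z: "0 < z" "z < e / 2" "?h (e / 2) - ?h 0 = (e / 2) * ?k z" by auto
    have "z < e" using z(2) e(1) by simp
    from e(2)[OF z(1) this] have kz: "0 < ?k z" unfolding k0 .
    have "0 < (e / 2) * ?k z" by (rule mult_pos_pos[OF half_gt_zero[OF e(1)] kz])
    then have "?h 0 < ?h (e / 2)" using z(3) by linarith
    then show False using max[of "(e / 2 * x, e / 2 * y)"] unfolding c0 by simp
  qed
  from nonneg_form_discriminant[OF Q]
  have r: "0 \<le> g\<^sup>2 - d\<^sup>2" and le: "(b1 * (g - d))\<^sup>2 + (b2 * (g + d))\<^sup>2 \<le> (g\<^sup>2 - d\<^sup>2)\<^sup>2" by auto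
  have f: "g\<^sup>2 - d\<^sup>2 = (g - d) * (g + d)" by (simp add: power2_eq_square algebra_simps)
  show "(b1 * (g - inverse g))\<^sup>2 + (b2 * (g + inverse g))\<^sup>2 \<le> ((g - inverse g) * (g + inverse g))\<^sup>2"
    using le[unfolded f] unfolding d_def .
  have "d \<le> g" using r gd g unfolding f by (simp add: zero_le_mult_iff)
  then have "1 \<le> g * g" using gd g mult_left_mono[of d g g] by simp
  then show "1 \<le> g" using g by (metis abs_of_pos abs_square_less_1 not_le power2_eq_square)
qed

lemma orbit_max_conditions:
  assumes p: "p \<in> P2" "\<not> singular p" and max: "\<And>g. snd (snd (flow.action g p)) \<le> snd (snd p)"
    and pe: "p = (Complex a1 a2, Complex b1 b2, g)"
  shows "a1 = 0" "a2 = 0" "1 < g"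
    "(b1 * (g - inverse g))\<^sup>2 + (b2 * (g + inverse g))\<^sup>2 \<le> ((g - inverse g) * (g + inverse g))\<^sup>2"
proof -
  note * = orbit_max_second_order[OF p(1) max pe]
  show "a1 = 0" "a2 = 0"
    "(b1 * (g - inverse g))\<^sup>2 + (b2 * (g + inverse g))\<^sup>2 \<le> ((g - inverse g) * (g + inverse g))\<^sup>2"
    by (fact *)+
  have "g \<noteq> 1"
  proof
    assume "g = 1"
    then have "b2 = 0" using *(4) by simp
    then show False using p(2) * \<open>g = 1\<close> by (simp add: pe singular_iff complex_eq_iff)
  qed
  then show "1 < g" using *(3) by simp
qed

text \<open>
  Here \<open>s = \<gamma> + 1 / \<gamma>\<close> and \<open>u = \<gamma> - 1 / \<gamma>\<close> for two maxima, with \<open>c\<^sub>1 = b1 s\<close> and \<open>c\<^sub>2 = b2 u\<close> the common value of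
  \<open>spec1\<close>. The function \<open>c\<^sub>1\<^sup>2 / s\<^sup>2 + c\<^sub>2\<^sup>2 / u\<^sup>2 + s\<^sup>2\<close> of \<open>s\<^sup>2\<close> is strictly convex, or has slope \<open>1\<close> if
  \<open>c\<^sub>1 = c\<^sub>2 = 0\<close>. The last assumption says that its derivative is nonnegative at \<open>s\<^sup>2\<close>; so it takes a
  strictly larger value at every larger argument.
\<close>

lemma orbit_max_unique_aux:
  fixes b1 b2 b1' b2' s u s' u' :: real
  assumes su: "0 < u" "0 < s" "s\<^sup>2 - u\<^sup>2 = 4" "s'\<^sup>2 - u'\<^sup>2 = 4" "0 < u'" "0 < s'"
    and eq: "b1 * s = b1' * s'" "b2 * u = b2' * u'" "b1\<^sup>2 + b2\<^sup>2 + s\<^sup>2 = b1'\<^sup>2 + b2'\<^sup>2 + s'\<^sup>2"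
    and le: "(b1 * u)\<^sup>2 + (b2 * s)\<^sup>2 \<le> (u * s)\<^sup>2"
  shows "s' \<le> s"
proof (rule ccontr)
  assume "\<not> s' \<le> s"
  then have s: "s\<^sup>2 < s'\<^sup>2" using su by (simp add: power_strict_mono)
  then have u: "u\<^sup>2 < u'\<^sup>2" using su by linarith
  define D where "D = s'\<^sup>2 - s\<^sup>2"
  have D: "0 < D" "D = u'\<^sup>2 - u\<^sup>2" using s su by (auto simp: D_def)
  have b: "b1' = b1 * s / s'" "b2' = b2 * u / u'" using eq su by (auto simp: field_simps)
  have "b1\<^sup>2 - b1'\<^sup>2 = D * (b1\<^sup>2 / s'\<^sup>2)"
    unfolding b D_def using \<open>0 < s'\<close> by (simp add: field_simps power2_eq_square)
  moreover have "b2\<^sup>2 - b2'\<^sup>2 = D * (b2\<^sup>2 / u'\<^sup>2)"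
    unfolding b D(2) using \<open>0 < u'\<close> by (simp add: field_simps power2_eq_square)
  ultimately have "D * (b1\<^sup>2 / s'\<^sup>2 + b2\<^sup>2 / u'\<^sup>2) = D * 1"
    using eq(3) by (simp add: D_def algebra_simps)
  then have one: "b1\<^sup>2 / s'\<^sup>2 + b2\<^sup>2 / u'\<^sup>2 = 1" using D(1) by (metis less_irrefl mult_left_cancel)
  have "b1\<^sup>2 / s\<^sup>2 + b2\<^sup>2 / u\<^sup>2 = ((b1 * u)\<^sup>2 + (b2 * s)\<^sup>2) / (u * s)\<^sup>2"
    using \<open>0 < u\<close> \<open>0 < s\<close> by (simp add: field_simps power_mult_distrib)
  then have "b1\<^sup>2 / s\<^sup>2 + b2\<^sup>2 / u\<^sup>2 \<le> 1"
    using le \<open>0 < u\<close> \<open>0 < s\<close> by (simp add: divide_le_eq_1)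
  moreover have "b1\<^sup>2 / s'\<^sup>2 \<le> b1\<^sup>2 / s\<^sup>2" "b2\<^sup>2 / u'\<^sup>2 \<le> b2\<^sup>2 / u\<^sup>2"
    by (rule divide_left_mono[OF less_imp_le[OF s]] divide_left_mono[OF less_imp_le[OF u]]; use su in simp)+
  moreover have "b1\<^sup>2 / s'\<^sup>2 < b1\<^sup>2 / s\<^sup>2" if "b1 \<noteq> 0"
    using s su that by (intro divide_strict_left_mono) auto
  moreover have "b2\<^sup>2 / u'\<^sup>2 < b2\<^sup>2 / u\<^sup>2" if "b2 \<noteq> 0"
    using u su that by (intro divide_strict_left_mono) auto
  ultimately have "b1 = 0" "b2 = 0" using one by linarith+
  then show False using one by simp
qed

lemma orbit_max_unique:
  assumes p: "p \<in> P2" "\<not> singular p" "\<And>g. snd (snd (flow.action g p)) \<le> snd (snd p)"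
    and q: "q \<in> P2" "\<not> singular q" "\<And>g. snd (snd (flow.action g q)) \<le> snd (snd q)"
    and eq: "spec1 p = spec1 q" "spec2 p = spec2 q"
  shows "p = q"
proof -
  obtain a1 a2 b1 b2 g where pe: "p = (Complex a1 a2, Complex b1 b2, g)" by (rule potential_coords)
  obtain a1' a2' b1' b2' g' where qe: "q = (Complex a1' a2', Complex b1' b2', g')" by (rule potential_coords)
  note pc = orbit_max_conditions[OF p pe] and qc = orbit_max_conditions[OF q qe]
  define s u where "s = g + inverse g" and "u = g - inverse g"
  define s' u' where "s' = g' + inverse g'" and "u' = g' - inverse g'"
  have inv: "inverse g < 1" "inverse g' < 1" using pc(3) qc(3) by (auto simp: inverse_less_1_iff)
  have pos: "0 < inverse g" "0 < inverse g'" using pc(3) qc(3) by auto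
  have su: "0 < u" "0 < s" "s\<^sup>2 - u\<^sup>2 = 4" "0 < u'" "0 < s'" "s'\<^sup>2 - u'\<^sup>2 = 4"
    subgoal using inv pc(3) unfolding u_def by linarith
    subgoal using pos pc(3) unfolding s_def by linarith
    subgoal using pc(3) by (simp add: s_def u_def power2_eq_square algebra_simps)
    subgoal using inv qc(3) unfolding u'_def by linarith
    subgoal using pos qc(3) unfolding s'_def by linarith
    subgoal using qc(3) by (simp add: s'_def u'_def power2_eq_square algebra_simps)
    done
  have e1: "b1 * s = b1' * s'" "b2 * u = b2' * u'"
    using eq(1) unfolding pe qe spec1_Complex s_def u_def s'_def u'_def
    by (simp_all add: pc(1,2) qc(1,2))
  have sq: "g\<^sup>2 + (inverse g)\<^sup>2 = s\<^sup>2 - 2" "g'\<^sup>2 + (inverse g')\<^sup>2 = s'\<^sup>2 - 2"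
    using pc(3) qc(3) by (simp_all add: s_def s'_def power2_eq_square algebra_simps)
  have e2: "b1\<^sup>2 + b2\<^sup>2 + s\<^sup>2 = b1'\<^sup>2 + b2'\<^sup>2 + s'\<^sup>2"
    using eq(2) sq unfolding pe qe spec2_Complex by (simp add: pc(1,2) qc(1,2))
  have "s' \<le> s"
    using orbit_max_unique_aux[OF su(1,2,3,6,4,5) e1 e2] pc(4) by (simp add: s_def u_def)
  moreover have "s \<le> s'"
    using orbit_max_unique_aux[OF su(4,5,6,3,1,2) e1[symmetric] e2[symmetric]] qc(4) by (simp add: s'_def u'_def)
  ultimately have s: "s = s'" by simp
  have "u\<^sup>2 = u'\<^sup>2" using su(3)[unfolded s] su(6) by linarith
  then have u: "u = u'" using su(1,4) by (metis less_imp_le power2_eq_iff_nonneg)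
  have "2 * g = s + u" "2 * g' = s' + u'" by (auto simp: s_def u_def s'_def u'_def)
  then have "g = g'" using s u by simp
  moreover have "b1 = b1'" "b2 = b2'" using e1 s u su by auto
  ultimately show ?thesis by (simp add: pe qe pc(1,2) qc(1,2))
qed

lemma orbit_subset_fibre: "p \<in> P2 \<Longrightarrow> action_orbit flow.action p \<subseteq> spec_fibre p"
  unfolding action_orbit_def by (rule image_subsetI) (simp add: spec_fibre_def flow.action_in spec_action)

lemma compact_fibre: "p \<in> P2 \<Longrightarrow> compact (spec_fibre p)"
proof -
  assume p: "p \<in> P2"
  let ?K = "{q \<in> P2. spec2 q \<le> spec2 p}"
  have "continuous_on ?K (\<lambda>q. (spec1 q, spec2 q))"
    using has_derivative_continuous[OF has_derivative_Pair[OF spec1_deriv spec2_deriv]]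
    by (intro continuous_at_imp_continuous_on) blast
  then have "closedin (top_of_set ?K) (?K \<inter> (\<lambda>q. (spec1 q, spec2 q)) -` {(spec1 p, spec2 p)})"
    by (intro continuous_closedin_preimage) auto
  then have "compact (?K \<inter> (\<lambda>q. (spec1 q, spec2 q)) -` {(spec1 p, spec2 p)})"
    by (rule closedin_compact[OF spec2_proper])
  moreover have "?K \<inter> (\<lambda>q. (spec1 q, spec2 q)) -` {(spec1 p, spec2 p)} = spec_fibre p"
    unfolding spec_fibre_def by auto
  ultimately show ?thesis by simp
qed

lemma fibre_action: "p \<in> P2 \<Longrightarrow> q \<in> spec_fibre p \<Longrightarrow> flow.action g q \<in> spec_fibre p"
  by (simp add: spec_fibre_def flow.action_in spec_action)

lemma fibre_eq: "q \<in> spec_fibre p \<Longrightarrow> spec_fibre q = spec_fibre p"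
  by (simp add: spec_fibre_def)

lemma continuous_on_gamma: "continuous_on S (\<lambda>q :: potential. snd (snd q))"
  by (intro continuous_intros)

text \<open>
  Open orbits of a compact fibre are closed, so each contains a maximum of \<open>\<gamma>\<close>; if the fibre has only one such
  maximum, it has only one orbit.
\<close>

lemma transitive_fibre:
  assumes p0: "p0 \<in> P2"
    and orbit_open: "\<And>p. p \<in> spec_fibre p0 \<Longrightarrow> \<exists>W. open W \<and> p \<in> W \<and> spec_fibre p0 \<inter> W \<subseteq> action_orbit flow.action p"
    and unique: "\<And>p q. p \<in> spec_fibre p0 \<Longrightarrow> q \<in> spec_fibre p0 \<Longrightarrow>
      (\<And>g. snd (snd (flow.action g p)) \<le> snd (snd p)) \<Longrightarrow> (\<And>g. snd (snd (flow.action g q)) \<le> snd (snd q)) \<Longrightarrow> p = q"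
  shows "transitive_action_on flow.action (spec_fibre p0)"
proof -
  have sub: "spec_fibre p0 \<subseteq> P2" by (auto simp: spec_fibre_def)
  have closed: "spec_fibre p0 \<inter> closure (action_orbit flow.action p) \<subseteq> action_orbit flow.action p"
    if "p \<in> spec_fibre p0" for p
    by (rule flow.orbit_closed[OF sub fibre_action[OF p0] orbit_open that])
  have max: "\<exists>m. m \<in> action_orbit flow.action p \<and> (\<forall>g. snd (snd (flow.action g m)) \<le> snd (snd m))"
    if p: "p \<in> spec_fibre p0" for p
  proof -
    have pP: "p \<in> P2" using p sub by blast
    have O: "action_orbit flow.action p \<subseteq> spec_fibre p0"
      using orbit_subset_fibre[OF pP] fibre_eq[OF p] by simp
    have "action_orbit flow.action p = spec_fibre p0 \<inter> closure (action_orbit flow.action p)"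
      using closed[OF p] O closure_subset by blast
    moreover have "compact (spec_fibre p0 \<inter> closure (action_orbit flow.action p))"
      by (intro compact_Int_closed compact_fibre p0 closed_closure)
    ultimately have "compact (action_orbit flow.action p)" by simp
    moreover have "action_orbit flow.action p \<noteq> {}" by (simp add: action_orbit_def)
    ultimately obtain m where m: "m \<in> action_orbit flow.action p"
      "\<And>q. q \<in> action_orbit flow.action p \<Longrightarrow> snd (snd q) \<le> snd (snd m)"
      using continuous_attains_sup[OF _ _ continuous_on_gamma] by meson
    have "flow.action g m \<in> action_orbit flow.action p" for g
      using flow.action_orbit_eq[OF pP m(1)] unfolding action_orbit_def by blast
    then show ?thesis using m by blast
  qed
  show ?thesis
    unfolding transitive_action_on_def
  proof
    fix p assume p: "p \<in> spec_fibre p0"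
    have orb: "action_orbit flow.action p \<subseteq> spec_fibre p0"
      using orbit_subset_fibre[of p] fibre_eq[OF p] p sub by auto
    have "q \<in> action_orbit flow.action p" if q: "q \<in> spec_fibre p0" for q
    proof -
      have P: "p \<in> P2" "q \<in> P2" using p q sub by auto
      obtain m where m: "m \<in> action_orbit flow.action p" "\<And>g. snd (snd (flow.action g m)) \<le> snd (snd m)"
        using max[OF p] by blast
      obtain n where n: "n \<in> action_orbit flow.action q" "\<And>g. snd (snd (flow.action g n)) \<le> snd (snd n)"
        using max[OF q] by blast
      have "m \<in> spec_fibre p0" "n \<in> spec_fibre p0"
        using subsetD[OF orbit_subset_fibre[OF P(1)] m(1)] subsetD[OF orbit_subset_fibre[OF P(2)] n(1)]
          fibre_eq[OF p] fibre_eq[OF q] by simp_all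
      then have "m = n" using unique m(2) n(2) by blast
      then have "action_orbit flow.action p = action_orbit flow.action q"
        using flow.action_orbit_eq[OF P(1) m(1)] flow.action_orbit_eq[OF P(2) n(1)] by simp
      then show ?thesis using flow.action_orbit_self[OF P(2)] by simp
    qed
    then show "spec_fibre p0 = action_orbit flow.action p" using orb by blast
  qed
qed

lemma transitive_nonsingular_fibre:
  assumes p0: "p0 \<in> P2" and nonsing: "\<And>p. p \<in> spec_fibre p0 \<Longrightarrow> \<not> singular p"
  shows "transitive_action_on flow.action (spec_fibre p0)"
proof (rule transitive_fibre[OF p0])
  fix p assume p: "p \<in> spec_fibre p0"
  then have "p \<in> P2" by (simp add: spec_fibre_def)
  from nonsingular_orbit_open[OF this nonsing[OF p]]
  show "\<exists>W. open W \<and> p \<in> W \<and> spec_fibre p0 \<inter> W \<subseteq> action_orbit flow.action p"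
    by (simp add: fibre_eq[OF p])
next
  fix p q assume "p \<in> spec_fibre p0" "q \<in> spec_fibre p0"
    and "\<And>g. snd (snd (flow.action g p)) \<le> snd (snd p)" "\<And>g. snd (snd (flow.action g q)) \<le> snd (snd q)"
  then show "p = q" using nonsing by (intro orbit_max_unique) (auto simp: spec_fibre_def)
qed

section \<open>The spectral polynomial\<close>

lemma eq_singletonI: "p \<in> S \<Longrightarrow> (\<And>q. q \<in> S \<Longrightarrow> q = p) \<Longrightarrow> S = {p}"
  by blast

definition spectral_poly :: "potential \<Rightarrow> complex poly" where
  "spectral_poly p = [:1, - spec1 p, of_real (spec2 p), - cnj (spec1 p), 1:]"

lemma spec1_eq: "spec1 (\<alpha>, \<beta>, \<gamma>) = \<alpha>\<^sup>2 + cnj \<beta> * of_real (inverse \<gamma>) + \<beta> * of_real \<gamma>"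
  by (simp add: spec1_def)

lemma spec2_eq: "spec2 (\<alpha>, \<beta>, \<gamma>) = 2 * (norm \<alpha>)\<^sup>2 + (norm \<beta>)\<^sup>2 + \<gamma>\<^sup>2 + (inverse \<gamma>)\<^sup>2"
  by (simp add: spec2_def power2_norm_eq_inner)

lemma of_real_spec2:
  "complex_of_real (spec2 (\<alpha>, \<beta>, \<gamma>)) =
    2 * (\<alpha> * cnj \<alpha>) + \<beta> * cnj \<beta> + (of_real \<gamma>)\<^sup>2 + (of_real (inverse \<gamma>))\<^sup>2"
  unfolding spec2_eq of_real_add of_real_mult complex_norm_square by simp

lemma det_zeta:
  assumes "p \<in> P2"
  shows "det (zeta p) = [:0, 1:] * spectral_poly p"
proof -
  obtain \<alpha> \<beta> \<gamma> where p: "p = (\<alpha>, \<beta>, \<gamma>)" by (cases p)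
  define G D where "G = complex_of_real \<gamma>" and "D = complex_of_real (inverse \<gamma>)"
  have GD: "G * D = 1" using assms by (simp add: p G_def D_def flip: of_real_mult)
  have "det (zeta p) = [:0, 1, - (\<alpha>\<^sup>2 + cnj \<beta> * D + \<beta> * G), 2 * (\<alpha> * cnj \<alpha>) + \<beta> * cnj \<beta> + G\<^sup>2 + D\<^sup>2,
      - ((cnj \<alpha>)\<^sup>2 + \<beta> * D + cnj \<beta> * G), 1:]"
    using GD by (simp add: p det_2 vector_2 G_def[symmetric] D_def[symmetric] power2_eq_square algebra_simps
      del: of_real_inverse)
  then show ?thesis
    by (simp add: p spectral_poly_def spec1_eq of_real_spec2 G_def D_def del: of_real_inverse)
qed

lemma isospectral_iff: "p \<in> isospectral a \<longleftrightarrow> p \<in> P2 \<and> a = spectral_poly p"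
proof -
  have "[:0, 1:] * spectral_poly p = [:0, 1:] * a \<longleftrightarrow> a = spectral_poly p" by auto
  then show ?thesis using det_zeta[of p] unfolding isospectral_def mem_Collect_eq by metis
qed

lemma spectral_poly_eq_iff: "spectral_poly p = spectral_poly q \<longleftrightarrow> spec1 p = spec1 q \<and> spec2 p = spec2 q"
  by (auto simp: spectral_poly_def)

lemma isospectral_eq_fibre: "p \<in> isospectral a \<Longrightarrow> isospectral a = spec_fibre p"
  by (auto simp: isospectral_iff spec_fibre_def spectral_poly_eq_iff)

lemma isospectral_nonempty:
  assumes "a \<in> M2"
  obtains p where "p \<in> isospectral a"
proof -
  have "\<exists>p\<in>P2. [:0, 1:] * a = det (zeta p)"
    using assms unfolding M2_def mem_Collect_eq by (rule conjunct2)
  then obtain p where p: "p \<in> P2" "[:0, 1:] * a = det (zeta p)" by (rule bexE)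
  then have "p \<in> isospectral a" unfolding isospectral_def mem_Collect_eq by (intro conjI p(2)[symmetric])
  then show thesis by (rule that)
qed

lemma spectral_poly_degree: "degree (spectral_poly p) = 4" "spectral_poly p \<noteq> 0"
  by (simp_all add: spectral_poly_def)

text \<open>
  On the unit circle the lower left entry of \<open>\<zeta>\<close> is, up to sign and a power of \<open>z\<close>, the conjugate of the upper right one,
  and the diagonal entry is, up to such a power, imaginary. Hence the determinant is a power of \<open>z\<close>
  times a sum of two squared moduli, and can vanish only where \<open>\<zeta>\<close> vanishes.
\<close>

lemma poly_spectral_circle:
  assumes "(\<alpha>, \<beta>, \<gamma>) \<in> P2" and z: "norm z = 1"
  shows "poly (spectral_poly (\<alpha>, \<beta>, \<gamma>)) z = z\<^sup>2 * of_real ((norm (\<alpha> - z * cnj \<alpha>))\<^sup>2 +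
      (norm (of_real (inverse \<gamma>) - \<beta> * z + of_real \<gamma> * z\<^sup>2))\<^sup>2)"
proof -
  define G D where "G = complex_of_real \<gamma>" and "D = complex_of_real (inverse \<gamma>)"
  define z' where "z' = cnj z"
  define a b where "a = cnj \<alpha>" and "b = cnj \<beta>"
  have zz: "z * z' = 1" using cnj_unit[OF z] by (simp add: z'_def)
  have GD: "G * D = 1" "cnj G = G" "cnj D = D"
    using assms by (simp_all add: G_def D_def flip: of_real_mult)
  have rhs: "complex_of_real ((norm (\<alpha> - z * cnj \<alpha>))\<^sup>2 + (norm (of_real (inverse \<gamma>) - \<beta> * z + of_real \<gamma> * z\<^sup>2))\<^sup>2) =
      (\<alpha> - z * a) * (a - z' * \<alpha>) + (D - \<beta> * z + G * z\<^sup>2) * (D - b * z' + G * z'\<^sup>2)"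
    unfolding of_real_add complex_norm_square G_def[symmetric] D_def[symmetric]
    by (simp add: GD a_def b_def z'_def)
  have "poly (spectral_poly (\<alpha>, \<beta>, \<gamma>)) z =
      1 - (\<alpha>\<^sup>2 + b * D + \<beta> * G) * z + (2 * (\<alpha> * a) + \<beta> * b + G\<^sup>2 + D\<^sup>2) * z^2 - (a\<^sup>2 + \<beta> * D + b * G) * z^3 + z^4"
    unfolding spectral_poly_def of_real_spec2 spec1_eq G_def[symmetric] D_def[symmetric]
    by (simp add: GD a_def b_def algebra_simps power2_eq_square power3_eq_cube power4_eq_xxxx)
  also have "\<dots> = z\<^sup>2 * ((\<alpha> - z * a) * (a - z' * \<alpha>) + (D - \<beta> * z + G * z\<^sup>2) * (D - b * z' + G * z'\<^sup>2))"
    using zz GD(1) by algebra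
  finally show ?thesis unfolding rhs .
qed

lemma circle_root_iff:
  assumes P: "(\<alpha>, \<beta>, \<gamma>) \<in> P2" and z: "norm z = 1"
  shows "poly (spectral_poly (\<alpha>, \<beta>, \<gamma>)) z = 0 \<longleftrightarrow>
    \<alpha> = z * cnj \<alpha> \<and> \<beta> = of_real \<gamma> * z + of_real (inverse \<gamma>) * cnj z"
proof -
  have z0: "z \<noteq> 0" "z * cnj z = 1" using z cnj_unit by auto
  have "poly (spectral_poly (\<alpha>, \<beta>, \<gamma>)) z = 0 \<longleftrightarrow>
      \<alpha> - z * cnj \<alpha> = 0 \<and> of_real (inverse \<gamma>) - \<beta> * z + of_real \<gamma> * z\<^sup>2 = 0"
    unfolding poly_spectral_circle[OF assms]
    using z0(1) by (simp only: mult_eq_0_iff of_real_eq_0_iff sum_power2_eq_zero_iff norm_eq_zero power_eq_0_iff) auto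
  also have "of_real (inverse \<gamma>) - \<beta> * z + of_real \<gamma> * z\<^sup>2 = 0 \<longleftrightarrow>
      z * (\<beta> - (of_real \<gamma> * z + of_real (inverse \<gamma>) * cnj z)) = 0"
  proof -
    have "z * (\<beta> - (of_real \<gamma> * z + of_real (inverse \<gamma>) * cnj z)) =
        - (of_real (inverse \<gamma>) - \<beta> * z + of_real \<gamma> * z\<^sup>2)"
      using z0(2) by (simp add: power2_eq_square algebra_simps del: of_real_inverse)
    then show ?thesis by (metis neg_equal_0_iff_equal)
  qed
  finally show ?thesis using z0(1) by (simp del: of_real_inverse)
qed

lemma singular_circle_root:
  assumes "p \<in> P2" "singular p" "\<not> (fst p = 0 \<and> snd (snd p) = 1 \<and> Im (fst (snd p)) = 0)"
  obtains z where "norm z = 1" "poly (spectral_poly p) z = 0"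
proof -
  obtain \<alpha> \<beta> \<gamma> where p: "p = (\<alpha>, \<beta>, \<gamma>)" by (cases p)
  obtain z where "norm z = 1" "\<alpha> = z * cnj \<alpha>" "\<beta> = of_real \<gamma> * z + of_real (inverse \<gamma>) * cnj z"
    using assms(2,3) unfolding p singular_iff by auto
  then show thesis using circle_root_iff[of \<alpha> \<beta> \<gamma> z] assms(1) that[of z] unfolding p by blast
qed

text \<open>
  The remaining quadratic factor depends on the potential only through the sum \<open>\<bar>\<alpha>\<bar>\<^sup>2 + \<gamma>\<^sup>2 + 1 / \<gamma>\<^sup>2\<close>.
\<close>

lemma spectral_poly_circle_factor:
  assumes P: "(\<alpha>, \<beta>, \<gamma>) \<in> P2" and z: "norm z = 1"
    and \<alpha>: "\<alpha> = z * cnj \<alpha>" and \<beta>: "\<beta> = of_real \<gamma> * z + of_real (inverse \<gamma>) * cnj z"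
  shows "spectral_poly (\<alpha>, \<beta>, \<gamma>) = [:- z, 1:]\<^sup>2 *
    [:(cnj z)\<^sup>2, - (cnj z * of_real ((norm \<alpha>)\<^sup>2 + \<gamma>\<^sup>2 + (inverse \<gamma>)\<^sup>2)), 1:]"
proof -
  define G D where "G = complex_of_real \<gamma>" and "D = complex_of_real (inverse \<gamma>)"
  define z' a where "z' = cnj z" and "a = cnj \<alpha>"
  have zz: "z * z' = 1" using cnj_unit[OF z] by (simp add: z'_def)
  have GD: "G * D = 1" "cnj G = G" "cnj D = D"
    using P by (simp_all add: G_def D_def flip: of_real_mult)
  have b: "\<beta> = G * z + D * z'" "cnj \<beta> = G * z' + D * z"
    unfolding \<beta> z'_def G_def D_def by (simp_all del: of_real_inverse)
  have al: "\<alpha> = z * a" using \<alpha> by (simp add: a_def)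
  have E: "complex_of_real ((norm \<alpha>)\<^sup>2 + \<gamma>\<^sup>2 + (inverse \<gamma>)\<^sup>2) = \<alpha> * a + G\<^sup>2 + D\<^sup>2"
    unfolding of_real_add complex_norm_square by (simp add: G_def D_def a_def)
  have "- (\<alpha>\<^sup>2 + (G * z' + D * z) * D + (G * z + D * z') * G) = - (2 * (z * z'\<^sup>2) + z\<^sup>2 * (z' * (\<alpha> * a + G\<^sup>2 + D\<^sup>2)))"
    using zz GD(1) al by algebra
  moreover have "2 * (\<alpha> * a) + (G * z + D * z') * (G * z' + D * z) + G\<^sup>2 + D\<^sup>2 =
      z'\<^sup>2 + 2 * z * (z' * (\<alpha> * a + G\<^sup>2 + D\<^sup>2)) + z\<^sup>2"
    using zz GD(1) al by algebra
  moreover have "- (a\<^sup>2 + (G * z + D * z') * D + (G * z' + D * z) * G) = - (z' * (\<alpha> * a + G\<^sup>2 + D\<^sup>2)) - 2 * z"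
    using zz GD(1) al by algebra
  moreover have "z\<^sup>2 * z'\<^sup>2 = 1" using zz by algebra
  ultimately have "[:1, - (\<alpha>\<^sup>2 + cnj \<beta> * D + \<beta> * G), 2 * (\<alpha> * a) + \<beta> * cnj \<beta> + G\<^sup>2 + D\<^sup>2,
      - (a\<^sup>2 + \<beta> * D + cnj \<beta> * G), 1:] = [:z\<^sup>2, - 2 * z, 1:] * [:z'\<^sup>2, - (z' * (\<alpha> * a + G\<^sup>2 + D\<^sup>2)), 1:]"
  proof -
    assume E: "- (\<alpha>\<^sup>2 + (G * z' + D * z) * D + (G * z + D * z') * G) = - (2 * (z * z'\<^sup>2) + z\<^sup>2 * (z' * (\<alpha> * a + G\<^sup>2 + D\<^sup>2)))"
      "2 * (\<alpha> * a) + (G * z + D * z') * (G * z' + D * z) + G\<^sup>2 + D\<^sup>2 = z'\<^sup>2 + 2 * z * (z' * (\<alpha> * a + G\<^sup>2 + D\<^sup>2)) + z\<^sup>2"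
      "- (a\<^sup>2 + (G * z + D * z') * D + (G * z' + D * z) * G) = - (z' * (\<alpha> * a + G\<^sup>2 + D\<^sup>2)) - 2 * z"
      "z\<^sup>2 * z'\<^sup>2 = 1"
    have prod: "[:z\<^sup>2, - 2 * z, 1:] * [:z'\<^sup>2, - K, 1:] =
        [:z\<^sup>2 * z'\<^sup>2, - (2 * (z * z'\<^sup>2) + z\<^sup>2 * K), z'\<^sup>2 + 2 * z * K + z\<^sup>2, - K - 2 * z, 1:]" for K
      by (simp add: algebra_simps)
    show ?thesis
      unfolding prod b(2) unfolding b(1) E ..
  qed
  moreover have "[:- z, 1:]\<^sup>2 = [:z\<^sup>2, - 2 * z, 1:]" by (simp add: power2_eq_square)
  ultimately show ?thesis
    unfolding spectral_poly_def of_real_spec2 spec1_eq E G_def[symmetric] D_def[symmetric] z'_def[symmetric]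
    by (simp add: GD a_def)
qed

lemma square_poly_order_even:
  fixes q :: "complex poly"
  assumes "q \<noteq> 0"
  shows "even (order z (q\<^sup>2))"
  using assms order_mult[of q q z] by (simp add: power2_eq_square)

lemma spectral_poly_square:
  assumes "Im \<beta> = 0"
  shows "spectral_poly (0, \<beta>, 1) = [:1, - \<beta>, 1:]\<^sup>2"
proof -
  have c: "cnj \<beta> = \<beta>" using assms by (simp add: complex_eq_iff)
  show ?thesis
    unfolding spectral_poly_def of_real_spec2 spec1_eq by (simp add: c power2_eq_square)
qed

text \<open>
  The four given roots are all the roots of \<open>a\<close>. A singular potential either produces a root on the unit
  circle or makes \<open>a\<close> a square, which has no simple root.
\<close>

lemma M2_1_nonsingular:
  assumes a: "a \<in> M2_1" and p: "p \<in> isospectral a"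
  shows "\<not> singular p"
proof
  assume s: "singular p"
  have pa: "p \<in> P2" "a = spectral_poly p" using p by (auto simp: isospectral_iff)
  obtain A where A: "card A = 4" "\<And>z. z \<in> A \<Longrightarrow> order z a = 1" "\<And>z. z \<in> A \<Longrightarrow> z \<notin> sphere 0 1"
    using a by (auto simp: M2_1_def)
  have a0: "a \<noteq> 0" "degree a = 4" using pa spectral_poly_degree by auto
  have "A \<subseteq> {z. poly a z = 0}" using A(2) a0(1) order_root[of a] by fastforce
  moreover have "card {z. poly a z = 0} \<le> card A" using card_poly_roots_bound[OF a0(1)] a0(2) A(1) by simp
  ultimately have roots: "A = {z. poly a z = 0}"
    using card_seteq[OF poly_roots_finite[OF a0(1)]] by blast
  show False
  proof (cases "fst p = 0 \<and> snd (snd p) = 1 \<and> Im (fst (snd p)) = 0")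
    case True
    then have "p = (0, fst (snd p), 1)" by (cases p) simp
    then have sq: "a = [:1, - fst (snd p), 1:]\<^sup>2" using spectral_poly_square True pa(2) by metis
    obtain z where "z \<in> A" using A(1) by (metis card.empty ex_in_conv zero_neq_numeral)
    then have "order z a = 1" using A(2) by blast
    then show False using square_poly_order_even[of "[:1, - fst (snd p), 1:]" z] sq by simp
  next
    case False
    then obtain z where "norm z = 1" "poly a z = 0" using singular_circle_root[OF pa(1) s] pa(2) by blast
    then show False using roots A(3) by (auto simp: dist_norm)
  qed
qed

lemma inverse_square_sum:
  fixes g :: real assumes "0 < g"
  shows "2 \<le> g\<^sup>2 + (inverse g)\<^sup>2" "g\<^sup>2 + (inverse g)\<^sup>2 = 2 \<Longrightarrow> g = 1"
proof -
  have e: "g\<^sup>2 + (inverse g)\<^sup>2 = 2 + (g - inverse g)\<^sup>2" using assms by (simp add: power2_eq_square algebra_simps)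
  then show "2 \<le> g\<^sup>2 + (inverse g)\<^sup>2" by simp
  assume "g\<^sup>2 + (inverse g)\<^sup>2 = 2"
  then have "g = inverse g" using e by simp
  then have "g\<^sup>2 = 1" using assms by (simp add: power2_eq_square field_simps)
  then show "g = 1" using assms by (metis abs_of_pos abs_square_eq_1)
qed

lemma isospectral_circle_root:
  assumes "(\<alpha>, \<beta>, \<gamma>) \<in> isospectral a" "z \<in> sphere 0 1" "order z a \<noteq> 0"
  shows "norm z = 1" "\<alpha> = z * cnj \<alpha>" "\<beta> = of_real \<gamma> * z + of_real (inverse \<gamma>) * cnj z" "0 < \<gamma>"
    "a = [:- z, 1:]\<^sup>2 * [:(cnj z)\<^sup>2, - (cnj z * of_real ((norm \<alpha>)\<^sup>2 + \<gamma>\<^sup>2 + (inverse \<gamma>)\<^sup>2)), 1:]"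
proof -
  have P: "(\<alpha>, \<beta>, \<gamma>) \<in> P2" "a = spectral_poly (\<alpha>, \<beta>, \<gamma>)" using assms(1) isospectral_iff by auto
  show z: "norm z = 1" using assms(2) by (simp add: dist_norm)
  have "poly a z = 0" using assms(3) order_root by blast
  then show *: "\<alpha> = z * cnj \<alpha>" "\<beta> = of_real \<gamma> * z + of_real (inverse \<gamma>) * cnj z"
    using circle_root_iff[OF P(1) z] unfolding P(2) by auto
  show "0 < \<gamma>" using P(1) by simp
  show "a = [:- z, 1:]\<^sup>2 * [:(cnj z)\<^sup>2, - (cnj z * of_real ((norm \<alpha>)\<^sup>2 + \<gamma>\<^sup>2 + (inverse \<gamma>)\<^sup>2)), 1:]"
    unfolding P(2) by (rule spectral_poly_circle_factor[OF P(1) z *])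
qed

text \<open>
  Vanishing of \<open>\<zeta>\<close> at two points of the circle gives \<open>\<alpha> = 0\<close> and \<open>\<gamma> = 1\<close>, and then determines \<open>\<beta>\<close>.
\<close>

lemma M2_3_single:
  assumes a: "a \<in> M2_3"
  shows "\<exists>p. isospectral a = {p}"
proof -
  obtain z w where zw: "z \<noteq> w" "z \<in> sphere 0 1" "w \<in> sphere 0 1" "order z a = 2" "order w a = 2" and M: "a \<in> M2"
    using a by (auto simp: M2_3_def)
  have unique: "q = (0, z + cnj z, 1)" if q: "q \<in> isospectral a" for q
  proof -
    obtain \<alpha> \<beta> \<gamma> where qe: "q = (\<alpha>, \<beta>, \<gamma>)" by (cases q)
    note Z = isospectral_circle_root(1-4)[OF q[unfolded qe] zw(2)] and W = isospectral_circle_root(1-4)[OF q[unfolded qe] zw(3)]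
    have Z: "norm z = 1" "\<alpha> = z * cnj \<alpha>" "\<beta> = of_real \<gamma> * z + of_real (inverse \<gamma>) * cnj z" "0 < \<gamma>"
      and W: "norm w = 1" "\<alpha> = w * cnj \<alpha>" "\<beta> = of_real \<gamma> * w + of_real (inverse \<gamma>) * cnj w"
      using Z W zw(4,5) by auto
    have "(z - w) * cnj \<alpha> = 0" using Z(2) W(2) by (simp add: algebra_simps)
    then have "\<alpha> = 0" using zw(1) by simp
    have "of_real \<gamma> * (z - w) = of_real (inverse \<gamma>) * cnj (w - z)"
      using Z(3) W(3) by (simp add: algebra_simps del: of_real_inverse)
    then have "norm (of_real \<gamma> * (z - w)) = norm (of_real (inverse \<gamma>) * cnj (w - z))" by simp
    then have "\<gamma> * norm (z - w) = inverse \<gamma> * norm (z - w)"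
      using Z(4) unfolding norm_mult complex_mod_cnj norm_of_real by (simp add: norm_minus_commute)
    then have "\<gamma> = inverse \<gamma>" using zw(1) by simp
    then have "\<gamma>\<^sup>2 + (inverse \<gamma>)\<^sup>2 = 2" using Z(4) by (metis one_add_one power2_eq_square right_inverse less_irrefl)
    then have "\<gamma> = 1" using inverse_square_sum(2)[OF Z(4)] by simp
    then show ?thesis using \<open>\<alpha> = 0\<close> Z(3) by (simp add: qe)
  qed
  obtain p where p: "p \<in> isospectral a" by (rule isospectral_nonempty[OF M])
  have "q = p" if "q \<in> isospectral a" for q unfolding unique[OF that] unique[OF p] ..
  from eq_singletonI[OF p this] show ?thesis by (rule exI)
qed

text \<open>
  The quadratic factor is \<open>(\<lambda> - z)\<^sup>2\<close>, which forces \<open>\<bar>\<alpha>\<bar>\<^sup>2 + \<gamma>\<^sup>2 + 1 / \<gamma>\<^sup>2\<close> to take its minimal value \<open>2\<close>.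
\<close>

lemma M2_4_single:
  assumes a: "a \<in> M2_4"
  shows "\<exists>p. isospectral a = {p}"
proof -
  obtain z where z: "z \<in> sphere 0 1" "order z a = 4" and M: "a \<in> M2"
    using a unfolding M2_4_def mem_Collect_eq by (elim conjE bexE)
  have unique: "q = (0, z + cnj z, 1)" if q: "q \<in> isospectral a" for q
  proof -
    obtain \<alpha> \<beta> \<gamma> where qe: "q = (\<alpha>, \<beta>, \<gamma>)" by (cases q)
    define E where "E = (norm \<alpha>)\<^sup>2 + \<gamma>\<^sup>2 + (inverse \<gamma>)\<^sup>2"
    define r where "r = [:(cnj z)\<^sup>2, - (cnj z * of_real E), 1:]"
    have Z: "norm z = 1" "\<beta> = of_real \<gamma> * z + of_real (inverse \<gamma>) * cnj z" "0 < \<gamma>" "a = [:- z, 1:]\<^sup>2 * r"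
      using isospectral_circle_root[OF q[unfolded qe] z(1)] z(2) by (auto simp: r_def E_def)
    have r0: "r \<noteq> 0" by (simp add: r_def)
    have "order z a = order z ([:- z, 1:]\<^sup>2) + order z r"
      unfolding Z(4) by (rule order_mult) (use r0 in auto)
    then have "order z r = 2" using z(2) order_power_n_n[of z 2] by simp
    then have "[:- z, 1:]\<^sup>2 dvd r" using order_1[of z r] by simp
    then obtain s where s: "r = [:- z, 1:]\<^sup>2 * s" by blast
    then have "s \<noteq> 0" using r0 by auto
    have "degree r = 2" by (simp add: r_def)
    then have "degree s = 0" using degree_mult_eq[of "[:- z, 1:]\<^sup>2" s] \<open>s \<noteq> 0\<close> s by (simp add: degree_power_eq)
    then obtain k where k: "s = [:k:]" by (metis degree_eq_zeroE)
    have "r = [:z\<^sup>2 * k, - 2 * z * k, k:]" unfolding s k by (simp add: power2_eq_square)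
    then have "cnj z * of_real E = 2 * z" "k = 1" by (simp_all add: r_def)
    then have "norm (cnj z * of_real E) = 2" using Z(1) by (simp add: norm_mult)
    then have "\<bar>E\<bar> = 2" using Z(1) by (simp add: norm_mult)
    moreover have "2 \<le> \<gamma>\<^sup>2 + (inverse \<gamma>)\<^sup>2" using inverse_square_sum(1)[OF Z(3)] .
    ultimately have "(norm \<alpha>)\<^sup>2 = 0" "\<gamma>\<^sup>2 + (inverse \<gamma>)\<^sup>2 = 2"
      using zero_le_power2[of "norm \<alpha>"] unfolding E_def by linarith+
    then have "\<alpha> = 0" "\<gamma> = 1" using inverse_square_sum(2)[OF Z(3)] by auto
    then show ?thesis using Z(2) by (simp add: qe)
  qed
  obtain p where p: "p \<in> isospectral a" by (rule isospectral_nonempty[OF M])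
  have "q = p" if "q \<in> isospectral a" for q unfolding unique[OF that] unique[OF p] ..
  from eq_singletonI[OF p this] show ?thesis by (rule exI)
qed

lemma double_roots_poly:
  fixes a :: "complex poly"
  assumes "degree a = 4" "lead_coeff a = 1" "z \<noteq> w" "order z a = 2" "order w a = 2"
  shows "a = [:- z, 1:]\<^sup>2 * [:- w, 1:]\<^sup>2"
proof -
  have a0: "a \<noteq> 0" using assms(1) by auto
  have "[:- z, 1:]\<^sup>2 dvd a" using order_1[of z a] assms(4) by simp
  then obtain q where q: "a = [:- z, 1:]\<^sup>2 * q" by blast
  then have q0: "q \<noteq> 0" using a0 by auto
  have "order w a = order w ([:- z, 1:]\<^sup>2) + order w q"
    unfolding q by (rule order_mult) (use a0 q in auto)
  moreover have "order w ([:- z, 1:]\<^sup>2) = 0" using assms(3) by (intro order_0I) (simp add: poly_power)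
  ultimately have "order w q = 2" using assms(5) by simp
  then have "[:- w, 1:]\<^sup>2 dvd q" using order_1[of w q] by simp
  then obtain s where s: "q = [:- w, 1:]\<^sup>2 * s" by blast
  then have "s \<noteq> 0" using q0 by auto
  then have "degree a = 2 + (2 + degree s)"
    using q s q0 by (simp add: degree_mult_eq degree_power_eq)
  then have "degree s = 0" using assms(1) by simp
  then obtain k where k: "s = [:k:]" by (metis degree_eq_zeroE)
  have "lead_coeff a = k" unfolding q s k by (simp add: lead_coeff_mult lead_coeff_power)
  then have "k = 1" using assms(2) by metis
  then have "s = 1" using k by (simp add: one_pCons)
  then show ?thesis unfolding q s by simp
qed

lemma order_double_roots:
  fixes z w u :: complex
  assumes "z \<noteq> w"
  shows "order u ([:- z, 1:]\<^sup>2 * [:- w, 1:]\<^sup>2) = 2 \<longleftrightarrow> u = z \<or> u = w"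
proof -
  have o: "order u ([:- v, 1:]\<^sup>2) = (if u = v then 2 else 0)" for v
    using order_power_n_n[of v 2] by (auto intro!: order_0I simp: poly_power)
  have "order u ([:- z, 1:]\<^sup>2 * [:- w, 1:]\<^sup>2) = order u ([:- z, 1:]\<^sup>2) + order u ([:- w, 1:]\<^sup>2)"
    by (rule order_mult) simp
  then show ?thesis using assms by (simp add: o)
qed

text \<open>
  Write \<open>a = (\<lambda> - z)\<^sup>2 (\<lambda> - w)\<^sup>2\<close>. Comparison with the coefficients \<open>1\<close>, \<open>spec1\<close> and \<open>cnj spec1\<close> gives \<open>z w = 1\<close> or \<open>z w = - 1\<close>
  and \<open>cnj (z + w) = z w (z + w)\<close>. The sign \<open>- 1\<close> would make \<open>spec2\<close> negative. So \<open>w = 1 / z\<close> and \<open>z + w\<close> is real, which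
  for \<open>z\<close> off the unit circle is possible only if \<open>z\<close> is real.
\<close>

lemma M2_5_form:
  assumes a: "a \<in> M2_5" and l: "order l a = 2"
  obtains r where "l = of_real r" "r \<noteq> 0" "\<bar>r\<bar> \<noteq> 1" "{u. order u a = 2} = {l, inverse (cnj l)}"
    "\<forall>p. p \<in> isospectral a \<longleftrightarrow> p \<in> P2 \<and> spec1 p = of_real (2 * (r + inverse r)) \<and> spec2 p = (r + inverse r)\<^sup>2 + 2"
    "\<forall>u. norm u = 1 \<longrightarrow> poly a u \<noteq> 0"
proof -
  obtain z w where zw: "z \<noteq> w" "z \<notin> sphere 0 1" "w \<notin> sphere 0 1" "order z a = 2" "order w a = 2" and M: "a \<in> M2"
    using a by (auto simp: M2_5_def)
  obtain p where "p \<in> isospectral a" by (rule isospectral_nonempty[OF M])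
  then have p: "p \<in> P2" "a = spectral_poly p" by (simp_all add: isospectral_iff)
  have a: "a = [:- z, 1:]\<^sup>2 * [:- w, 1:]\<^sup>2"
    by (rule double_roots_poly[OF _ _ zw(1,4,5)]) (simp_all add: p(2) spectral_poly_def)
  have a': "a = [:(z * w)\<^sup>2, - (2 * (z * w) * (z + w)), (z + w)\<^sup>2 + 2 * (z * w), - (2 * (z + w)), 1:]"
    unfolding a by (simp add: power2_eq_square algebra_simps)
  have c: "(z * w)\<^sup>2 = 1" "spec1 p = 2 * (z * w) * (z + w)" "of_real (spec2 p) = (z + w)\<^sup>2 + 2 * (z * w)"
    "cnj (spec1 p) = 2 * (z + w)"
  proof -
    have e: "[:1, - spec1 p, of_real (spec2 p), - cnj (spec1 p), 1:] =
        [:(z * w)\<^sup>2, - (2 * (z * w) * (z + w)), (z + w)\<^sup>2 + 2 * (z * w), - (2 * (z + w)), 1:]"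
      using p(2)[unfolded spectral_poly_def] a' by (rule trans[OF sym])
    then show "(z * w)\<^sup>2 = 1" "spec1 p = 2 * (z * w) * (z + w)"
      "of_real (spec2 p) = (z + w)\<^sup>2 + 2 * (z * w)" "cnj (spec1 p) = 2 * (z + w)"
      unfolding pCons_eq_iff neg_equal_iff_equal by metis+
  qed
  have pos: "0 < spec2 p"
  proof -
    obtain \<alpha> \<beta> \<gamma> where pe: "p = (\<alpha>, \<beta>, \<gamma>)" by (cases p)
    have "0 < \<gamma>\<^sup>2" using p(1) by (simp add: pe)
    then show ?thesis unfolding pe spec2_eq
      using zero_le_power2[of "norm \<alpha>"] zero_le_power2[of "norm \<beta>"] zero_le_power2[of "inverse \<gamma>"] by linarith
  qed
  have cs: "cnj (z + w) = (z * w) * (z + w)"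
    using c(2,4) by (metis (no_types, lifting) complex_cnj_cnj complex_cnj_mult complex_cnj_numeral mult.assoc
        mult_cancel_left zero_neq_numeral)
  have zw1: "z * w = 1"
  proof (rule ccontr)
    assume "z * w \<noteq> 1"
    then have m: "z * w = - 1" using c(1) by (simp add: power2_eq_1_iff)
    then have "Re (z + w) = 0" using arg_cong[OF cs, of Re] by simp
    then have "Re ((z + w)\<^sup>2 + 2 * (z * w)) = - (Im (z + w))\<^sup>2 - 2"
      unfolding m by (simp add: power2_eq_square)
    then have "spec2 p = - (Im (z + w))\<^sup>2 - 2" using arg_cong[OF c(3), of Re] by (metis Re_complex_of_real)
    then have "spec2 p \<le> 0" using zero_le_power2[of "Im (z + w)"] by linarith
    then show False using pos by simp
  qed
  have z0: "z \<noteq> 0" using zw1 by auto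
  have w: "w = inverse z" using inverse_unique[OF zw1] by simp
  have "Im (z + w) = 0" using arg_cong[OF cs, of Im] zw1 by simp
  have "Im z = 0"
  proof -
    have n: "(norm z)\<^sup>2 \<noteq> 1" "0 < (norm z)\<^sup>2"
      using zw(2) z0 by (auto simp: dist_norm abs_square_eq_1)
    have "Im w = - Im z / (norm z)\<^sup>2" unfolding w by (simp add: cmod_power2)
    then have "Im z * ((norm z)\<^sup>2 - 1) = 0" using \<open>Im (z + w) = 0\<close> n by (simp add: field_simps)
    then show ?thesis using n by simp
  qed
  then obtain x where x: "z = of_real x" by (metis complex_is_Real_iff Reals_cases)
  have x0: "x \<noteq> 0" "\<bar>x\<bar> \<noteq> 1" using z0 zw(2) by (auto simp: x dist_norm)
  have sum: "z + w = of_real (x + inverse x)" by (simp add: w x)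
  have lzw: "l = z \<or> l = w" using l order_double_roots[OF zw(1)] unfolding a by blast
  have set: "{u. order u a = 2} = {z, w}" using order_double_roots[OF zw(1)] unfolding a by auto
  define r where "r = (if l = z then x else inverse x)"
  have r: "l = of_real r" "r \<noteq> 0" "\<bar>r\<bar> \<noteq> 1" "r + inverse r = x + inverse x"
    using lzw x0 by (auto simp: r_def x w abs_inverse inverse_eq_1_iff)
  show thesis
  proof (rule that[of r])
    show "{u. order u a = 2} = {l, inverse (cnj l)}" unfolding set using lzw by (auto simp: x w)
    show "\<forall>p'. p' \<in> isospectral a \<longleftrightarrow> p' \<in> P2 \<and> spec1 p' = of_real (2 * (r + inverse r)) \<and> spec2 p' = (r + inverse r)\<^sup>2 + 2"
    proof
      fix p'
      have "spec1 p = of_real (2 * (r + inverse r))" using c(2) unfolding zw1 sum r(4) by simp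
      moreover have "complex_of_real (spec2 p) = of_real ((r + inverse r)\<^sup>2 + 2)"
        using c(3) unfolding zw1 sum r(4) by simp
      then have "spec2 p = (r + inverse r)\<^sup>2 + 2" using of_real_eq_iff by blast
      ultimately show "p' \<in> isospectral a \<longleftrightarrow> p' \<in> P2 \<and> spec1 p' = of_real (2 * (r + inverse r)) \<and> spec2 p' = (r + inverse r)\<^sup>2 + 2"
        unfolding isospectral_iff p(2) spectral_poly_eq_iff by auto
    qed
    show "\<forall>u. norm u = 1 \<longrightarrow> poly a u \<noteq> 0"
      using zw(2,3) unfolding a by (auto simp: dist_norm)
  qed (use r in auto)
qed

section \<open>One double root on the unit circle\<close>

lemma connected_not_dim_le_0:
  fixes S :: "'a::t1_space set"
  assumes "connected S" "p \<in> S" "q \<in> S" "p \<noteq> q"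
  shows "\<not> top_of_set S dim_le 0"
proof
  assume "top_of_set S dim_le 0"
  then have base: "neighbourhood_base_of (\<lambda>B. closedin (top_of_set S) B \<and> openin (top_of_set S) B) (top_of_set S)"
    by (simp add: dimension_le_0_neighbourhood_base_of_clopen)
  have "openin (top_of_set S) (S \<inter> - {q})" by (intro openin_open_Int) auto
  moreover have "p \<in> S \<inter> - {q}" using assms by auto
  ultimately obtain A B where AB: "openin (top_of_set S) A" "closedin (top_of_set S) B" "openin (top_of_set S) B"
    "p \<in> A" "A \<subseteq> B" "B \<subseteq> S \<inter> - {q}"
    using base unfolding neighbourhood_base_of by meson
  then have "B = {} \<or> B = S" using assms(1) unfolding connected_clopen by blast
  then show False using AB assms by blast
qed

lemma finite_dim_le_0:
  fixes S :: "'a::metric_space set"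
  assumes "finite S"
  shows "top_of_set S dim_le 0"
proof -
  have "top_of_set S = discrete_topology S"
    using assms Hausdorff_imp_t1_space[OF Hausdorff_space_subtopology[OF Hausdorff_space_euclidean]]
    by (intro finite_t1_space_imp_discrete_topology) auto
  then show ?thesis by simp
qed

text \<open>
  Boxes with respect to the coordinates \<open>f\<close> and \<open>g\<close> are a base of open sets. The frontier of a box lies in
  four level sets, so it is finite, hence of dimension at most zero.
\<close>

lemma finite_levels_dim_le_1:
  fixes S :: "'a::metric_space set" and f g :: "'a \<Rightarrow> real"
  assumes cont: "continuous_on S f" "continuous_on S g"
    and fin: "\<And>c. finite {q \<in> S. f q = c}" "\<And>c. finite {q \<in> S. g q = c}"
    and base: "\<And>V p. open V \<Longrightarrow> p \<in> S \<Longrightarrow> p \<in> V \<Longrightarrow>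
      \<exists>e>0. \<forall>q\<in>S. \<bar>f q - f p\<bar> < e \<longrightarrow> \<bar>g q - g p\<bar> < e \<longrightarrow> q \<in> V"
  shows "top_of_set S dim_le 1"
proof (rule dimension_le.intros)
  fix V p assume V: "openin (top_of_set S) V" "p \<in> V"
  then obtain T where T: "open T" "V = S \<inter> T" by (auto simp: openin_open)
  then obtain e where e: "e > 0" "\<And>q. q \<in> S \<Longrightarrow> \<bar>f q - f p\<bar> < e \<Longrightarrow> \<bar>g q - g p\<bar> < e \<Longrightarrow> q \<in> T"
    using base[of T p] V(2) by blast
  let ?h = "\<lambda>q. max \<bar>f q - f p\<bar> \<bar>g q - g p\<bar>"
  have conth: "continuous_on S ?h" by (intro continuous_intros cont)
  define B where "B = S \<inter> ?h -` {..<e}"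
  have B: "openin (top_of_set S) B" unfolding B_def
    by (rule continuous_openin_preimage_gen[OF conth]) auto
  have "closedin (top_of_set S) (S \<inter> ?h -` {..e})"
    by (rule continuous_closedin_preimage[OF conth]) auto
  then have "top_of_set S closure_of B \<subseteq> S \<inter> ?h -` {..e}"
    by (rule closure_of_minimal[rotated]) (auto simp: B_def)
  then have "top_of_set S frontier_of B \<subseteq> (S \<inter> ?h -` {..e}) - B"
    using interior_of_openin[OF B] by (auto simp: frontier_of_def)
  also have "\<dots> \<subseteq> {q \<in> S. f q = f p + e} \<union> {q \<in> S. f q = f p - e} \<union> {q \<in> S. g q = g p + e} \<union> {q \<in> S. g q = g p - e}"
    by (auto simp: B_def max_def abs_if split: if_splits)
  finally have "finite (top_of_set S frontier_of B)"
    by (rule finite_subset) (intro finite_UnI fin)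
  then have "subtopology (top_of_set S) (top_of_set S frontier_of B) dim_le 1 - 1"
    using finite_dim_le_0[of "S \<inter> (top_of_set S frontier_of B)"] by (simp add: subtopology_subtopology)
  moreover have "p \<in> B" using V(2) T e(1) by (simp add: B_def)
  moreover have "B \<subseteq> V" using e(2) T by (auto simp: B_def)
  ultimately show "\<exists>U. p \<in> U \<and> U \<subseteq> V \<and> openin (top_of_set S) U \<and>
      subtopology (top_of_set S) (top_of_set S frontier_of U) dim_le 1 - 1"
    using B by blast
qed simp

lemma inverse_square_sum_eq:
  fixes g h :: real
  assumes "0 < g" "0 < h" "g\<^sup>2 + (inverse g)\<^sup>2 = h\<^sup>2 + (inverse h)\<^sup>2"
  shows "h = g \<or> h = inverse g"
proof -
  define d e where "d = inverse g" and "e = inverse h"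
  have de: "g * d = 1" "h * e = 1" using assms by (auto simp: d_def e_def)
  have "g\<^sup>2 + d\<^sup>2 = h\<^sup>2 + e\<^sup>2" using assms(3) by (simp add: d_def e_def)
  then have "(h\<^sup>2 - g\<^sup>2) * (h\<^sup>2 * g\<^sup>2 - 1) = 0" using de by algebra
  then consider "h\<^sup>2 = g\<^sup>2" | "(h * g)\<^sup>2 = 1" by (auto simp: power_mult_distrib)
  then show ?thesis
  proof cases
    case 1
    then show ?thesis using assms by (metis less_imp_le power2_eq_iff_nonneg)
  next
    case 2
    then have "h * g = 1" using assms by (metis abs_of_pos abs_square_eq_1 mult_pos_pos)
    then show ?thesis using assms by (simp add: field_simps)
  qed
qed

text \<open>
  A potential for which \<open>\<zeta>\<close> vanishes at the point \<open>w\<^sup>2\<close> of the unit circle is determined by \<open>\<gamma>\<close> and the real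
  number \<open>r\<close> with \<open>\<alpha> = r w\<close>.
\<close>

definition circle_potential :: "complex \<Rightarrow> real \<Rightarrow> real \<Rightarrow> potential" where
  "circle_potential w r g = (of_real r * w, of_real g * w\<^sup>2 + of_real (inverse g) * cnj (w\<^sup>2), g)"

definition potential_circle :: "complex \<Rightarrow> real \<Rightarrow> potential set" where
  "potential_circle w E = {circle_potential w r g | r g. 0 < g \<and> r\<^sup>2 + g\<^sup>2 + (inverse g)\<^sup>2 = E}"

definition ray_coord :: "complex \<Rightarrow> potential \<Rightarrow> real" where
  "ray_coord w q = Re (fst q * cnj w)"

context
  fixes w :: complex and E :: real
  assumes w: "norm w = 1" and E: "2 < E"
begin

lemma unit_w: "w * cnj w = 1"
  using cnj_unit[OF w] .

lemma ray_coord_circle_potential [simp]: "ray_coord w (circle_potential w r g) = r" "snd (snd (circle_potential w r g)) = g"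
proof -
  have "ray_coord w (circle_potential w r g) = Re (of_real r * (w * cnj w))"
    by (simp add: ray_coord_def circle_potential_def mult.assoc)
  then show "ray_coord w (circle_potential w r g) = r" by (simp add: unit_w)
qed (simp add: circle_potential_def)

lemma potential_circleD:
  assumes "q \<in> potential_circle w E"
  shows "circle_potential w (ray_coord w q) (snd (snd q)) = q" "0 < snd (snd q)"
    "(ray_coord w q)\<^sup>2 + (snd (snd q))\<^sup>2 + (inverse (snd (snd q)))\<^sup>2 = E"
proof -
  obtain r g where q: "q = circle_potential w r g" "0 < g" "r\<^sup>2 + g\<^sup>2 + (inverse g)\<^sup>2 = E"
    using assms unfolding potential_circle_def by blast
  show "circle_potential w (ray_coord w q) (snd (snd q)) = q" "0 < snd (snd q)"
    "(ray_coord w q)\<^sup>2 + (snd (snd q))\<^sup>2 + (inverse (snd (snd q)))\<^sup>2 = E"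
    unfolding q(1) ray_coord_circle_potential by (simp, fact q(2), fact q(3))
qed

lemma potential_circle_eqI:
  assumes "q \<in> potential_circle w E" "q' \<in> potential_circle w E" "ray_coord w q = ray_coord w q'" "snd (snd q) = snd (snd q')"
  shows "q = q'"
proof -
  have "q = circle_potential w (ray_coord w q) (snd (snd q))" by (rule potential_circleD(1)[OF assms(1), symmetric])
  also have "\<dots> = circle_potential w (ray_coord w q') (snd (snd q'))" by (simp only: assms(3,4))
  also have "\<dots> = q'" by (rule potential_circleD(1)[OF assms(2)])
  finally show ?thesis .
qed

lemma continuous_on_ray_coord: "continuous_on S (ray_coord w)"
  unfolding ray_coord_def by (intro continuous_intros)

lemma potential_circle_dim_le_1: "top_of_set (potential_circle w E) dim_le 1"
proof (rule finite_levels_dim_le_1[OF continuous_on_ray_coord continuous_on_gamma])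
  fix c
  show "finite {q \<in> potential_circle w E. ray_coord w q = c}"
  proof (cases "\<exists>g. 0 < g \<and> c\<^sup>2 + g\<^sup>2 + (inverse g)\<^sup>2 = E")
    case True
    then obtain g where g: "0 < g" "c\<^sup>2 + g\<^sup>2 + (inverse g)\<^sup>2 = E" by blast
    have "{q \<in> potential_circle w E. ray_coord w q = c} \<subseteq> {circle_potential w c g, circle_potential w c (inverse g)}"
    proof
      fix q assume "q \<in> {q \<in> potential_circle w E. ray_coord w q = c}"
      then have q: "q \<in> potential_circle w E" "ray_coord w q = c" by auto
      have "g\<^sup>2 + (inverse g)\<^sup>2 = (snd (snd q))\<^sup>2 + (inverse (snd (snd q)))\<^sup>2"
        using g(2) potential_circleD(3)[OF q(1)] unfolding q(2) by linarith
      from inverse_square_sum_eq[OF g(1) potential_circleD(2)[OF q(1)] this]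
      have "circle_potential w c (snd (snd q)) \<in> {circle_potential w c g, circle_potential w c (inverse g)}" by auto
      then show "q \<in> {circle_potential w c g, circle_potential w c (inverse g)}"
        using potential_circleD(1)[OF q(1)] unfolding q(2) by simp
    qed
    then show ?thesis by (rule finite_subset) simp
  next
    case False
    then have "{q \<in> potential_circle w E. ray_coord w q = c} = {}" using potential_circleD(2,3) by blast
    then show ?thesis by (simp only: finite.emptyI)
  qed
  show "finite {q \<in> potential_circle w E. snd (snd q) = c}"
  proof -
    have "{q \<in> potential_circle w E. snd (snd q) = c} \<subseteq>
        (\<lambda>r. circle_potential w r c) ` {sqrt (E - c\<^sup>2 - (inverse c)\<^sup>2), - sqrt (E - c\<^sup>2 - (inverse c)\<^sup>2)}"
    proof
      fix q assume "q \<in> {q \<in> potential_circle w E. snd (snd q) = c}"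
      then have q: "q \<in> potential_circle w E" "snd (snd q) = c" by auto
      let ?s = "sqrt (E - c\<^sup>2 - (inverse c)\<^sup>2)"
      have "E - c\<^sup>2 - (inverse c)\<^sup>2 = (ray_coord w q)\<^sup>2"
        using potential_circleD(3)[OF q(1)] unfolding q(2) by linarith
      then have "?s = \<bar>ray_coord w q\<bar>" by (simp only: real_sqrt_abs)
      then have "ray_coord w q = ?s \<or> ray_coord w q = - ?s" by linarith
      moreover have "q = circle_potential w (ray_coord w q) c"
        using potential_circleD(1)[OF q(1)] unfolding q(2) by simp
      ultimately show "q \<in> (\<lambda>r. circle_potential w r c) ` {?s, - ?s}" by blast
    qed
    then show ?thesis by (rule finite_subset) simp
  qed
next
  fix V p assume V: "open V" "p \<in> potential_circle w E" "p \<in> V"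
  let ?\<rho> = "\<lambda>x. circle_potential w (fst x) (snd x)"
  let ?x = "(ray_coord w p, snd (snd p))"
  have p: "?\<rho> ?x = p" "0 < snd (snd p)" using potential_circleD[OF V(2)] by auto
  have "isCont ?\<rho> ?x"
    unfolding circle_potential_def using p(2) by (intro continuous_intros) auto
  then have cont: "\<forall>d>0. \<exists>e>0. \<forall>x. dist x ?x < e \<longrightarrow> dist (?\<rho> x) (?\<rho> ?x) < d"
    by (simp only: continuous_at_eps_delta)
  have "?\<rho> ?x \<in> V" using V(3) p(1) by simp
  then obtain d where d: "d > 0" "ball (?\<rho> ?x) d \<subseteq> V" using V(1) open_contains_ball by blast
  obtain e where e: "e > 0" "\<And>x. dist x ?x < e \<Longrightarrow> dist (?\<rho> x) (?\<rho> ?x) < d"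
    using cont d(1) by meson
  show "\<exists>e>0. \<forall>q\<in>potential_circle w E. \<bar>ray_coord w q - ray_coord w p\<bar> < e \<longrightarrow> \<bar>snd (snd q) - snd (snd p)\<bar> < e \<longrightarrow> q \<in> V"
  proof (intro exI[of _ "e / 2"] conjI ballI impI)
    fix q assume q: "q \<in> potential_circle w E" "\<bar>ray_coord w q - ray_coord w p\<bar> < e / 2" "\<bar>snd (snd q) - snd (snd p)\<bar> < e / 2"
    have "dist (ray_coord w q, snd (snd q)) ?x \<le> \<bar>ray_coord w q - ray_coord w p\<bar> + \<bar>snd (snd q) - snd (snd p)\<bar>"
      unfolding dist_Pair_Pair dist_real_def by (rule order_trans[OF sqrt_sum_squares_le_sum_abs]) simp
    then have "dist (ray_coord w q, snd (snd q)) ?x < e" using q(2,3) by linarith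
    from e(2)[OF this] have "dist (?\<rho> (ray_coord w q, snd (snd q))) (?\<rho> ?x) < d" .
    then have "?\<rho> (ray_coord w q, snd (snd q)) \<in> V"
      by (intro subsetD[OF d(2)]) (simp only: mem_ball dist_commute)
    moreover have "?\<rho> (ray_coord w q, snd (snd q)) = q"
      using potential_circleD(1)[OF q(1)] by simp
    ultimately show "q \<in> V" by (simp only:)
  qed (use e(1) in simp)
qed

lemma potential_circle_two_points:
  obtains p q where "p \<in> potential_circle w E" "q \<in> potential_circle w E" "p \<noteq> q"
proof -
  let ?r = "sqrt (E - 2)"
  have "\<exists>r g. circle_potential w s 1 = circle_potential w r g \<and> 0 < g \<and> r\<^sup>2 + g\<^sup>2 + (inverse g)\<^sup>2 = E"
    if "s\<^sup>2 = E - 2" for s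
    by (rule exI[of _ s], rule exI[of _ 1]) (simp add: that)
  then have "circle_potential w ?r 1 \<in> potential_circle w E" "circle_potential w (- ?r) 1 \<in> potential_circle w E"
    unfolding potential_circle_def mem_Collect_eq using E by simp_all
  moreover have "circle_potential w ?r 1 \<noteq> circle_potential w (- ?r) 1"
  proof
    assume "circle_potential w ?r 1 = circle_potential w (- ?r) 1"
    then have "?r = - ?r" by (metis ray_coord_circle_potential(1))
    then show False using E by simp
  qed
  ultimately show thesis by (rule that)
qed

text \<open>
  Along the combination of the fields with coefficients \<open>Re w\<close> and \<open>- Im w\<close> the coordinates satisfy
  \<open>\<gamma>' = - 2 \<gamma> r\<close> and \<open>r' = 2 (\<gamma>\<^sup>2 - 1 / \<gamma>\<^sup>2)\<close>; this lemma is the second equation.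
\<close>

lemma potential_circle_direction:
  fixes r g :: real
  assumes "0 < g"
  defines "p \<equiv> circle_potential w r g"
  shows "fst (Re w *\<^sub>R field_U p + (- Im w) *\<^sub>R field_V p) * cnj w = of_real (2 * (g\<^sup>2 - (inverse g)\<^sup>2))"
proof -
  define G D w' where "G = complex_of_real g" and "D = complex_of_real (inverse g)" and "w' = cnj w"
  have GD: "G * D = 1" "cnj G = G" "cnj D = D" using assms(1) by (simp_all add: G_def D_def flip: of_real_mult)
  have w1: "w * w' = 1" using unit_w by (simp add: w'_def)
  have xy: "of_real (Re w) - \<i> * of_real (Im w) = w'" "of_real (Re w) + \<i> * of_real (Im w) = w"
    by (simp_all add: w'_def complex_eq_iff)
  define \<beta> where "\<beta> = G * w\<^sup>2 + D * w'\<^sup>2"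
  have b: "cnj \<beta> = G * w'\<^sup>2 + D * w\<^sup>2" by (simp add: \<beta>_def GD w'_def)
  have "fst (Re w *\<^sub>R field_U p + (- Im w) *\<^sub>R field_V p) =
      of_real (Re w) * (\<beta> * G - cnj \<beta> * D + (G\<^sup>2 - D\<^sup>2)) - of_real (Im w) * (\<i> * (\<beta> * G - cnj \<beta> * D - (G\<^sup>2 - D\<^sup>2)))"
    unfolding p_def circle_potential_def field_U_def field_V_def Let_def \<beta>_def G_def D_def w'_def
    by (simp add: scaleR_conv_of_real)
  also have "\<dots> = (of_real (Re w) - \<i> * of_real (Im w)) * (\<beta> * G - cnj \<beta> * D)
      + (of_real (Re w) + \<i> * of_real (Im w)) * (G\<^sup>2 - D\<^sup>2)"
    by (simp add: algebra_simps)
  also have "\<dots> = w' * (\<beta> * G - cnj \<beta> * D) + w * (G\<^sup>2 - D\<^sup>2)" by (simp only: xy)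
  finally have F: "fst (Re w *\<^sub>R field_U p + (- Im w) *\<^sub>R field_V p) = w' * (\<beta> * G - cnj \<beta> * D) + w * (G\<^sup>2 - D\<^sup>2)" .
  have "fst (Re w *\<^sub>R field_U p + (- Im w) *\<^sub>R field_V p) * w' =
      (w' * ((G * w\<^sup>2 + D * w'\<^sup>2) * G - (G * w'\<^sup>2 + D * w\<^sup>2) * D) + w * (G\<^sup>2 - D\<^sup>2)) * w'"
    unfolding F b unfolding \<beta>_def ..
  also have "\<dots> = 2 * (G\<^sup>2 - D\<^sup>2)" using w1 GD(1) by algebra
  finally show ?thesis by (simp add: w'_def G_def D_def)
qed

text \<open>
  Where \<open>r \<noteq> 0\<close>, the coordinate \<open>\<gamma>\<close> is injective on the curve near \<open>p\<close>, because the sign of \<open>r\<close> is fixed there, and it moves with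
  nonzero speed. Where \<open>r = 0\<close>, the same holds for the coordinate \<open>r\<close>, because \<open>E > 2\<close> excludes \<open>\<gamma> = 1\<close>.
\<close>

lemma potential_circle_orbit_open:
  assumes P: "potential_circle w E \<subseteq> P2" and inv: "\<And>p g. p \<in> potential_circle w E \<Longrightarrow> flow.action g p \<in> potential_circle w E"
    and p: "p \<in> potential_circle w E"
  shows "\<exists>W. open W \<and> p \<in> W \<and> potential_circle w E \<inter> W \<subseteq> action_orbit flow.action p"
proof -
  obtain r g where rg: "r = ray_coord w p" "g = snd (snd p)" by blast
  have pe: "p = circle_potential w r g" "0 < g" "r\<^sup>2 + g\<^sup>2 + (inverse g)\<^sup>2 = E"
    using potential_circleD[OF p] rg by simp_all
  have pP: "p \<in> P2" using p P by blast
  define c where "c t = flow.action (t * Re w, t * (- Im w)) p" for t :: real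
  have c0: "c 0 = p" using flow.action_zero[OF pP] by (simp add: c_def zero_prod_def)
  have contc: "continuous_on UNIV c"
    unfolding c_def[abs_def]
    by (rule continuous_on_compose2[OF flow.action_continuous[OF pP]]) (auto intro!: continuous_intros)
  have rangec: "range c \<subseteq> potential_circle w E"
    unfolding c_def by (rule image_subsetI) (rule inv[OF p])
  have orb: "range c \<subseteq> action_orbit flow.action p"
    unfolding c_def action_orbit_def by (intro image_subsetI rangeI)
  have dg: "((\<lambda>t. snd (snd (c t))) has_real_derivative - 2 * g * r) (at 0)"
  proof -
    have "Re w * Re (fst p) - (- Im w) * Im (fst p) = r * ((Re w)\<^sup>2 + (Im w)\<^sup>2)"
      unfolding pe circle_potential_def by (simp add: power2_eq_square algebra_simps)
    also have "\<dots> = r" using w by (simp add: cmod_power2[symmetric])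
    finally show ?thesis
      using gamma_line_deriv[OF pP, of "Re w" "- Im w" 0] c0 rg(2) unfolding c_def[symmetric] c_def[of 0, simplified, symmetric]
      by (simp add: c_def)
  qed
  have dr: "((\<lambda>t. ray_coord w (c t)) has_real_derivative 2 * (g\<^sup>2 - (inverse g)\<^sup>2)) (at 0)"
  proof -
    have bl: "bounded_linear (ray_coord w)"
      unfolding ray_coord_def[abs_def]
      by (intro bounded_linear_compose[OF bounded_linear_Re] bounded_linear_mult_const bounded_linear_fst)
    have "(c has_vector_derivative Re w *\<^sub>R field_U p + (- Im w) *\<^sub>R field_V p) (at 0)"
      using action_line_deriv[OF pP, of "Re w" "- Im w" 0] c0 by (simp add: c_def[abs_def])
    from bounded_linear.has_vector_derivative[OF bl this]
    have "((\<lambda>t. ray_coord w (c t)) has_vector_derivative ray_coord w (Re w *\<^sub>R field_U p + (- Im w) *\<^sub>R field_V p)) (at 0)" .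
    moreover have "ray_coord w (Re w *\<^sub>R field_U p + (- Im w) *\<^sub>R field_V p) = 2 * (g\<^sup>2 - (inverse g)\<^sup>2)"
      unfolding ray_coord_def pe(1) potential_circle_direction[OF pe(2)] by (simp only: Re_complex_of_real)
    ultimately show ?thesis by (simp only: has_real_derivative_iff_has_vector_derivative)
  qed
  have cover: "\<exists>W. open W \<and> p \<in> W \<and> potential_circle w E \<inter> W \<subseteq> action_orbit flow.action p"
    if W: "open W" "p \<in> W" and h: "continuous_on W h" "inj_on h (potential_circle w E \<inter> W)"
      and d: "((\<lambda>t. h (c t)) has_real_derivative k) (at 0)" "k \<noteq> 0" for W h k
  proof -
    have "surj (\<lambda>t. k * t)" using d(2) by (intro surjI[of _ "\<lambda>t. t / k"]) simp
    moreover have "((\<lambda>t. h (c t)) has_derivative (\<lambda>t. k * t)) (at 0)"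
      using d(1) by (simp add: has_field_derivative_def)
    moreover have "c 0 \<in> W" using c0 W(2) by simp
    ultimately obtain W' where W': "open W'" "c 0 \<in> W'" "potential_circle w E \<inter> W' \<subseteq> range c"
      using parametrization_covers_neighborhood[OF contc rangec W(1) _ h] by metis
    then show ?thesis using c0 order_trans[OF W'(3) orb] by metis
  qed
  show ?thesis
  proof (cases "r = 0")
    case False
    define W where "W = {q. 0 < r * ray_coord w q}"
    have "open W" unfolding W_def ray_coord_def by (intro open_Collect_less continuous_intros)
    moreover have "p \<in> W" using False rg by (auto simp: W_def zero_less_mult_iff)
    moreover have "inj_on (\<lambda>q. snd (snd q)) (potential_circle w E \<inter> W)"
    proof (rule inj_onI)
      fix q q' assume q: "q \<in> potential_circle w E \<inter> W" "q' \<in> potential_circle w E \<inter> W" "snd (snd q) = snd (snd q')"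
      have C: "q \<in> potential_circle w E" "q' \<in> potential_circle w E" using q by blast+
      have "(ray_coord w q)\<^sup>2 = (ray_coord w q')\<^sup>2"
        using potential_circleD(3)[OF C(1)] potential_circleD(3)[OF C(2)] unfolding q(3) by linarith
      moreover have "0 < r * ray_coord w q" "0 < r * ray_coord w q'" using q(1,2) by (simp_all add: W_def)
      ultimately have "ray_coord w q = ray_coord w q'" by (auto simp: power2_eq_iff)
      then show "q = q'" by (rule potential_circle_eqI[OF C _ q(3)])
    qed
    moreover have "- 2 * g * r \<noteq> 0" using False pe(2) by simp
    ultimately show ?thesis using cover[OF _ _ continuous_on_gamma _ dg] by blast
  next
    case True
    have g1: "g \<noteq> 1" using pe(3) E True by auto
    define W where "W = {q :: potential. 0 < (g - 1) * (snd (snd q) - 1)}"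
    have "open W" unfolding W_def by (intro open_Collect_less continuous_intros)
    moreover have "p \<in> W" using g1 rg by (auto simp: W_def zero_less_mult_iff)
    moreover have "inj_on (ray_coord w) (potential_circle w E \<inter> W)"
    proof (rule inj_onI)
      fix q q' assume q: "q \<in> potential_circle w E \<inter> W" "q' \<in> potential_circle w E \<inter> W" "ray_coord w q = ray_coord w q'"
      have C: "q \<in> potential_circle w E" "q' \<in> potential_circle w E" using q by blast+
      have pos: "0 < snd (snd q)" "0 < snd (snd q')"
        using potential_circleD(2) C by auto
      have "(snd (snd q))\<^sup>2 + (inverse (snd (snd q)))\<^sup>2 = (snd (snd q'))\<^sup>2 + (inverse (snd (snd q')))\<^sup>2"
        using potential_circleD(3)[OF C(1)] potential_circleD(3)[OF C(2)] unfolding q(3) by linarith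
      from inverse_square_sum_eq[OF pos this] have "snd (snd q') = snd (snd q)"
      proof
        assume i: "snd (snd q') = inverse (snd (snd q))"
        have "0 < (g - 1) * (snd (snd q) - 1)" "0 < (g - 1) * (inverse (snd (snd q)) - 1)"
          using q(1,2) unfolding W_def i[symmetric] by simp_all
        then have False
          using pos(1) by (auto simp: zero_less_mult_iff one_less_inverse_iff inverse_less_1_iff)
        then show ?thesis ..
      qed
      then show "q = q'" by (rule potential_circle_eqI[OF C q(3) sym])
    qed
    moreover have "2 * (g\<^sup>2 - (inverse g)\<^sup>2) \<noteq> 0"
    proof
      assume "2 * (g\<^sup>2 - (inverse g)\<^sup>2) = 0"
      then have "g = inverse g \<or> g = - inverse g" by (simp add: power2_eq_iff)
      moreover have "0 < inverse g" using pe(2) by simp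
      ultimately have "g = inverse g" using pe(2) by linarith
      then have "g\<^sup>2 = 1" using pe(2) by (metis power2_eq_square right_inverse less_irrefl)
      then show False using g1 pe(2) by (metis abs_of_pos abs_square_eq_1)
    qed
    ultimately show ?thesis using cover[OF _ _ continuous_on_ray_coord _ dr] by blast
  qed
qed

end

text \<open>
  The number \<open>E = \<bar>\<alpha>\<bar>\<^sup>2 + \<gamma>\<^sup>2 + 1 / \<gamma>\<^sup>2\<close> can be read off from the quadratic factor of \<open>a\<close>. It is at least \<open>2\<close>, and
  for \<open>E = 2\<close> the quadratic factor would be \<open>(\<lambda> - cnj z)\<^sup>2\<close>, with its root on the unit circle.
\<close>

lemma isospectral_potential_circle:
  assumes a: "a \<in> M2_2"
  obtains w E where "norm w = 1" "2 < E" "isospectral a = potential_circle w E"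
proof -
  obtain z w1 where z: "z \<in> sphere 0 1" "order z a = 2" and w1: "w1 \<notin> sphere 0 1" "order w1 a = 1" and M: "a \<in> M2"
    using a unfolding M2_2_def by fastforce
  define w where "w = csqrt z"
  have nz: "norm z = 1" using z(1) by (simp add: dist_norm)
  have w: "norm w = 1" "w\<^sup>2 = z" using nz by (simp_all add: w_def)
  have unit_w: "w * cnj w = 1" using cnj_unit[OF w(1)] .
  define E where "E q = (norm (fst q))\<^sup>2 + (snd (snd q))\<^sup>2 + (inverse (snd (snd q)))\<^sup>2" for q :: potential
  have fact: "q = circle_potential w (Re (fst q * cnj w)) (snd (snd q))" "0 < snd (snd q)"
    "E q = (Re (fst q * cnj w))\<^sup>2 + (snd (snd q))\<^sup>2 + (inverse (snd (snd q)))\<^sup>2"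
    "a = [:- z, 1:]\<^sup>2 * [:(cnj z)\<^sup>2, - (cnj z * of_real (E q)), 1:]" if q: "q \<in> isospectral a" for q
  proof -
    obtain \<alpha> \<beta> \<gamma> where qe: "q = (\<alpha>, \<beta>, \<gamma>)" by (cases q)
    have "order z a \<noteq> 0" using z(2) by simp
    note Z = isospectral_circle_root[OF q[unfolded qe] z(1) this]
    have "cnj (\<alpha> * cnj w) = \<alpha> * cnj w"
    proof -
      have "\<alpha> * cnj w = z * cnj \<alpha> * cnj w" using Z(2) by simp
      also have "\<dots> = w * (w * cnj w) * cnj \<alpha>" unfolding w(2)[symmetric] by (simp add: power2_eq_square mult_ac)
      finally show ?thesis using unit_w by (simp add: mult_ac)
    qed
    then have re: "of_real (Re (\<alpha> * cnj w)) = \<alpha> * cnj w" by (metis Reals_cnj_iff of_real_Re)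
    have al: "\<alpha> = of_real (Re (\<alpha> * cnj w)) * w" unfolding re using unit_w by (simp add: mult_ac)
    then show "q = circle_potential w (Re (fst q * cnj w)) (snd (snd q))"
      using Z(3) by (simp add: qe circle_potential_def w(2))
    show "0 < snd (snd q)" using Z(4) by (simp add: qe)
    have "(norm \<alpha>)\<^sup>2 = (Re (\<alpha> * cnj w))\<^sup>2"
      using arg_cong[OF al, of norm] w(1) by (simp add: norm_mult del: times_complex.sel)
    then show "E q = (Re (fst q * cnj w))\<^sup>2 + (snd (snd q))\<^sup>2 + (inverse (snd (snd q)))\<^sup>2"
      by (simp add: E_def qe del: times_complex.sel)
    show "a = [:- z, 1:]\<^sup>2 * [:(cnj z)\<^sup>2, - (cnj z * of_real (E q)), 1:]"
      using Z(5) by (simp add: E_def qe)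
  qed
  obtain p where p: "p \<in> isospectral a" by (rule isospectral_nonempty[OF M])
  have E_const: "E q = E p" if q: "q \<in> isospectral a" for q
  proof -
    have "[:- z, 1:]\<^sup>2 * [:(cnj z)\<^sup>2, - (cnj z * of_real (E q)), 1:] = [:- z, 1:]\<^sup>2 * [:(cnj z)\<^sup>2, - (cnj z * of_real (E p)), 1:]"
      using fact(4)[OF q] fact(4)[OF p] by simp
    then have "[:(cnj z)\<^sup>2, - (cnj z * of_real (E q)), 1:] = [:(cnj z)\<^sup>2, - (cnj z * complex_of_real (E p)), 1:]"
      by (subst (asm) mult_left_cancel) simp_all
    then show ?thesis using nz by auto
  qed
  have "2 \<le> E p"
    using inverse_square_sum(1)[OF fact(2)[OF p]] zero_le_power2[of "norm (fst p)"] unfolding E_def by linarith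
  moreover have "E p \<noteq> 2"
  proof
    assume E2: "E p = 2"
    have "poly a w1 = 0" using w1(2) order_root[of a w1] by simp
    then have "(w1 - z)\<^sup>2 * (w1 - cnj z)\<^sup>2 = 0"
      using fact(4)[OF p] unfolding E2 by (simp add: power2_eq_square algebra_simps)
    then have "w1 = z \<or> w1 = cnj z" by auto
    then show False using w1(1) nz by (auto simp: dist_norm)
  qed
  ultimately have E2: "2 < E p" by simp
  have "isospectral a = potential_circle w (E p)"
  proof
    show "isospectral a \<subseteq> potential_circle w (E p)"
    proof
      fix q assume q: "q \<in> isospectral a"
      show "q \<in> potential_circle w (E p)"
        unfolding potential_circle_def mem_Collect_eq
        using fact(1,2,3)[OF q] E_const[OF q] by metis
    qed
    show "potential_circle w (E p) \<subseteq> isospectral a"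
    proof
      fix q assume "q \<in> potential_circle w (E p)"
      then obtain r g where q: "q = circle_potential w r g" "0 < g" "r\<^sup>2 + g\<^sup>2 + (inverse g)\<^sup>2 = E p"
        unfolding potential_circle_def by blast
      have "of_real r * w = z * cnj (of_real r * w)"
        using unit_w unfolding w(2)[symmetric] by (simp add: power2_eq_square mult_ac)
      from spectral_poly_circle_factor[OF _ nz this refl, of g]
      have "spectral_poly q = [:- z, 1:]\<^sup>2 * [:(cnj z)\<^sup>2, - (cnj z * of_real (r\<^sup>2 + g\<^sup>2 + (inverse g)\<^sup>2)), 1:]"
        using q(2) w by (simp add: q(1) circle_potential_def norm_mult)
      then have "spectral_poly q = a" unfolding q(3) using fact(4)[OF p] by simp
      then show "q \<in> isospectral a"
        using q(2) by (simp add: isospectral_iff q(1) circle_potential_def)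
    qed
  qed
  then show thesis using that w(1) E2 by blast
qed

lemma M2_2_orbit:
  assumes a: "a \<in> M2_2"
  shows "transitive_action_on flow.action (isospectral a)" "one_dimensional (isospectral a)"
proof -
  obtain w E where w: "norm w = 1" "2 < E" and C: "isospectral a = potential_circle w E"
    by (rule isospectral_potential_circle[OF a])
  obtain p0 q0 where pq: "p0 \<in> potential_circle w E" "q0 \<in> potential_circle w E" "p0 \<noteq> q0"
    by (rule potential_circle_two_points[OF w])
  have p0: "p0 \<in> P2" using pq(1) unfolding C[symmetric] isospectral_iff by blast
  have fib: "spec_fibre p0 = potential_circle w E"
    using isospectral_eq_fibre[of p0 a] pq(1) unfolding C by simp
  have "transitive_action_on flow.action (spec_fibre p0)"
  proof (rule transitive_fibre[OF p0])
    fix p assume "p \<in> spec_fibre p0"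
    then show "\<exists>W. open W \<and> p \<in> W \<and> spec_fibre p0 \<inter> W \<subseteq> action_orbit flow.action p"
      using potential_circle_orbit_open[OF w, of p] fibre_action[OF p0] unfolding fib[symmetric]
      by (metis (no_types, lifting) mem_Collect_eq spec_fibre_def subsetI)
  next
    fix p q assume p: "p \<in> spec_fibre p0" and q: "q \<in> spec_fibre p0"
      and max: "\<And>g. snd (snd (flow.action g p)) \<le> snd (snd p)" "\<And>g. snd (snd (flow.action g q)) \<le> snd (snd q)"
    have PP: "p \<in> P2" "q \<in> P2" using p q by (auto simp: spec_fibre_def)
    have one: "fst r = 0 \<and> 1 \<le> snd (snd r)"
      if "r \<in> P2" "\<And>g. snd (snd (flow.action g r)) \<le> snd (snd r)" for r
    proof -
      obtain a1 a2 b1 b2 g where re: "r = (Complex a1 a2, Complex b1 b2, g)" by (rule potential_coords)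
      show ?thesis using orbit_max_second_order[OF that re] by (simp add: re complex_eq_iff)
    qed
    note op = one[OF PP(1) max(1)] and oq = one[OF PP(2) max(2)]
    have rad: "ray_coord w p = 0" "ray_coord w q = 0" using op oq by (simp_all add: ray_coord_def)
    have pos: "0 < snd (snd p)" "0 < snd (snd q)" using op oq by auto
    have "(snd (snd p))\<^sup>2 + (inverse (snd (snd p)))\<^sup>2 = (snd (snd q))\<^sup>2 + (inverse (snd (snd q)))\<^sup>2"
      using potential_circleD(3)[OF w p[unfolded fib]] potential_circleD(3)[OF w q[unfolded fib]] unfolding rad by simp
    from inverse_square_sum_eq[OF pos this] have "snd (snd p) = snd (snd q)"
    proof
      assume i: "snd (snd q) = inverse (snd (snd p))"
      have "inverse (snd (snd p)) \<le> 1" using op by (simp add: inverse_le_1_iff)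
      then have "snd (snd q) = 1" using i oq by simp
      then show ?thesis using i by (metis inverse_1 inverse_inverse_eq)
    qed simp
    then show "p = q"
      by (intro potential_circle_eqI[OF w p[unfolded fib] q[unfolded fib]]) (simp_all only: rad)
  qed
  then show tr: "transitive_action_on flow.action (isospectral a)" unfolding C fib .
  have "potential_circle w E = range (\<lambda>g. flow.action g p0)"
    using tr pq(1) unfolding transitive_action_on_def C action_orbit_def by blast
  moreover have "connected (range (\<lambda>g. flow.action g p0))"
    by (rule connected_continuous_image[OF flow.action_continuous[OF p0] connected_UNIV])
  ultimately have "connected (potential_circle w E)" by simp
  then show "one_dimensional (isospectral a)"
    unfolding one_dimensional_def C
    using connected_not_dim_le_0[OF _ pq] potential_circle_dim_le_1[OF w] by blast
qed

section \<open>Two double roots off the unit circle\<close>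

text \<open>
  The diagonal entry gives \<open>\<alpha> = r cnj \<alpha>\<close>, hence \<open>\<alpha> = 0\<close>. The sum of the two other equations gives
  \<open>(\<gamma> - 1 / \<gamma>) (1 - r\<^sup>2) = 0\<close>, hence \<open>\<gamma> = 1\<close>.
\<close>

lemma zeta_at_eq_0_iff:
  assumes p: "p \<in> P2" and r: "r \<noteq> 0" "\<bar>r\<bar> \<noteq> 1"
  shows "zeta_at p (of_real r) = 0 \<longleftrightarrow> p = (0, of_real (r + inverse r), 1)"
proof
  obtain \<alpha> \<beta> \<gamma> where pe: "p = (\<alpha>, \<beta>, \<gamma>)" by (cases p)
  define z d where "z = complex_of_real r" and "d = inverse \<gamma>"
  assume "zeta_at p (of_real r) = 0"
  then have "poly (zeta p $ 1 $ 1) z = 0" "poly (zeta p $ 1 $ 2) z = 0" "poly (zeta p $ 2 $ 1) z = 0"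
    by (simp_all add: zeta_at_def vec_eq_iff z_def)
  then have e: "z * (\<alpha> - cnj \<alpha> * z) = 0" "- of_real d + z * (\<beta> - of_real \<gamma> * z) = 0"
      "z * (of_real \<gamma> + z * (- cnj \<beta> + of_real d * z)) = 0"
    by (simp_all add: pe vector_2 d_def algebra_simps)
  have z: "z \<noteq> 0" "norm z = \<bar>r\<bar>" using r by (simp_all add: z_def)
  have "\<alpha> = cnj \<alpha> * z" using e(1) z(1) by simp
  then have "norm \<alpha> = norm \<alpha> * \<bar>r\<bar>" using z(2) by (metis complex_mod_cnj norm_mult)
  then have a: "\<alpha> = 0" using r by simp
  have "of_real \<gamma> + z * (- cnj \<beta> + of_real d * z) = 0" using e(3) z(1) by simp
  from arg_cong[OF this, of cnj] have e3: "of_real \<gamma> + z * (- \<beta> + of_real d * z) = 0"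
    by (simp add: z_def)
  have "(of_real \<gamma> - of_real d) * (1 - z\<^sup>2) = (of_real \<gamma> + z * (- \<beta> + of_real d * z)) + (- of_real d + z * (\<beta> - of_real \<gamma> * z))"
    by (simp add: algebra_simps power2_eq_square)
  also have "\<dots> = 0" unfolding e(2) e3 by simp
  finally have "(of_real \<gamma> - of_real d) * (1 - z\<^sup>2) = 0" .
  moreover have "1 - z\<^sup>2 \<noteq> 0"
  proof
    assume "1 - z\<^sup>2 = 0"
    then have "complex_of_real (r\<^sup>2) = of_real 1" by (simp add: z_def)
    then have "r\<^sup>2 = 1" using of_real_eq_iff by blast
    then show False using r(2) by (simp add: abs_square_eq_1)
  qed
  ultimately have "complex_of_real \<gamma> = of_real d" by simp
  then have gd: "\<gamma> = d" using of_real_eq_iff by blast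
  have "0 < \<gamma>" using p by (simp add: pe)
  then have "\<gamma>\<^sup>2 = 1" using gd d_def by (metis power2_eq_square right_inverse less_irrefl)
  then have g: "\<gamma> = 1" using \<open>0 < \<gamma>\<close> by (metis abs_of_pos abs_square_eq_1)
  have "z * \<beta> = 1 + z * z" using e(2) g by (simp add: d_def algebra_simps)
  then have "\<beta> = inverse z + z" using z(1) by (simp add: field_simps)
  then show "p = (0, of_real (r + inverse r), 1)" by (simp add: pe a g z_def add.commute)
next
  assume pe: "p = (0, of_real (r + inverse r), 1)"
  have "complex_of_real r * inverse (of_real r) = 1" using r by simp
  then show "zeta_at p (of_real r) = 0"
    unfolding zeta_at_def vec_eq_iff forall_2 using r(1)
    by (simp add: pe vector_2 field_simps)
qed

definition node :: "real \<Rightarrow> potential" where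
  "node r = (0, complex_of_real (r + inverse r), 1)"

definition abs_trace :: "real \<Rightarrow> real" where
  "abs_trace r = \<bar>r\<bar> + inverse \<bar>r\<bar>"

text \<open>
  The largest value of \<open>\<gamma>\<close> on the fibre.
\<close>

definition gamma_max :: "real \<Rightarrow> real" where
  "gamma_max r = max \<bar>r\<bar> (inverse \<bar>r\<bar>)"

definition sgn_root :: "real \<Rightarrow> complex" where
  "sgn_root r = (if 0 < r then 1 else \<i>)"

text \<open>
  Two arcs in the fibre, parametrized by \<open>g = \<gamma>\<close>. With \<open>t = g + 1 / g\<close> and \<open>k = abs_trace r\<close>, and for \<open>r > 0\<close>, the
  potentials of the fibre with real \<open>\<beta>\<close> and real or imaginary \<open>\<alpha>\<close> satisfy \<open>\<alpha>\<^sup>2 + \<beta> t = 2 k\<close> and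
  \<open>2 \<bar>\<alpha>\<bar>\<^sup>2 + \<beta>\<^sup>2 + t\<^sup>2 = k\<^sup>2 + 4\<close>. For real \<open>\<alpha>\<close> this gives \<open>(\<beta> - t)\<^sup>2 = (k - 2)\<^sup>2\<close>, for imaginary \<open>\<alpha>\<close> it gives
  \<open>(\<beta> + t)\<^sup>2 = (k + 2)\<^sup>2\<close>; one solution of each is taken. For \<open>r < 0\<close> the sign of \<open>\<beta>\<close> changes and \<open>\<alpha>\<close> is
  multiplied by \<open>i\<close>. The first arc avoids the node, the second one starts in it at \<open>g = 1\<close>.
\<close>

definition joining_arc :: "real \<Rightarrow> real \<Rightarrow> potential" where
  "joining_arc r g = (of_real (sqrt ((abs_trace r - (g + inverse g)) * (g + inverse g + 2))) * sgn_root r,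
    of_real (sgn r * (g + inverse g - abs_trace r + 2)), g)"

definition node_arc :: "real \<Rightarrow> real \<Rightarrow> potential" where
  "node_arc r g = (of_real (sqrt ((g + inverse g - 2) * (abs_trace r - (g + inverse g)))) * (\<i> * sgn_root r),
    of_real (sgn r * (abs_trace r + 2 - (g + inverse g))), g)"

context
  fixes a :: "complex poly" and r :: real
  assumes r: "r \<noteq> 0" "\<bar>r\<bar> \<noteq> 1"
    and iso: "\<And>p. p \<in> isospectral a \<longleftrightarrow> p \<in> P2 \<and> spec1 p = of_real (2 * (r + inverse r)) \<and> spec2 p = (r + inverse r)\<^sup>2 + 2"
    and no_circle_root: "\<forall>u. norm u = 1 \<longrightarrow> poly a u \<noteq> 0"
begin

lemma node_in: "node r \<in> isospectral a"
proof -
  have "spec1 (node r) = of_real (2 * (r + inverse r))"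
    unfolding node_def spec1_eq by (simp add: algebra_simps)
  moreover have "spec2 (node r) = (r + inverse r)\<^sup>2 + 2"
    unfolding node_def spec2_eq by (simp only: norm_of_real power2_abs) simp
  ultimately show ?thesis unfolding iso by (simp add: node_def)
qed

lemma gamma_max_facts:
  "1 < gamma_max r" "gamma_max r + inverse (gamma_max r) = abs_trace r" "2 < abs_trace r"
  "r + inverse r = sgn r * abs_trace r" "(sgn r)\<^sup>2 = 1"
  "(sgn_root r)\<^sup>2 = of_real (sgn r)" "norm (sgn_root r) = 1"
proof -
  show "1 < gamma_max r" using r by (auto simp: gamma_max_def less_max_iff_disj one_less_inverse_iff)
  have k: "abs_trace r = \<bar>r\<bar> + inverse \<bar>r\<bar>"
    by (rule abs_trace_def)
  then show sum: "gamma_max r + inverse (gamma_max r) = abs_trace r" by (auto simp: gamma_max_def max_def)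
  have "abs_trace r - 2 = (gamma_max r - 1)\<^sup>2 / gamma_max r"
    unfolding sum[symmetric] using \<open>1 < gamma_max r\<close> by (simp add: field_simps power2_eq_square)
  moreover have "0 < (gamma_max r - 1)\<^sup>2 / gamma_max r" using \<open>1 < gamma_max r\<close> by simp
  ultimately show "2 < abs_trace r" by linarith
  show "r + inverse r = sgn r * abs_trace r" unfolding k sgn_if using r(1) by (auto simp: sgn_if abs_if)
  show "(sgn r)\<^sup>2 = 1" "(sgn_root r)\<^sup>2 = of_real (sgn r)" "norm (sgn_root r) = 1" using r(1) by (auto simp: sgn_if sgn_root_def)
qed

lemma real_potential_in:
  assumes "0 < g" "norm v = 1" "v\<^sup>2 = of_real \<tau>"
    and "\<tau> * \<rho>\<^sup>2 + b * (g + inverse g) = 2 * sgn r * abs_trace r" "2 * \<rho>\<^sup>2 + b\<^sup>2 + (g + inverse g)\<^sup>2 = (abs_trace r)\<^sup>2 + 4"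
  shows "(of_real \<rho> * v, of_real b, g) \<in> isospectral a"
proof -
  have "spec1 (of_real \<rho> * v, of_real b, g) = of_real (\<tau> * \<rho>\<^sup>2 + b * (g + inverse g))"
    unfolding spec1_eq by (simp add: power_mult_distrib assms(3) algebra_simps)
  also have "\<dots> = of_real (2 * (r + inverse r))" unfolding assms(4) gamma_max_facts(4) by (simp add: mult.assoc)
  finally have 1: "spec1 (of_real \<rho> * v, of_real b, g) = of_real (2 * (r + inverse r))" .
  have "spec2 (of_real \<rho> * v, of_real b, g) = 2 * \<rho>\<^sup>2 + b\<^sup>2 + (g + inverse g)\<^sup>2 - 2"
    unfolding spec2_eq using assms(1) by (simp add: norm_mult assms(2) power2_eq_square algebra_simps)
  also have "\<dots> = (r + inverse r)\<^sup>2 + 2"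
    unfolding assms(5) gamma_max_facts(4) by (simp add: power_mult_distrib gamma_max_facts(5))
  finally show ?thesis using 1 assms(1) unfolding iso by simp
qed

lemma sum_inverse_range:
  assumes "inverse (gamma_max r) \<le> g" "g \<le> gamma_max r"
  shows "0 < g" "2 \<le> g + inverse g" "g + inverse g \<le> abs_trace r"
proof -
  have g0': "0 < inverse (gamma_max r)" "gamma_max r * inverse (gamma_max r) = 1" using gamma_max_facts(1) by auto
  show g: "0 < g" using assms(1) g0' by linarith
  have "g + inverse g - 2 = (g - 1)\<^sup>2 / g" using g by (simp add: field_simps power2_eq_square)
  moreover have "0 \<le> (g - 1)\<^sup>2 / g" using g by simp
  ultimately show "2 \<le> g + inverse g" by linarith
  have "(gamma_max r + inverse (gamma_max r)) - (g + inverse g) = (gamma_max r - g) * (g - inverse (gamma_max r)) / g"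
    using g g0' by (simp add: field_simps)
  moreover have "0 \<le> (gamma_max r - g) * (g - inverse (gamma_max r)) / g" using assms g by simp
  ultimately show "g + inverse g \<le> abs_trace r" using gamma_max_facts(2) by linarith
qed

lemma joining_arc_in:
  assumes "inverse (gamma_max r) \<le> g" "g \<le> gamma_max r"
  shows "joining_arc r g \<in> isospectral a" "joining_arc r g \<noteq> node r"
proof -
  note t = sum_inverse_range[OF assms]
  define t where "t = g + inverse g"
  have sq: "(sqrt ((abs_trace r - t) * (t + 2)))\<^sup>2 = (abs_trace r - t) * (t + 2)" using t by (simp add: t_def)
  show "joining_arc r g \<in> isospectral a"
    unfolding joining_arc_def
  proof (rule real_potential_in[OF t(1) gamma_max_facts(7,6)], unfold t_def[symmetric] sq)
    show "sgn r * ((abs_trace r - t) * (t + 2)) + sgn r * (t - abs_trace r + 2) * t = 2 * sgn r * abs_trace r" by (simp add: algebra_simps)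
    have "2 * ((abs_trace r - t) * (t + 2)) + (sgn r * (t - abs_trace r + 2))\<^sup>2 + t\<^sup>2 = 2 * ((abs_trace r - t) * (t + 2)) + (t - abs_trace r + 2)\<^sup>2 + t\<^sup>2"
      by (simp add: power_mult_distrib gamma_max_facts(5))
    also have "\<dots> = (abs_trace r)\<^sup>2 + 4" by (simp add: power2_eq_square algebra_simps)
    finally show "2 * ((abs_trace r - t) * (t + 2)) + (sgn r * (t - abs_trace r + 2))\<^sup>2 + t\<^sup>2 = (abs_trace r)\<^sup>2 + 4" .
  qed
  show "joining_arc r g \<noteq> node r"
  proof
    assume eq: "joining_arc r g = node r"
    then have g1: "g = 1" by (simp add: joining_arc_def node_def)
    have "sgn_root r \<noteq> 0" using gamma_max_facts(7) by auto
    moreover have "of_real (sqrt ((abs_trace r - (g + inverse g)) * (g + inverse g + 2))) * sgn_root r = 0"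
      using arg_cong[OF eq, of fst] unfolding joining_arc_def node_def by (simp only: fst_conv)
    ultimately have "sqrt ((abs_trace r - (g + inverse g)) * (g + inverse g + 2)) = 0"
      by (simp only: mult_eq_0_iff of_real_eq_0_iff) blast
    then show False using gamma_max_facts(3) unfolding g1 by simp
  qed
qed

lemma node_arc_in:
  assumes "1 \<le> g" "g \<le> gamma_max r"
  shows "node_arc r g \<in> isospectral a"
proof -
  have "inverse (gamma_max r) \<le> g" using assms(1) gamma_max_facts(1) inverse_le_1_iff[of "gamma_max r"] by linarith
  note t = sum_inverse_range[OF this assms(2)]
  define t where "t = g + inverse g"
  have sq: "(sqrt ((t - 2) * (abs_trace r - t)))\<^sup>2 = (t - 2) * (abs_trace r - t)" using t by (simp add: t_def)
  have v: "norm (\<i> * sgn_root r) = 1" "(\<i> * sgn_root r)\<^sup>2 = of_real (- sgn r)" using gamma_max_facts by (simp_all add: norm_mult power_mult_distrib)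
  show ?thesis
    unfolding node_arc_def
  proof (rule real_potential_in[OF t(1) v], unfold t_def[symmetric] sq)
    show "- sgn r * ((t - 2) * (abs_trace r - t)) + sgn r * (abs_trace r + 2 - t) * t = 2 * sgn r * abs_trace r" by (simp add: algebra_simps)
    have "2 * ((t - 2) * (abs_trace r - t)) + (sgn r * (abs_trace r + 2 - t))\<^sup>2 + t\<^sup>2 = 2 * ((t - 2) * (abs_trace r - t)) + (abs_trace r + 2 - t)\<^sup>2 + t\<^sup>2"
      by (simp add: power_mult_distrib gamma_max_facts(5))
    also have "\<dots> = (abs_trace r)\<^sup>2 + 4" by (simp add: power2_eq_square algebra_simps)
    finally show "2 * ((t - 2) * (abs_trace r - t)) + (sgn r * (abs_trace r + 2 - t))\<^sup>2 + t\<^sup>2 = (abs_trace r)\<^sup>2 + 4" .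
  qed
qed

lemma node_in_closure: "node r \<in> closure (isospectral a - {node r})"
proof -
  have "node_arc r ` closure {1<..<gamma_max r} \<subseteq> closure (isospectral a - {node r})"
  proof (rule image_closure_subset)
    show "continuous_on (closure {1<..<gamma_max r}) (node_arc r)"
      unfolding node_arc_def using gamma_max_facts(1) by (intro continuous_intros) auto
    have "node_arc r g \<in> isospectral a - {node r}" if "g \<in> {1<..<gamma_max r}" for g
      using node_arc_in[of g] that by (auto simp: node_arc_def node_def)
    then show "node_arc r ` {1<..<gamma_max r} \<subseteq> closure (isospectral a - {node r})"
      using closure_subset by blast
  qed simp
  moreover have "node_arc r 1 = node r"
    by (simp only: node_arc_def node_def gamma_max_facts(4)) simp
  moreover have "1 \<in> closure {1<..<gamma_max r}" using gamma_max_facts(1) by simp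
  ultimately show ?thesis by (metis image_subset_iff)
qed

lemma node_fixed: "flow.action g (node r) = node r"
  by (rule flow.action_fixed) (simp_all add: node_def field_U_def field_V_def zero_prod_def)

text \<open>
  A singular potential of the second kind in the fibre is the node, since \<open>spec1\<close> determines its \<open>\<beta>\<close>.
\<close>

lemma punctured_nonsingular:
  assumes p: "p \<in> isospectral a - {node r}"
  shows "\<not> singular p"
proof
  assume sing: "singular p"
  have pP: "p \<in> P2" "a = spectral_poly p" "spec1 p = of_real (2 * (r + inverse r))"
    using p by (simp_all add: isospectral_iff[of p a, symmetric] iso) (use p isospectral_iff in blast)
  show False
  proof (cases "fst p = 0 \<and> snd (snd p) = 1 \<and> Im (fst (snd p)) = 0")
    case True
    then obtain b where pe: "p = (0, of_real b, 1)"
      by (cases p) (metis complex_is_Real_iff Reals_cases fst_conv snd_conv)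
    then have "complex_of_real (2 * b) = of_real (2 * (r + inverse r))" using pP(3) by (simp add: spec1_eq)
    then have "2 * b = 2 * (r + inverse r)" by (simp only: of_real_eq_iff)
    then have "b = r + inverse r" by simp
    then have "p = node r" unfolding pe node_def by (simp only:)
    then show False using p by blast
  next
    case False
    then show False using singular_circle_root[OF pP(1) sing] no_circle_root pP(2) by metis
  qed
qed

lemma punctured_fibre:
  assumes "p \<in> isospectral a"
  shows "spec_fibre p = isospectral a" "p \<in> P2"
  by (rule isospectral_eq_fibre[OF assms, symmetric]) (use assms iso in blast)

lemma punctured_invariant:
  assumes p: "p \<in> isospectral a - {node r}"
  shows "flow.action g p \<in> isospectral a - {node r}"
proof -
  have P: "p \<in> isospectral a" "p \<in> P2" using p iso by blast+
  have "flow.action g p \<in> isospectral a"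
    using fibre_action[OF P(2), of p g] punctured_fibre[OF P(1)] P(1) by simp
  moreover have "flow.action g p \<noteq> node r"
  proof
    assume "flow.action g p = node r"
    then have "p = node r" using flow.action_inverse[OF P(2), of g] node_fixed[of "- g"] by simp
    then show False using p by simp
  qed
  ultimately show ?thesis by simp
qed

lemma punctured_orbit_open:
  assumes p: "p \<in> isospectral a - {node r}"
  shows "\<exists>W. open W \<and> p \<in> W \<and> (isospectral a - {node r}) \<inter> W \<subseteq> action_orbit flow.action p"
proof -
  have P: "p \<in> isospectral a" "p \<in> P2" using p iso by blast+
  obtain W where "open W" "p \<in> W" "isospectral a \<inter> W \<subseteq> action_orbit flow.action p"
    using nonsingular_orbit_open[OF P(2) punctured_nonsingular[OF p]] unfolding punctured_fibre[OF P(1)] by blast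
  then show ?thesis by blast
qed

lemma punctured_subset: "isospectral a - {node r} \<subseteq> P2"
  using iso by blast

text \<open>
  For \<open>\<alpha> = 0\<close> and \<open>\<gamma> \<noteq> 1\<close> the equations of the fibre imply that \<open>\<beta>\<close> is real and that
  \<open>(t\<^sup>2 - k\<^sup>2) (t\<^sup>2 - 4) = 0\<close>, where \<open>t = \<gamma> + 1 / \<gamma>\<close> and \<open>k = abs_trace r\<close>.
\<close>

lemma critical_potential:
  assumes p: "p \<in> isospectral a" and a0: "fst p = 0" and g1: "snd (snd p) \<noteq> 1"
  shows "p = joining_arc r (gamma_max r) \<or> p = joining_arc r (inverse (gamma_max r))"
proof -
  obtain a1 a2 b1 b2 g where pe: "p = (Complex a1 a2, Complex b1 b2, g)" by (rule potential_coords)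
  have g: "0 < g" "g \<noteq> 1" using p g1 unfolding iso by (simp_all add: pe)
  have a12: "a1 = 0" "a2 = 0" using a0 by (simp_all add: pe complex_eq_iff)
  define d where "d = inverse g"
  have gd: "g * d = 1" "0 < d" using g by (auto simp: d_def)
  have "spec1 p = of_real (2 * (sgn r * abs_trace r))" "spec2 p = (sgn r * abs_trace r)\<^sup>2 + 2" using p unfolding iso gamma_max_facts(4) by auto
  then have e: "b1 * (g + d) = 2 * sgn r * abs_trace r" "b2 * (g - d) = 0" "b1\<^sup>2 + b2\<^sup>2 + g\<^sup>2 + d\<^sup>2 = (abs_trace r)\<^sup>2 + 2"
    unfolding pe spec1_Complex spec2_Complex a12 d_def[symmetric]
    by (simp_all add: complex_eq_iff power_mult_distrib gamma_max_facts(5))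
  have "g - d \<noteq> 0"
  proof
    assume "g - d = 0"
    then have "g\<^sup>2 = 1" using gd by (simp add: power2_eq_square)
    then show False using g by (metis abs_of_pos abs_square_eq_1)
  qed
  then have b2: "b2 = 0" using e(2) by simp
  \<comment> \<open>note \<open>(g - d)\<^sup>2 = (g + d)\<^sup>2 - 4\<close>\<close>
  have "((g + d)\<^sup>2 - (abs_trace r)\<^sup>2) * (g - d)\<^sup>2 = 0"
    using e(1,3) gd(1) gamma_max_facts(5) b2 by algebra
  then have "(g + d)\<^sup>2 = (abs_trace r)\<^sup>2" using \<open>g - d \<noteq> 0\<close> by simp
  then have t: "g + d = abs_trace r" using g(1) gd(2) gamma_max_facts(3) by (metis add_pos_pos less_imp_le less_trans power2_eq_iff_nonneg zero_less_numeral)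
  have b1: "b1 = 2 * sgn r" using e(1) t gamma_max_facts(3) by simp
  have "(g - gamma_max r) * (g * gamma_max r - 1) = 0"
  proof -
    have "g + d = gamma_max r + inverse (gamma_max r)" using t gamma_max_facts(2) by simp
    moreover have "gamma_max r * inverse (gamma_max r) = 1" using gamma_max_facts(1) by simp
    ultimately show ?thesis using gd(1) by algebra
  qed
  then have "g = gamma_max r \<or> gamma_max r * g = 1" by (auto simp only: mult_eq_0_iff right_minus_eq mult.commute)
  then have "g = gamma_max r \<or> g = inverse (gamma_max r)" using inverse_unique by metis
  moreover have "joining_arc r h = (0, of_real (2 * sgn r), h)" if "h + inverse h = abs_trace r" for h
    unfolding joining_arc_def that by simp
  moreover have "p = (0, of_real (2 * sgn r), g)" by (simp add: pe a12 b1 b2 complex_eq_iff)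
  moreover have "gamma_max r + inverse (gamma_max r) = abs_trace r" "inverse (gamma_max r) + inverse (inverse (gamma_max r)) = abs_trace r" using gamma_max_facts(2) by auto
  ultimately show ?thesis by metis
qed

text \<open>
  On the compact closure of the orbit \<open>\<gamma>\<close> has a maximum and a minimum. If one of them is different from \<open>1\<close>, it is not attained at
  the node, so it is attained on the orbit. If both are \<open>1\<close>, then \<open>\<gamma>\<close> is constant on the orbit, and \<open>p\<close> is a maximum
  with \<open>\<gamma> = 1\<close>, which \<open>orbit_max_conditions\<close> excludes.
\<close>

lemma punctured_orbit_critical:
  assumes p: "p \<in> isospectral a - {node r}"
  shows "\<exists>m \<in> {joining_arc r (gamma_max r), joining_arc r (inverse (gamma_max r))}. m \<in> action_orbit flow.action p"
proof -
  let ?O = "action_orbit flow.action p"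
  have P: "p \<in> isospectral a" "p \<in> P2" using p iso by blast+
  have comp: "compact (isospectral a)" using compact_fibre[OF P(2)] punctured_fibre[OF P(1)] by simp
  have O: "?O \<subseteq> isospectral a - {node r}"
    unfolding action_orbit_def by (intro image_subsetI punctured_invariant[OF p])
  have Oc: "closure ?O \<subseteq> isospectral a"
    using O compact_imp_closed[OF comp] by (intro closure_minimal) auto
  have compO: "compact (closure ?O)" "closure ?O \<noteq> {}"
    using compact_Int_closed[OF comp closed_closure[of ?O]] Oc by (auto simp: Int_absorb1 action_orbit_def)
  have absorbed: "(isospectral a - {node r}) \<inter> closure ?O \<subseteq> ?O"
    by (rule flow.orbit_closed[OF punctured_subset punctured_invariant punctured_orbit_open p])
  have stay: "flow.action g m \<in> ?O" if "m \<in> ?O" for g m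
    using flow.action_orbit_eq[OF P(2) that] unfolding action_orbit_def by blast
  have found: "\<exists>m \<in> {joining_arc r (gamma_max r), joining_arc r (inverse (gamma_max r))}. m \<in> ?O"
    if m: "m \<in> closure ?O" "snd (snd m) \<noteq> 1"
      and ext: "(\<forall>q\<in>closure ?O. snd (snd q) \<le> snd (snd m)) \<or> (\<forall>q\<in>closure ?O. snd (snd m) \<le> snd (snd q))" for m
  proof -
    have "m \<noteq> node r" using m(2) by (auto simp: node_def)
    then have mO: "m \<in> ?O" using absorbed m(1) Oc by blast
    have mP: "m \<in> P2" "m \<in> isospectral a" using mO O punctured_subset by blast+
    have "fst m = 0"
      using ext stay[OF mO] closure_subset[of ?O] by (intro orbit_extremum_alpha[OF mP(1)]) blast
    then have "m = joining_arc r (gamma_max r) \<or> m = joining_arc r (inverse (gamma_max r))" using critical_potential[OF mP(2)] m(2) by blast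
    then show ?thesis using mO by blast
  qed
  obtain M where M: "M \<in> closure ?O" "\<And>q. q \<in> closure ?O \<Longrightarrow> snd (snd q) \<le> snd (snd M)"
    using continuous_attains_sup[OF compO continuous_on_gamma] by blast
  obtain m where m: "m \<in> closure ?O" "\<And>q. q \<in> closure ?O \<Longrightarrow> snd (snd m) \<le> snd (snd q)"
    using continuous_attains_inf[OF compO continuous_on_gamma] by blast
  have "snd (snd M) \<noteq> 1 \<or> snd (snd m) \<noteq> 1"
  proof (rule ccontr)
    assume "\<not> ?thesis"
    then have one: "snd (snd q) = 1" if "q \<in> ?O" for q
      using M(2)[of q] m(2)[of q] closure_subset[of ?O] that by force
    have pO: "p \<in> ?O" by (rule flow.action_orbit_self[OF P(2)])
    obtain a1 a2 b1 b2 g where pe: "p = (Complex a1 a2, Complex b1 b2, g)" by (rule potential_coords)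
    have "1 < g"
      by (rule orbit_max_conditions(3)[OF P(2) punctured_nonsingular[OF p] _ pe])
        (use one stay[OF pO] one[OF pO] in simp)
    then show False using one[OF pO] by (simp add: pe)
  qed
  then show ?thesis using found[OF M(1)] found[OF m(1)] M(2) m(2) by blast
qed

lemma punctured_single_orbit:
  assumes p: "p \<in> isospectral a - {node r}"
  shows "isospectral a - {node r} = action_orbit flow.action p"
proof -
  let ?K = "isospectral a - {node r}"
  have range: "inverse (gamma_max r) \<le> gamma_max r" using gamma_max_facts(1) inverse_le_1_iff[of "gamma_max r"] by linarith
  have bK: "joining_arc r ` {inverse (gamma_max r)..gamma_max r} \<subseteq> ?K"
  proof (rule image_subsetI)
    fix g assume "g \<in> {inverse (gamma_max r)..gamma_max r}"
    then show "joining_arc r g \<in> ?K" using joining_arc_in[of g] by simp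
  qed
  have "0 < inverse (gamma_max r)" using gamma_max_facts(1) by simp
  then have "continuous_on {inverse (gamma_max r)..gamma_max r} (joining_arc r)"
    unfolding joining_arc_def by (intro continuous_intros) auto
  then have conn: "connected (joining_arc r ` {inverse (gamma_max r)..gamma_max r})" by (rule connected_continuous_image) simp
  have end_in: "joining_arc r (gamma_max r) \<in> joining_arc r ` {inverse (gamma_max r)..gamma_max r}" "joining_arc r (inverse (gamma_max r)) \<in> joining_arc r ` {inverse (gamma_max r)..gamma_max r}"
    using range by auto
  have same: "joining_arc r (inverse (gamma_max r)) \<in> action_orbit flow.action (joining_arc r (gamma_max r))"
    by (rule flow.connected_in_orbit[OF punctured_subset punctured_invariant punctured_orbit_open conn bK end_in])
  have bP: "joining_arc r (gamma_max r) \<in> P2" using bK end_in punctured_subset by blast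
  have orb: "action_orbit flow.action q = action_orbit flow.action (joining_arc r (gamma_max r))" if q: "q \<in> ?K" for q
  proof -
    have qP: "q \<in> P2" using q punctured_subset by blast
    obtain m where m: "m \<in> {joining_arc r (gamma_max r), joining_arc r (inverse (gamma_max r))}" "m \<in> action_orbit flow.action q"
      using punctured_orbit_critical[OF q] by blast
    have "action_orbit flow.action m = action_orbit flow.action (joining_arc r (gamma_max r))"
      using m(1) flow.action_orbit_eq[OF bP same] by auto
    then show ?thesis using flow.action_orbit_eq[OF qP m(2)] by simp
  qed
  have "q \<in> action_orbit flow.action p" if q: "q \<in> ?K" for q
    using orb[OF q] orb[OF p] flow.action_orbit_self[of q] q punctured_subset by blast
  moreover have "action_orbit flow.action p \<subseteq> ?K"
    unfolding action_orbit_def by (intro image_subsetI punctured_invariant[OF p])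
  ultimately show ?thesis by blast
qed

lemma punctured_nonempty: "joining_arc r 1 \<in> isospectral a - {node r}"
proof -
  have "inverse (gamma_max r) \<le> 1" "1 \<le> gamma_max r" using gamma_max_facts(1) by (auto simp: inverse_le_1_iff)
  then show ?thesis using joining_arc_in[of 1] by simp
qed

lemma closure_punctured: "closure (isospectral a - {node r}) = isospectral a"
proof
  have "closed (isospectral a)"
    using compact_fibre[of "node r"] punctured_fibre[OF node_in] compact_imp_closed by auto
  then show "closure (isospectral a - {node r}) \<subseteq> isospectral a" by (intro closure_minimal) auto
  show "isospectral a \<subseteq> closure (isospectral a - {node r})"
    using node_in_closure closure_subset[of "isospectral a - {node r}"] by blast
qed

lemma K_L_sets:
  "K_set a (of_real r) = isospectral a - {node r}" "L_set a (of_real r) = {node r}"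
proof -
  have z: "zeta_at p (of_real r) = 0 \<longleftrightarrow> p = node r" "zeta_at p (inverse (cnj (of_real r))) = 0 \<longleftrightarrow> p = node r"
    if "p \<in> isospectral a" for p
  proof -
    have pP: "p \<in> P2" using that iso by blast
    show "zeta_at p (of_real r) = 0 \<longleftrightarrow> p = node r"
      unfolding node_def by (rule zeta_at_eq_0_iff[OF pP r])
    have "inverse r \<noteq> 0" "\<bar>inverse r\<bar> \<noteq> 1" using r by (auto simp: abs_inverse inverse_eq_1_iff)
    from zeta_at_eq_0_iff[OF pP this]
    show "zeta_at p (inverse (cnj (of_real r))) = 0 \<longleftrightarrow> p = node r"
      by (simp add: node_def add.commute)
  qed
  show "K_set a (of_real r) = isospectral a - {node r}"
    unfolding K_set_def using z by blast
  show "L_set a (of_real r) = {node r}"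
    unfolding L_set_def using z node_in by blast
qed

lemma punctured_submanifold: "submanifold 2 P2 (isospectral a - {node r})"
proof (rule submanifold_fibre[OF punctured_subset punctured_nonsingular])
  fix p assume p: "p \<in> isospectral a - {node r}"
  then have "spec_fibre p = isospectral a" using punctured_fibre by blast
  then show "\<exists>N. open N \<and> p \<in> N \<and> (isospectral a - {node r}) \<inter> N = spec_fibre p \<inter> N"
    using p by (intro exI[of _ "- {node r}"]) auto
qed

end

section \<open>The Lax equations and the isospectral sets\<close>

text \<open>
  The value of \<open>\<zeta>\<close> at \<open>z\<close> as a linear function of \<open>\<alpha>\<close>, \<open>\<beta>\<close>, \<open>\<gamma>\<close> and \<open>1 / \<gamma>\<close>.
\<close>

definition zeta_value :: "complex \<Rightarrow> complex \<times> complex \<times> real \<times> real \<Rightarrow> complex ^ 2 ^ 2" where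
  "zeta_value z x = (let \<alpha> = fst x; \<beta> = fst (snd x); \<gamma> = of_real (fst (snd (snd x))); \<delta> = of_real (snd (snd (snd x))) in
     vector [vector [\<alpha> * z - cnj \<alpha> * z\<^sup>2, - \<delta> + \<beta> * z - \<gamma> * z\<^sup>2],
             vector [\<gamma> * z - cnj \<beta> * z\<^sup>2 + \<delta> * z ^ 3, - \<alpha> * z + cnj \<alpha> * z\<^sup>2]])"

lemma zeta_at_eq: "zeta_at (\<alpha>, \<beta>, \<gamma>) z = zeta_value z (\<alpha>, \<beta>, \<gamma>, inverse \<gamma>)"
  unfolding zeta_at_def zeta_value_def vec_eq_iff forall_2 Let_def
  by (simp add: power2_eq_square power3_eq_cube ring_distribs mult.assoc)

lemma bounded_linear_zeta_value: "bounded_linear (zeta_value z)"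
  by (rule linear_conv_bounded_linear[THEN iffD1], rule linearI)
    (simp_all add: zeta_value_def vec_eq_iff forall_2 Let_def ring_distribs scaleR_right_diff_distrib
      scaleR_right_distrib scaleR_conv_of_real[where 'a = complex])

lemma zeta_at_deriv:
  assumes c: "(c has_vector_derivative v) (at t)" and P: "c t \<in> P2"
  shows "((\<lambda>t. zeta_at (c t) z) has_vector_derivative
    zeta_value z (fst v, fst (snd v), snd (snd v), - (inverse (snd (snd (c t))) * snd (snd v) * inverse (snd (snd (c t)))))) (at t)"
proof -
  have g0: "snd (snd (c t)) \<noteq> 0" using P by (simp add: in_P2_iff)
  have d: "((\<lambda>t. (fst (c t), fst (snd (c t)), snd (snd (c t)), inverse (snd (snd (c t))))) has_vector_derivative
      (fst v, fst (snd v), snd (snd v), - (inverse (snd (snd (c t))) * snd (snd v) * inverse (snd (snd (c t)))))) (at t)"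
    using c unfolding has_vector_derivative_def
    by (auto intro!: derivative_eq_intros g0 simp: fun_eq_iff)
  have e: "zeta_at q z = zeta_value z (fst q, fst (snd q), snd (snd q), inverse (snd (snd q)))" for q
    by (cases q) (simp add: zeta_at_eq)
  show ?thesis
    unfolding e by (rule bounded_linear.has_vector_derivative[OF bounded_linear_zeta_value d])
qed

text \<open>
  After substitution of real and imaginary part of \<open>\<alpha>\<close> the entries of both sides agree as polynomials modulo
  \<open>\<gamma> (1 / \<gamma>) = 1\<close> and \<open>z (1 / z) = 1\<close>.
\<close>

lemma lax_equation:
  assumes p: "p \<in> P2" and z: "z \<noteq> 0"
  shows "zeta_value z (fst (field_U p), fst (snd (field_U p)), snd (snd (field_U p)),
      - (inverse (snd (snd p)) * snd (snd (field_U p)) * inverse (snd (snd p)))) = commutator (zeta_at p z) (U p z)"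
    "zeta_value z (fst (field_V p), fst (snd (field_V p)), snd (snd (field_V p)),
      - (inverse (snd (snd p)) * snd (snd (field_V p)) * inverse (snd (snd p)))) = commutator (zeta_at p z) (V p z)"
proof -
  obtain \<alpha> \<beta> \<gamma> where pe: "p = (\<alpha>, \<beta>, \<gamma>)" by (cases p)
  define d where "d = inverse \<gamma>"
  define G D where "G = complex_of_real \<gamma>" and "D = complex_of_real d"
  define y where "y = inverse z"
  define a b where "a = cnj \<alpha>" and "b = cnj \<beta>"
  have GD: "G * D = 1" using p by (simp add: pe G_def D_def d_def flip: of_real_mult)
  have zy: "z * y = 1" using z by (simp add: y_def)
  have cG: "cnj G = G" "cnj D = D" by (simp_all add: G_def D_def)
  define R J where "R = complex_of_real (Re \<alpha>)" and "J = \<i> * complex_of_real (Im \<alpha>)"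
  have al: "\<alpha> = R + J" and aa: "a = R - J"
    by (simp_all add: R_def J_def a_def complex_eq_iff)
  have Im: "complex_of_real (Im \<alpha>) = - \<i> * J" by (simp add: J_def)
  have half: "(\<alpha> - a) / 2 = J" "(a - \<alpha>) / 2 = - J" "(\<alpha> + a) / 2 = R" "- (\<alpha> + a) / 2 = - R"
    by (simp_all add: al aa)
  have ca: "cnj a = \<alpha>" "cnj b = \<beta>" by (simp_all add: a_def b_def)
  note entries = pe zeta_at_eq zeta_value_def field_U_def field_V_def commutator_def U.simps V.simps
    vec_eq_iff forall_2 vector_2 matrix_matrix_mult_def sum_2 Let_def fst_conv snd_conv
    d_def[symmetric] of_real_minus of_real_mult of_real_diff of_real_power of_real_numeral
    G_def[symmetric] D_def[symmetric] y_def[symmetric] a_def[symmetric] b_def[symmetric] R_def[symmetric] Im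
    vec_lambda_beta vector_minus_component
    complex_cnj_add complex_cnj_diff complex_cnj_mult complex_cnj_power complex_cnj_numeral complex_cnj_i
    complex_cnj_minus complex_cnj_cnj cG half
  have ii: "\<i> * (\<i> * x) = - x" for x by simp
  have DG: "D * G = 1" "y * z = 1" using GD zy by (simp_all only: mult.commute)
  have "D * (G * x) = x" "G * (D * x) = x" "y * (z * x) = x" "z * (y * x) = x" for x
    by (simp_all only: mult.assoc[symmetric] GD DG zy mult_1)
  note cancel = this GD DG zy
  show "zeta_value z (fst (field_U p), fst (snd (field_U p)), snd (snd (field_U p)),
      - (inverse (snd (snd p)) * snd (snd (field_U p)) * inverse (snd (snd p)))) = commutator (zeta_at p z) (U p z)"
    unfolding entries ca unfolding al aa
    by (simp add: algebra_simps power2_eq_square power3_eq_cube cancel)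
  show "zeta_value z (fst (field_V p), fst (snd (field_V p)), snd (snd (field_V p)),
      - (inverse (snd (snd p)) * snd (snd (field_V p)) * inverse (snd (snd p)))) = commutator (zeta_at p z) (V p z)"
    unfolding entries ca unfolding al aa
    by (simp add: algebra_simps power2_eq_square power3_eq_cube cancel ii)
qed

theorem theorem2p1:
  shows "\<exists>\<phi> :: real \<times> real \<Rightarrow> potential \<Rightarrow> potential.
    additive_action_on \<phi> P2 \<and>
    (\<forall>p\<in>P2. \<forall>x y z. z \<noteq> 0 \<longrightarrow>
       ((\<lambda>x'. zeta_at (\<phi> (x', y) p) z) has_vector_derivative
          commutator (zeta_at (\<phi> (x, y) p) z) (U (\<phi> (x, y) p) z)) (at x) \<and>
       ((\<lambda>y'. zeta_at (\<phi> (x, y') p) z) has_vector_derivative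
          commutator (zeta_at (\<phi> (x, y) p) z) (V (\<phi> (x, y) p) z)) (at y)) \<and>
    (\<forall>a\<in>M2. compact (isospectral a)) \<and>
    (\<forall>a\<in>M2_1. submanifold 2 P2 (isospectral a) \<and> compact (isospectral a) \<and>
       transitive_action_on \<phi> (isospectral a)) \<and>
    (\<forall>a\<in>M2_2. one_dimensional (isospectral a) \<and> compact (isospectral a) \<and>
       transitive_action_on \<phi> (isospectral a)) \<and>
    (\<forall>a\<in>M2_3 \<union> M2_4. \<exists>p. isospectral a = {p} \<and> (\<forall>g. \<phi> g p = p)) \<and>
    (\<forall>a\<in>M2_5. \<forall>l. order l a = 2 \<longrightarrow>
       {z. order z a = 2} = {l, inverse (cnj l)} \<and>
       isospectral a = K_set a l \<union> L_set a l \<and>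
       K_set a l \<inter> L_set a l = {} \<and>
       (\<exists>p\<in>P2. K_set a l = action_orbit \<phi> p) \<and>
       (\<exists>p\<in>P2. L_set a l = action_orbit \<phi> p) \<and>
       submanifold 2 P2 (K_set a l) \<and>
       \<not> compact (K_set a l) \<and>
       top_of_set P2 closure_of K_set a l = isospectral a \<and>
       (\<exists>p. L_set a l = {p}))"
proof (intro exI[of _ flow.action] conjI ballI allI impI)
  show "additive_action_on flow.action P2"
    unfolding additive_action_on_def
    by (intro conjI ballI allI flow.action_in flow.action_zero flow.action_add)
next
  fix p x y and z :: complex
  assume p: "p \<in> P2" and z: "z \<noteq> 0"
  have q: "flow.action (x, y) p \<in> P2" by (rule flow.action_in[OF p])
  show "((\<lambda>x'. zeta_at (flow.action (x', y) p) z) has_vector_derivative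
      commutator (zeta_at (flow.action (x, y) p) z) (U (flow.action (x, y) p) z)) (at x)"
    using zeta_at_deriv[OF flow.action_deriv_fst[OF p] q, where z = z] unfolding lax_equation[OF q z] .
  show "((\<lambda>y'. zeta_at (flow.action (x, y') p) z) has_vector_derivative
      commutator (zeta_at (flow.action (x, y) p) z) (V (flow.action (x, y) p) z)) (at y)"
    using zeta_at_deriv[OF flow.action_deriv_snd[OF p] q, where z = z] unfolding lax_equation[OF q z] .
next
  have compact: "compact (isospectral a)" if a: "a \<in> M2" for a
  proof -
    obtain p where p: "p \<in> isospectral a" by (rule isospectral_nonempty[OF a])
    then have "p \<in> P2" by (simp add: isospectral_iff)
    from compact_fibre[OF this] show ?thesis by (simp only: isospectral_eq_fibre[OF p])
  qed
  then show "compact (isospectral a)" if "a \<in> M2" for a using that .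
  fix a
  show "compact (isospectral a)" if "a \<in> M2_1"
    using that by (intro compact) (simp add: M2_1_def)
  show "compact (isospectral a)" if "a \<in> M2_2"
    using that by (intro compact) (simp add: M2_2_def)
next
  fix a assume a: "a \<in> M2_1"
  then have "a \<in> M2" by (simp add: M2_1_def)
  then obtain p where p: "p \<in> isospectral a" by (rule isospectral_nonempty)
  have pP: "p \<in> P2" using p by (simp add: isospectral_iff)
  have fib: "isospectral a = spec_fibre p" by (rule isospectral_eq_fibre[OF p])
  have nonsing: "\<not> singular q" if "q \<in> spec_fibre p" for q
    using M2_1_nonsingular[OF a] that unfolding fib .
  show "transitive_action_on flow.action (isospectral a)"
    unfolding fib by (rule transitive_nonsingular_fibre[OF pP nonsing])
  show "submanifold 2 P2 (isospectral a)"
    unfolding fib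
  proof (rule submanifold_fibre[OF _ nonsing])
    show "spec_fibre p \<subseteq> P2" by (auto simp: spec_fibre_def)
    fix q assume "q \<in> spec_fibre p"
    then show "\<exists>N. open N \<and> q \<in> N \<and> spec_fibre p \<inter> N = spec_fibre q \<inter> N"
      by (intro exI[of _ UNIV]) (simp add: fibre_eq)
  qed
next
  fix a assume a: "a \<in> M2_2"
  show "transitive_action_on flow.action (isospectral a)" "one_dimensional (isospectral a)"
    by (fact M2_2_orbit[OF a])+
next
  fix a assume "a \<in> M2_3 \<union> M2_4"
  then obtain p where p: "isospectral a = {p}"
    using M2_3_single M2_4_single by blast
  then have pa: "p \<in> isospectral a" by simp
  then have pP: "p \<in> P2" by (simp add: isospectral_iff)
  have fib: "spec_fibre p = {p}" using isospectral_eq_fibre[OF pa] p by simp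
  have "flow.action g p = p" for g
    using fibre_action[OF pP, of p g] unfolding fib by simp
  then show "\<exists>p. isospectral a = {p} \<and> (\<forall>g. flow.action g p = p)" using p by blast
next
  fix a l assume a: "a \<in> M2_5" and l: "order l a = 2"
  obtain r where r: "l = of_real r" "r \<noteq> 0" "\<bar>r\<bar> \<noteq> 1" and ord: "{u. order u a = 2} = {l, inverse (cnj l)}"
    and iso: "\<forall>p. p \<in> isospectral a \<longleftrightarrow> p \<in> P2 \<and> spec1 p = of_real (2 * (r + inverse r)) \<and> spec2 p = (r + inverse r)\<^sup>2 + 2"
    and root: "\<forall>u. norm u = 1 \<longrightarrow> poly a u \<noteq> 0"
    by (rule M2_5_form[OF a l])
  note ctx = r(2,3) iso[rule_format] root
  note KL = K_L_sets[OF ctx, folded r(1)]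
  show "{z. order z a = 2} = {l, inverse (cnj l)}" by (fact ord)
  show "isospectral a = K_set a l \<union> L_set a l" "K_set a l \<inter> L_set a l = {}"
    unfolding KL using node_in[OF ctx] by blast+
  have "joining_arc r 1 \<in> P2" using punctured_nonempty[OF ctx] punctured_subset[OF ctx] by blast
  then show "\<exists>p\<in>P2. K_set a l = action_orbit flow.action p"
    unfolding KL using punctured_single_orbit[OF ctx punctured_nonempty[OF ctx]] by (rule bexI[rotated])
  have "action_orbit flow.action (node r) = {node r}"
    unfolding action_orbit_def node_fixed[OF ctx] by simp
  moreover have "node r \<in> P2" using node_in[OF ctx] iso by blast
  ultimately show "\<exists>p\<in>P2. L_set a l = action_orbit flow.action p"
    unfolding KL by (intro bexI[of _ "node r"]) simp_all
  show "submanifold 2 P2 (K_set a l)"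
    unfolding KL by (rule punctured_submanifold[OF ctx])
  show "\<not> compact (K_set a l)"
  proof
    assume "compact (K_set a l)"
    then have "closure (isospectral a - {node r}) = isospectral a - {node r}"
      unfolding KL by (intro closure_closed compact_imp_closed)
    then show False using closure_punctured[OF ctx] node_in[OF ctx] by blast
  qed
  have "isospectral a \<subseteq> P2" using iso by blast
  then show "top_of_set P2 closure_of K_set a l = isospectral a"
    unfolding KL closure_of_subtopology euclidean_closure_of
    using closure_punctured[OF ctx] punctured_subset[OF ctx] by (simp add: Int_absorb1)
  show "\<exists>p. L_set a l = {p}" unfolding KL by blast
qed

end
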